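(* If there is a polynomial-time approximate sampler for log-$\mathrm{M}^\natural$-convex distributions, then the problem {\#}BIS (counting independent sets in a bipartite graph) has a fully polynomial-time randomized approximation scheme (FPRAS).
   Context: For a finite set $N$, a set function $h\colon 2^N\to\mathbb{R}$ is $\mathrm{M}^\natural$-convex if $-h$ is $\mathrm{M}^\natural$-concave, where $f\colon 2^N\to\mathbb{R}$ is $\mathrm{M}^\natural$-concave if for all $X,Y\subseteq N$ and every $i\in X\setminus Y$, either $f(X)+f(Y)\le f(X\setminus\{i\})+f(Y\cup\{i\})$, or there exists $j\in Y\setminus X$ with $f(X)+f(Y)\le f((X\setminus\{i\})\cup\{j\})+f((Y\cup\{i\})\setminus\{j\})$. A log-$\mathrm{M}^\natural$-convex distribution is a probability distribution $\pi$ on $2^N$ with $\pi(X)\propto g(X)$, where $g>0$ and $\log g$ is $\mathrm{M}^\natural$-convex. A polynomial-time approximate sampler is a randomized algorithm that, given such a distribution and an accuracy parameter $\varepsilon>0$, outputs a random set whose distribution is within total variation distance $\varepsilon$ of $\pi$, in time polynomial in $|N|$ and $\log(1/\varepsilon)$. {\#}BIS asks for the number of independent sets of a given bipartite graph. An FPRAS for a counting problem is a randomized algorithm that, given an instance and $\varepsilon,\delta\in(0,1)$, outputs a value within a factor $(1\pm\varepsilon)$ of the true count with probability at least $1-\delta$, in time polynomial in the instance size, $1/\varepsilon$ and $\log(1/\delta)$. *)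

theory Defs
  imports
    "HOL-Probability.Probability"
    "HOL-Library.Nat_Bijection"
    "HOL-Library.Log_Nat"
    "HOL-Computational_Algebra.Polynomial"
begin

section \<open>Set functions and distributions\<close>

definition Mnat_concave :: "'a set \<Rightarrow> ('a set \<Rightarrow> real) \<Rightarrow> bool" where
  "Mnat_concave N f \<longleftrightarrow>
     (\<forall>X Y. X \<subseteq> N \<longrightarrow> Y \<subseteq> N \<longrightarrow> (\<forall>i \<in> X - Y.
        f X + f Y \<le> f (X - {i}) + f (Y \<union> {i}) \<or>
        (\<exists>j \<in> Y - X. f X + f Y \<le> f ((X - {i}) \<union> {j}) + f ((Y \<union> {i}) - {j}))))"

definition Mnat_convex :: "'a set \<Rightarrow> ('a set \<Rightarrow> real) \<Rightarrow> bool" where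
  "Mnat_convex N h \<longleftrightarrow> Mnat_concave N (\<lambda>X. - h X)"

definition log_Mnat_convex_dist :: "'a set \<Rightarrow> ('a set \<Rightarrow> real) \<Rightarrow> 'a set pmf \<Rightarrow> bool" where
  "log_Mnat_convex_dist N g \<pi> \<longleftrightarrow>
     finite N \<and> (\<forall>X. X \<subseteq> N \<longrightarrow> 0 < g X) \<and> Mnat_convex N (\<lambda>X. ln (g X)) \<and>
     set_pmf \<pi> \<subseteq> Pow N \<and>
     (\<forall>X. X \<subseteq> N \<longrightarrow> pmf \<pi> X = g X / (\<Sum>Y\<in>Pow N. g Y))"

definition tv_dist :: "'a pmf \<Rightarrow> 'a pmf \<Rightarrow> real" where
  "tv_dist p q = (SUP A. \<bar>measure_pmf.prob p A - measure_pmf.prob q A\<bar>)"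

section \<open>Randomized algorithms with an oracle\<close>

text \<open>
  Algorithms are programs over finitely many registers that hold natural numbers, with fair coin
  flips and oracle queries. Running time is measured by the logarithmic cost criterion: every
  operation is charged the bit lengths of the numbers it handles, so that the polynomial-time
  programs are, up to polynomial factors, the polynomial-time probabilistic (oracle) Turing machines.
  Unit-cost multiplication and division would be strictly more powerful.
\<close>

type_synonym state = "nat \<Rightarrow> nat"

abbreviation bits :: "nat \<Rightarrow> nat" where
  "bits \<equiv> floorlog 2"

datatype binop = Add | Sub | Mul | Div | Mod

datatype expr = Const nat | Reg nat | Bin binop expr expr

primrec apply_op :: "binop \<Rightarrow> nat \<Rightarrow> nat \<Rightarrow> nat" where
  "apply_op Add a b = a + b"
| "apply_op Sub a b = a - b"
| "apply_op Mul a b = a * b"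
| "apply_op Div a b = a div b"
| "apply_op Mod a b = a mod b"

primrec value_of :: "expr \<Rightarrow> state \<Rightarrow> nat" where
  "value_of (Const k) s = k"
| "value_of (Reg x) s = s x"
| "value_of (Bin f e1 e2) s = apply_op f (value_of e1 s) (value_of e2 s)"

primrec cost :: "expr \<Rightarrow> state \<Rightarrow> nat" where
  "cost (Const k) s = 1 + bits k"
| "cost (Reg x) s = 1 + bits (s x)"
| "cost (Bin f e1 e2) s = cost e1 s + cost e2 s + 1 + bits (value_of (Bin f e1 e2) s)"

datatype com =
    Skip
  | Assign nat expr
  | Flip nat
  | Query nat nat expr
  | Seq com com
  | If expr com com
  | While expr com

primrec query_free :: "com \<Rightarrow> bool" where
  "query_free Skip \<longleftrightarrow> True"
| "query_free (Assign x e) \<longleftrightarrow> True"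
| "query_free (Flip x) \<longleftrightarrow> True"
| "query_free (Query x y e) \<longleftrightarrow> False"
| "query_free (Seq c1 c2) \<longleftrightarrow> query_free c1 \<and> query_free c2"
| "query_free (If e c1 c2) \<longleftrightarrow> query_free c1 \<and> query_free c2"
| "query_free (While e c) \<longleftrightarrow> query_free c"

text \<open>An oracle answers a query with a pair of numbers, stored in two registers.\<close>

type_synonym oracle_fun = "nat \<Rightarrow> nat \<times> nat"

abbreviation delay :: "nat \<Rightarrow> (state \<times> nat) pmf \<Rightarrow> (state \<times> nat) pmf" where
  "delay k r \<equiv> map_pmf (\<lambda>(s, t). (s, k + t)) r"

text \<open>
  \<open>exec orc c s r\<close>: started in \<open>s\<close>, the program \<open>c\<close> terminates for every outcome of its coin
  flips, and \<open>r\<close> is the joint distribution of the final state and the running time.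
  A guard holds iff its value is nonzero. In the rules for sequencing and loops, \<open>q\<close> matters only
  on the states that are reached.
\<close>

inductive exec :: "oracle_fun \<Rightarrow> com \<Rightarrow> state \<Rightarrow> (state \<times> nat) pmf \<Rightarrow> bool"
  for orc :: oracle_fun where
  Skip: "exec orc Skip s (return_pmf (s, 1))"
| Assign: "exec orc (Assign x e) s (return_pmf (s(x := value_of e s), 1 + cost e s))"
| Flip: "exec orc (Flip x) s (map_pmf (\<lambda>b. (s(x := of_bool b), 1)) (bernoulli_pmf (1/2)))"
| Query: "orc (value_of e s) = (a, b) \<Longrightarrow>
    exec orc (Query x y e) s (return_pmf (s(x := a, y := b), 1 + cost e s + bits a + bits b))"
| Seq: "exec orc c1 s r \<Longrightarrow> (\<And>s1 t1. (s1, t1) \<in> set_pmf r \<Longrightarrow> exec orc c2 s1 (q s1)) \<Longrightarrow>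
    exec orc (Seq c1 c2) s (bind_pmf r (\<lambda>(s1, t1). delay t1 (q s1)))"
| IfTrue: "value_of e s \<noteq> 0 \<Longrightarrow> exec orc c1 s r \<Longrightarrow>
    exec orc (If e c1 c2) s (delay (1 + cost e s) r)"
| IfFalse: "value_of e s = 0 \<Longrightarrow> exec orc c2 s r \<Longrightarrow>
    exec orc (If e c1 c2) s (delay (1 + cost e s) r)"
| WhileFalse: "value_of e s = 0 \<Longrightarrow> exec orc (While e c) s (return_pmf (s, 1 + cost e s))"
| WhileTrue: "value_of e s \<noteq> 0 \<Longrightarrow> exec orc c s r \<Longrightarrow>
    (\<And>s1 t1. (s1, t1) \<in> set_pmf r \<Longrightarrow> exec orc (While e c) s1 (q s1)) \<Longrightarrow>
    exec orc (While e c) s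
      (delay (1 + cost e s) (bind_pmf r (\<lambda>(s1, t1). delay t1 (q s1))))"

lemma exec_unique:
  assumes "exec orc c s r" "exec orc c s r'"
  shows "r = r'"
  using assms
proof (induction arbitrary: r' rule: exec.induct)
  case (Seq c1 s r c2 q)
  from Seq.prems obtain r2 q2 where r2: "exec orc c1 s r2"
    and q2: "\<And>s1 t1. (s1, t1) \<in> set_pmf r2 \<Longrightarrow> exec orc c2 s1 (q2 s1)"
    and r': "r' = bind_pmf r2 (\<lambda>(s1, t1). delay t1 (q2 s1))"
    by (cases rule: exec.cases) auto
  have "r = r2" using Seq.IH(1) r2 .
  moreover have "q s1 = q2 s1" if "(s1, t1) \<in> set_pmf r" for s1 t1
    using Seq.IH(2) q2 that \<open>r = r2\<close> by blast
  ultimately show ?case unfolding r' by (intro bind_pmf_cong) auto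
next
  case (WhileTrue e s c r q)
  from WhileTrue.prems WhileTrue.hyps obtain r2 q2 where r2: "exec orc c s r2"
    and q2: "\<And>s1 t1. (s1, t1) \<in> set_pmf r2 \<Longrightarrow> exec orc (While e c) s1 (q2 s1)"
    and r': "r' = delay (1 + cost e s) (bind_pmf r2 (\<lambda>(s1, t1). delay t1 (q2 s1)))"
    by (cases rule: exec.cases) auto
  have "r = r2" using WhileTrue.IH(1) r2 .
  moreover have "q s1 = q2 s1" if "(s1, t1) \<in> set_pmf r" for s1 t1
    using WhileTrue.IH(2) q2 that \<open>r = r2\<close> by blast
  ultimately show ?case unfolding r'
    by (intro arg_cong[where f = "map_pmf _"] bind_pmf_cong) auto
next
  case Skip thus ?case by (cases rule: exec.cases) auto
next
  case Assign thus ?case by (cases rule: exec.cases) auto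
next
  case Flip thus ?case by (cases rule: exec.cases) auto
next
  case Query
  from Query.prems Query.hyps show ?case by (cases rule: exec.cases) auto
next
  case IfTrue
  from IfTrue.prems IfTrue.hyps show ?case by (cases rule: exec.cases) (auto dest: IfTrue.IH)
next
  case IfFalse
  from IfFalse.prems IfFalse.hyps show ?case by (cases rule: exec.cases) (auto dest: IfFalse.IH)
next
  case WhileFalse
  from WhileFalse.prems WhileFalse.hyps show ?case by (cases rule: exec.cases) auto
qed

definition input :: "nat list \<Rightarrow> state" where
  "input xs = (\<lambda>i. if i < length xs then xs ! i else 0)"

section \<open>Approximate samplers\<close>

text \<open>
  The distribution is given by a value oracle for \<open>g\<close>: queried on the code of \<open>X\<close>, it returns a
  numerator and a denominator of \<open>g X\<close>, each of at most \<open>b\<close> bits. A program with logarithmic cost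
  has to pay for reading these values, so \<open>b\<close> counts as part of the input size.
\<close>

definition value_oracle :: "nat \<Rightarrow> (nat set \<Rightarrow> real) \<Rightarrow> nat \<Rightarrow> oracle_fun \<Rightarrow> bool" where
  "value_oracle n g b orc \<longleftrightarrow>
     (\<forall>X. X \<subseteq> {..<n} \<longrightarrow> (\<exists>num den. orc (set_encode X) = (num, den) \<and> den \<noteq> 0 \<and>
        g X = real num / real den \<and> bits num \<le> b \<and> bits den \<le> b))"

text \<open>
  A real accuracy parameter \<open>\<epsilon>\<close> is passed to a program as the natural number \<open>\<lceil>1 / \<epsilon>\<rceil>\<close>;
  the guarantee is stated for \<open>\<epsilon>\<close> itself.
\<close>

definition poly_time_sampler :: "com \<Rightarrow> bool" where
  "poly_time_sampler c \<longleftrightarrow>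
     (\<exists>p :: nat poly. \<forall>n g \<pi> b orc (\<epsilon> :: real).
        log_Mnat_convex_dist {..<n} g \<pi> \<longrightarrow> value_oracle n g b orc \<longrightarrow> 0 < \<epsilon> \<longrightarrow>
        (\<exists>r. exec orc c (input [n, nat \<lceil>1 / \<epsilon>\<rceil>]) r \<and>
             (\<forall>(s, t) \<in> set_pmf r. t \<le> poly p (n + b + nat \<lceil>log 2 (1 / \<epsilon>)\<rceil>)) \<and>
             tv_dist (map_pmf (\<lambda>(s, t). set_decode (s 0)) r) \<pi> \<le> \<epsilon>))"

section \<open>Approximate counting\<close>

text \<open>
  A counting problem consists of a set of instances, the register contents that encode an instance,
  the instance size and the count. The output is the rational number with numerator in register 0
  and denominator in register 1. The oracle is irrelevant, since the program makes no queries.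
\<close>

definition is_fpras ::
  "'i set \<Rightarrow> ('i \<Rightarrow> nat list) \<Rightarrow> ('i \<Rightarrow> nat) \<Rightarrow> ('i \<Rightarrow> nat) \<Rightarrow> com \<Rightarrow> bool" where
  "is_fpras I enc sz cnt c \<longleftrightarrow>
     query_free c \<and>
     (\<exists>p :: nat poly. \<forall>x \<in> I. \<forall>\<epsilon> \<in> {0<..<1 :: real}. \<forall>\<delta> \<in> {0<..<1 :: real}.
        \<exists>r. exec (\<lambda>_. (0, 0)) c (input (enc x @ [nat \<lceil>1 / \<epsilon>\<rceil>, nat \<lceil>1 / \<delta>\<rceil>])) r \<and>
            (\<forall>(s, t) \<in> set_pmf r.
               t \<le> poly p (sz x + nat \<lceil>1 / \<epsilon>\<rceil> + nat \<lceil>log 2 (1 / \<delta>)\<rceil>)) \<and>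
            measure_pmf.prob r
              {(s, t). (1 - \<epsilon>) * real (cnt x) \<le> real (s 0) / real (s 1) \<and>
                       real (s 0) / real (s 1) \<le> (1 + \<epsilon>) * real (cnt x)} \<ge> 1 - \<delta>)"

text \<open>
  A graph \<open>(n, E)\<close> has the vertices \<open>0, \<dots>, n - 1\<close> and the symmetric adjacency relation \<open>E\<close>;
  bipartiteness excludes loops. It is given by \<open>n\<close> and its adjacency matrix, read as a binary number;
  no bipartition is supplied.
\<close>

type_synonym graph = "nat \<times> (nat \<times> nat) set"

definition bipartite_graphs :: "graph set" where
  "bipartite_graphs =
     {(n, E). E \<subseteq> {..<n} \<times> {..<n} \<and> sym E \<and> (\<exists>A. \<forall>(u, v) \<in> E. u \<in> A \<longleftrightarrow> v \<notin> A)}"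

definition graph_code :: "graph \<Rightarrow> nat list" where
  "graph_code = (\<lambda>(n, E). [n, set_encode ((\<lambda>(u, v). u * n + v) ` E)])"

definition independent_sets :: "graph \<Rightarrow> nat set set" where
  "independent_sets = (\<lambda>(n, E). {S. S \<subseteq> {..<n} \<and> (\<forall>u \<in> S. \<forall>v \<in> S. (u, v) \<notin> E)})"

definition BIS_fpras :: "com \<Rightarrow> bool" where
  "BIS_fpras = is_fpras bipartite_graphs graph_code fst (\<lambda>G. card (independent_sets G))"

end

theory Submission
  imports Defs "HOL-Library.Z2" "HOL-Library.Function_Algebras" "HOL-Probability.Hoeffding"
begin

text \<open>
  For a matrix over the two-element field, the rank of the submatrix with rows \<open>A\<close> and columns
  outside \<open>B\<close> equals the rank of the rows in \<open>A\<close> together with the unit vectors of \<open>B\<close>, minus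
  \<open>|B|\<close>. As a function of the set \<open>A \<union> B\<close> it is thus a matroid rank function plus a linear function,
  hence \<open>M\<close>-natural-concave, and \<open>q\<close> to the power of minus this rank is a log-\<open>M\<close>-natural-convex
  weight. Applied to the adjacency matrix of a bipartite graph and a huge \<open>q\<close>, the distribution is nearly
  uniform on the pairs \<open>(A, B)\<close> for which the submatrix vanishes. These are the independent sets
  of the bipartite double cover, that is, of two disjoint copies of the graph, so a marginal of the
  distribution gives the probability that a uniformly random independent set avoids a given vertex.
  Restricting the matrix to the vertices below \<open>m\<close> for \<open>m = 1, \<dots>, n\<close>, the estimated
  probabilities multiply up to the reciprocal of the number of independent sets. The value oracle
  is replaced by Gaussian elimination, which keeps all numbers polynomially long by adding rows
  without reducing their entries modulo 2.
\<close>

section \<open>Running times and distributions of programs\<close>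

text \<open>The estimate is arranged so that an additive error is harmless. At stage
  \<open>m\<close> the vertices from \<open>m\<close> on are kept as isolated vertices, so the
  counts start at \<open>2 ^ n\<close> and each marginal is a count divided by twice the next one.
  Adding edges never increases the count, hence each marginal is at least 1/2, and an additive error
  of \<open>3 / E\<close> is a relative error of at most \<open>6 / E\<close>. Of the three units
  \<open>1 / E\<close>, one is due to the sampler, one to the sets of nonzero rank, one to sampling.
  The double cover is used because no bipartition is supplied.

  The main obstacle is the machine model. The sampler is an unknown program with an oracle, to be
  run many times inside a query-free one: its registers are shifted and cleared before each call,
  and its queries are answered by a subprogram. Logarithmic cost makes the length of every number
  matter, so a single bound \<open>K\<close> on bit lengths governs all costs. Randomness is handled
  by couplings: a run is related outcome by outcome to an ideal process built from binomial
  distributions, and probabilities are computed only there.\<close>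

lemma rel_pmf_mono_supp:
  assumes "rel_pmf R p q" "\<And>x y. x \<in> set_pmf p \<Longrightarrow> y \<in> set_pmf q \<Longrightarrow> R x y \<Longrightarrow> R' x y"
  shows "rel_pmf R' p q"
  using assms by (rule pmf.rel_mono_strong) 

lemma rel_pmf_supp:
  assumes "rel_pmf R p q"
  shows "rel_pmf (\<lambda>x y. R x y \<and> x \<in> set_pmf p \<and> y \<in> set_pmf q) p q"
  using assms by (rule rel_pmf_mono_supp) auto

lemma rel_pmf_supp1:
  assumes "rel_pmf R p q" "x \<in> set_pmf p"
  shows "\<exists>y \<in> set_pmf q. R x y"
proof -
  from assms(1) obtain pq where pq: "\<And>x y. (x, y) \<in> set_pmf pq \<Longrightarrow> R x y"
    "map_pmf fst pq = p" "map_pmf snd pq = q"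
    by cases blast
  from assms(2) obtain y where "(x, y) \<in> set_pmf pq" unfolding pq(2)[symmetric] by auto
  moreover from this have "y \<in> set_pmf q" unfolding pq(3)[symmetric] by force
  ultimately show ?thesis using pq(1) by blast
qed

text \<open>A coupling of the run with an ideal distribution \<open>A\<close>: \<open>Q\<close>
  relates outcomes pairwise, so register contents and time are tracked by program rules while
  probabilities are computed on \<open>A\<close>. The constant oracle is the one prescribed for
  query-free programs.\<close>

definition runsT :: "com \<Rightarrow> state \<Rightarrow> 'a pmf \<Rightarrow> (state \<Rightarrow> nat \<Rightarrow> 'a \<Rightarrow> bool) \<Rightarrow> bool" where
  "runsT c s A Q \<longleftrightarrow> (\<exists>r. exec (\<lambda>_. (0, 0)) c s r \<and> rel_pmf (\<lambda>(s', t) a. Q s' t a) r A)"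

lemma runsT_mono:
  assumes "runsT c s A P" "\<And>s' t a. a \<in> set_pmf A \<Longrightarrow> P s' t a \<Longrightarrow> Q s' t a"
  shows "runsT c s A Q"
proof -
  from assms(1) obtain r where "exec (\<lambda>_. (0, 0)) c s r" "rel_pmf (\<lambda>(s', t) a. P s' t a) r A"
    unfolding runsT_def by blast
  moreover from this(2) have "rel_pmf (\<lambda>(s', t) a. Q s' t a) r A"
    by (rule rel_pmf_mono_supp) (use assms(2) in auto)
  ultimately show ?thesis unfolding runsT_def by blast
qed

lemma runsT_map:
  "runsT c s (map_pmf f A) Q \<longleftrightarrow> runsT c s A (\<lambda>s' t a. Q s' t (f a))"
  unfolding runsT_def by (simp add: pmf.rel_map case_prod_unfold)

lemma runsT_Skip: "Q s 1 a \<Longrightarrow> runsT Skip s (return_pmf a) Q"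
  unfolding runsT_def by (auto intro!: exI exec.Skip)

lemma runsT_Assign:
  "Q (s(x := value_of e s)) (1 + cost e s) a \<Longrightarrow> runsT (Assign x e) s (return_pmf a) Q"
  unfolding runsT_def by (intro exI conjI, rule exec.Assign) auto

lemma runsT_Flip:
  assumes "\<And>b. Q (s(x := of_bool b)) 1 (f b)"
  shows "runsT (Flip x) s (map_pmf f (bernoulli_pmf (1/2))) Q"
  unfolding runsT_def
  by (intro exI conjI, rule exec.Flip) (simp add: pmf.rel_map assms[simplified] rel_pmf_reflI)

lemma runsT_Seq:
  assumes c1: "runsT c1 s A P"
    and c2: "\<And>s1 t1 a. a \<in> set_pmf A \<Longrightarrow> P s1 t1 a \<Longrightarrow>
               runsT c2 s1 (F a) (\<lambda>s2 t2 b. Q s2 (t1 + t2) b)"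
  shows "runsT (Seq c1 c2) s (bind_pmf A F) Q"
proof -
  let ?o = "\<lambda>_. (0, 0)"
  from c1 obtain r where r: "exec ?o c1 s r" and rel: "rel_pmf (\<lambda>(s', t) a. P s' t a) r A"
    unfolding runsT_def by blast
  \<comment> \<open>The sequencing rule wants one result per state, whereas \<open>c2\<close> is
    known to run for each pair of a state and an ideal outcome; uniqueness of results makes the
    choice fit all of them.\<close>
  define q where "q s1 = (SOME r'. exec ?o c2 s1 r')" for s1
  have q: "exec ?o c2 s1 (q s1) \<and> rel_pmf (\<lambda>(s', t) b. Q s' (t1 + t) b) (q s1) (F a)"
    if aP: "a \<in> set_pmf A" "P s1 t1 a" for s1 t1 a
  proof -
    obtain r' where r': "exec ?o c2 s1 r'" "rel_pmf (\<lambda>(s', t) b. Q s' (t1 + t) b) r' (F a)"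
      using c2[OF aP] unfolding runsT_def by auto
    moreover from r' have "q s1 = r'"
      unfolding q_def by (metis exec_unique someI_ex)
    ultimately show ?thesis by simp
  qed
  have "exec ?o (Seq c1 c2) s (bind_pmf r (\<lambda>(s1, t1). delay t1 (q s1)))"
  proof (rule exec.Seq[OF r])
    fix s1 t1 assume "(s1, t1) \<in> set_pmf r"
    from rel_pmf_supp1[OF rel this] q show "exec ?o c2 s1 (q s1)" by auto
  qed
  moreover have "rel_pmf (\<lambda>(s', t) a. Q s' t a)
      (bind_pmf r (\<lambda>(s1, t1). delay t1 (q s1))) (bind_pmf A F)"
    by (rule rel_pmf_bindI[OF rel_pmf_supp[OF rel]])
       (use q in \<open>auto simp: pmf.rel_map case_prod_unfold\<close>)
  ultimately show ?thesis unfolding runsT_def by blast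
qed

lemma runsT_If:
  assumes "runsT (if value_of e s \<noteq> 0 then c1 else c2) s A (\<lambda>s' t a. Q s' (1 + cost e s + t) a)"
  shows "runsT (If e c1 c2) s A Q"
proof -
  from assms obtain r where r: "exec (\<lambda>_. (0, 0)) (if value_of e s \<noteq> 0 then c1 else c2) s r"
    and rel: "rel_pmf (\<lambda>(s', t) a. Q s' (1 + cost e s + t) a) r A" unfolding runsT_def by blast
  have "exec (\<lambda>_. (0, 0)) (If e c1 c2) s (delay (1 + cost e s) r)"
    using r exec.IfTrue[of e s _ c1 r c2] exec.IfFalse[of e s _ c2 r c1]
    by (cases "value_of e s = 0") (auto simp del: plus_nat.simps add_Suc)
  moreover have "rel_pmf (\<lambda>(s', t) a. Q s' t a) (delay (1 + cost e s) r) A"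
    using rel by (simp add: pmf.rel_map case_prod_unfold)
  ultimately show ?thesis unfolding runsT_def by blast
qed

lemma runsT_WhileFalse:
  "value_of e s = 0 \<Longrightarrow> Q s (1 + cost e s) a \<Longrightarrow> runsT (While e c) s (return_pmf a) Q"
  unfolding runsT_def by (intro exI conjI, erule exec.WhileFalse) auto

lemma runsT_WhileTrue:
  assumes "value_of e s \<noteq> 0"
    and "runsT (Seq c (While e c)) s A (\<lambda>s' t a. Q s' (1 + cost e s + t) a)"
  shows "runsT (While e c) s A Q"
proof -
  from assms obtain r where r: "exec (\<lambda>_. (0, 0)) (Seq c (While e c)) s r"
    and rel: "rel_pmf (\<lambda>(s', t) a. Q s' (1 + cost e s + t) a) r A" unfolding runsT_def by blast
  from r have "exec (\<lambda>_. (0, 0)) (While e c) s (delay (1 + cost e s) r)"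
  proof (cases rule: exec.cases)
    case (Seq r' q)
    show ?thesis unfolding Seq(1) by (rule exec.WhileTrue[OF assms(1)]) (use Seq in auto)
  qed
  moreover have "rel_pmf (\<lambda>(s', t) a. Q s' t a) (delay (1 + cost e s) r) A"
    using rel by (simp add: pmf.rel_map case_prod_unfold)
  ultimately show ?thesis unfolding runsT_def by blast
qed

definition runs :: "com \<Rightarrow> state \<Rightarrow> nat \<Rightarrow> 'a pmf \<Rightarrow> (state \<Rightarrow> 'a \<Rightarrow> bool) \<Rightarrow> bool" where
  "runs c s B A Q \<longleftrightarrow> runsT c s A (\<lambda>s' t a. t \<le> B \<and> Q s' a)"

lemma runs_mono:
  assumes "runs c s B A P" "B \<le> B'" "\<And>s' a. a \<in> set_pmf A \<Longrightarrow> P s' a \<Longrightarrow> Q s' a"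
  shows "runs c s B' A Q"
  using assms unfolding runs_def by (fastforce intro: runsT_mono)

lemma runs_le: "runs c s B A Q \<Longrightarrow> B \<le> B' \<Longrightarrow> runs c s B' A Q"
  by (rule runs_mono)

lemma runs_Assign:
  "1 + cost e s \<le> B \<Longrightarrow> Q (s(x := value_of e s)) a \<Longrightarrow> runs (Assign x e) s B (return_pmf a) Q"
  unfolding runs_def by (intro runsT_Assign conjI)

lemma runs_Seq:
  assumes "runs c1 s B1 A P"
    and "\<And>s1 a. a \<in> set_pmf A \<Longrightarrow> P s1 a \<Longrightarrow> runs c2 s1 B2 (F a) Q"
  shows "runs (Seq c1 c2) s (B1 + B2) (bind_pmf A F) Q"
  unfolding runs_def
proof (rule runsT_Seq[OF assms(1)[unfolded runs_def]])
  fix s1 t1 a assume a: "a \<in> set_pmf A" "t1 \<le> B1 \<and> P s1 a"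
  have "runs c2 s1 B2 (F a) Q" using assms(2) a by blast
  then show "runsT c2 s1 (F a) (\<lambda>s' t a. t1 + t \<le> B1 + B2 \<and> Q s' a)"
    unfolding runs_def by (rule runsT_mono) (use a in auto)
qed

lemma runs_Seq_det:
  assumes "runs c1 s B1 (return_pmf ()) (\<lambda>s1 _. runs c2 s1 B2 A Q)"
  shows "runs (Seq c1 c2) s (B1 + B2) A Q"
  using runs_Seq[OF assms, where F = "\<lambda>_. A" and Q = Q and ?B2.0 = B2]
  by (simp add: bind_return_pmf)

lemma runs_Assign_Seq:
  "1 + cost e s \<le> U \<Longrightarrow> runs c (s(x := value_of e s)) B A Q \<Longrightarrow>
   runs (Seq (Assign x e) c) s (U + B) A Q"
  by (rule runs_Seq_det) (rule runs_Assign)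

lemma runs_If:
  assumes "1 + cost e s \<le> U"
    and "value_of e s \<noteq> 0 \<Longrightarrow> runs c1 s B A Q" "value_of e s = 0 \<Longrightarrow> runs c2 s B A Q"
  shows "runs (If e c1 c2) s (U + B) A Q"
proof -
  have "runs (if value_of e s \<noteq> 0 then c1 else c2) s B A Q" using assms(2,3) by simp
  then show ?thesis unfolding runs_def
    by (intro runsT_If, elim runsT_mono) (use assms(1) in auto)
qed

text \<open>Rounds are indexed by the number of rounds that remain afterwards, matching counters
  that run down to zero.\<close>

primrec iterate :: "(nat \<Rightarrow> 'a \<Rightarrow> 'a pmf) \<Rightarrow> nat \<Rightarrow> 'a \<Rightarrow> 'a pmf" where
  "iterate F 0 a = return_pmf a"
| "iterate F (Suc j) a = bind_pmf (F j a) (iterate F j)"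

text \<open>The index \<open>j\<close> is a ghost count of the remaining rounds: register
  \<open>i\<close> only has to vanish exactly when \<open>j\<close> does, which also covers a loop
  that halves its register. \<open>U\<close> pays for the guard, once per round and once more at the
  exit.\<close>

lemma runs_loop:
  assumes body: "\<And>j s a. Inv (Suc j) s a \<Longrightarrow> j < k \<Longrightarrow> runs c s B (F j a) (Inv j)"
    and guard: "\<And>j s a. Inv j s a \<Longrightarrow> j \<le> k \<Longrightarrow> (s i = 0 \<longleftrightarrow> j = 0) \<and> 2 + bits (s i) \<le> U"
    and init: "Inv k s a"
  shows "runs (While (Reg i) c) s (k * (U + B) + U) (iterate F k a) (Inv 0)"
proof -
  have "runs (While (Reg i) c) s (j * (U + B) + U) (iterate F j a) (Inv 0)"
    if "Inv j s a" "j \<le> k" for j s a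
    using that
  proof (induction j arbitrary: s a)
    case 0
    with guard[OF 0] show ?case unfolding runs_def
      by (auto intro!: runsT_WhileFalse)
  next
    case (Suc j)
    have g: "s i \<noteq> 0" "2 + bits (s i) \<le> U" using guard[OF Suc.prems] by auto
    have "runs (Seq c (While (Reg i) c)) s (B + (j * (U + B) + U)) (iterate F (Suc j) a) (Inv 0)"
      unfolding iterate.simps
      by (rule runs_Seq[OF body[OF Suc.prems(1)]]) (use Suc in auto)
    then show ?case unfolding runs_def
      by (intro runsT_WhileTrue, (use g in simp), elim runsT_mono) (use g in auto)
  qed
  then show ?thesis using init by blast
qed

lemma iterate_return: "iterate (\<lambda>_. return_pmf) k a = return_pmf a"
  by (induction k) (auto simp: bind_return_pmf)

lemma runs_loop_det:
  assumes "\<And>j s. Inv (Suc j) s \<Longrightarrow> j < k \<Longrightarrow> runs c s B (return_pmf ()) (\<lambda>s' _. Inv j s')"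
    and "\<And>j s. Inv j s \<Longrightarrow> j \<le> k \<Longrightarrow> (s i = 0 \<longleftrightarrow> j = 0) \<and> 2 + bits (s i) \<le> U"
    and "Inv k s"
  shows "runs (While (Reg i) c) s (k * (U + B) + U) (return_pmf ()) (\<lambda>s' _. Inv 0 s')"
proof -
  have "runs (While (Reg i) c) s (k * (U + B) + U) (iterate (\<lambda>_. return_pmf) k ()) (\<lambda>s' _. Inv 0 s')"
    by (rule runs_loop[where Inv = "\<lambda>j s _. Inv j s"]) (use assms in auto)
  then show ?thesis by (simp add: iterate_return)
qed

lemma runs_count_det:
  assumes "\<And>j s. Inv (Suc j) s \<Longrightarrow> j < k \<Longrightarrow> runs c s B (return_pmf ()) (\<lambda>s' _. Inv j s')"
    and guard: "\<And>j s. Inv j s \<Longrightarrow> j \<le> k \<Longrightarrow> s i = j \<and> 2 + bits j \<le> U"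
    and "Inv k s"
  shows "runs (While (Reg i) c) s (k * (U + B) + U) (return_pmf ()) (\<lambda>s' _. Inv 0 s')"
  by (rule runs_loop_det) (use assms(1,3) in \<open>auto dest: guard\<close>)

section \<open>Bit lengths and costs of expressions\<close>

primrec reads :: "expr \<Rightarrow> nat set" where
  "reads (Const k) = {}"
| "reads (Reg x) = {x}"
| "reads (Bin f e1 e2) = reads e1 \<union> reads e2"

text \<open>For a fixed expression this is linear in \<open>K\<close>, so side conditions on costs
  become numerical inequalities. The last equation covers \<open>Sub\<close>, \<open>Div\<close> and
  \<open>Mod\<close>, whose results never exceed the first operand.\<close>

fun value_bits :: "nat \<Rightarrow> expr \<Rightarrow> nat" where
  "value_bits K (Const k) = k"
| "value_bits K (Reg x) = K"
| "value_bits K (Bin Add e1 e2) = value_bits K e1 + value_bits K e2 + 1"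
| "value_bits K (Bin Mul e1 e2) = value_bits K e1 + value_bits K e2"
| "value_bits K (Bin f e1 e2) = value_bits K e1"

primrec cost_bound :: "nat \<Rightarrow> expr \<Rightarrow> nat" where
  "cost_bound K (Const k) = 1 + k"
| "cost_bound K (Reg x) = 1 + K"
| "cost_bound K (Bin f e1 e2) = cost_bound K e1 + cost_bound K e2 + 1 + value_bits K (Bin f e1 e2)"

lemma bits_le_iff: "bits x \<le> K \<longleftrightarrow> x < 2 ^ K"
  by (simp add: floorlog_le_iff)

lemma bits_le: "bits x \<le> x"
  by (simp add: bits_le_iff)

lemma value_less:
  assumes "\<forall>x\<in>reads e. s x < 2 ^ K"
  shows "value_of e s < 2 ^ value_bits K e"
  using assms
proof (induction e)
  case (Bin f e1 e2)
  define a b where ab: "a = value_of e1 s" "b = value_of e2 s"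
  define p q where pq: "p = value_bits K e1" "q = value_bits K e2"
  from Bin have lt: "a < 2 ^ p" "b < 2 ^ q" by (auto simp: ab pq)
  have add: "a + b < 2 ^ (p + q + 1)"
  proof -
    have "(2::nat) ^ p \<le> 2 ^ (p + q)" "(2::nat) ^ q \<le> 2 ^ (p + q)" by simp_all
    then show ?thesis using lt unfolding power_add power_one_right by linarith
  qed
  have mul: "a * b < 2 ^ (p + q)"
    using mult_strict_mono[OF lt] by (simp add: power_add)
  have "a div b < 2 ^ p" "a mod b < 2 ^ p" "a - b < 2 ^ p"
    using lt(1) div_le_dividend[of a b] mod_less_eq_dividend[of a b] by (meson le_less_trans diff_le_self)+
  with add mul show ?case by (cases f) (auto simp: ab pq)
qed auto

lemma cost_le:
  assumes "\<forall>x\<in>reads e. s x < 2 ^ K"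
  shows "cost e s \<le> cost_bound K e"
  using assms
proof (induction e)
  case (Const k) then show ?case using bits_le[of k] by simp
next
  case (Reg x) then show ?case by (simp add: bits_le_iff)
next
  case (Bin f e1 e2)
  have "bits (value_of (Bin f e1 e2) s) \<le> value_bits K (Bin f e1 e2)"
    using value_less[OF Bin.prems] by (simp add: bits_le_iff del: value_of.simps)
  with Bin show ?case by fastforce
qed

lemma cost_less:
  assumes "\<forall>x\<in>reads e. s x < 2 ^ K" "cost_bound K e < U"
  shows "1 + cost e s \<le> U"
  using cost_le[OF assms(1)] assms(2) by simp

section \<open>Registers left unchanged, and growth of register contents\<close>

primrec writes :: "com \<Rightarrow> nat set" where
  "writes Skip = {}"
| "writes (Assign x e) = {x}"
| "writes (Flip x) = {x}"
| "writes (Query x y e) = {x, y}"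
| "writes (Seq c1 c2) = writes c1 \<union> writes c2"
| "writes (If e c1 c2) = writes c1 \<union> writes c2"
| "writes (While e c) = writes c"

lemma finite_writes: "finite (writes c)"
  by (induction c) auto

text \<open>Meant for the unknown sampler: registers that it does not write stay zero, so clearing
  finitely many of them restores its start state.\<close>

lemma exec_frame:
  "exec orc c s r \<Longrightarrow> (s', t) \<in> set_pmf r \<Longrightarrow> x \<notin> writes c \<Longrightarrow> s' x = s x"
proof (induction arbitrary: s' t rule: exec.induct)
  case (Seq c1 s r c2 q)
  then obtain s1 t1 t2 where "(s1, t1) \<in> set_pmf r" "(s', t2) \<in> set_pmf (q s1)" by auto
  with Seq.IH(1)[of s1 t1] Seq.IH(2)[of s1 t1 s' t2] Seq.prems show ?case by simp
next
  case (WhileTrue e s c r q)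
  then obtain s1 t1 t2 where "(s1, t1) \<in> set_pmf r" "(s', t2) \<in> set_pmf (q s1)" by auto
  with WhileTrue.IH(1)[of s1 t1] WhileTrue.IH(2)[of s1 t1 s' t2] WhileTrue.prems show ?case by simp
next
  case (IfTrue e s c1 r c2)
  then obtain t1 where "(s', t1) \<in> set_pmf r" by auto
  with IfTrue.IH[of s' t1] IfTrue.prems show ?case by simp
next
  case (IfFalse e s c2 r c1)
  then obtain t1 where "(s', t1) \<in> set_pmf r" by auto
  with IfFalse.IH[of s' t1] IfFalse.prems show ?case by simp
qed auto

lemma bits_value_le_cost: "bits (value_of e s) \<le> cost e s"
  by (cases e) auto

text \<open>Writing a number costs at least its bit length, so the output of the sampler is bounded
  by its input and its running time.\<close>

lemma exec_bits:
  "exec orc c s r \<Longrightarrow> (s', t) \<in> set_pmf r \<Longrightarrow> bits (s' x) \<le> bits (s x) + t"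
proof (induction arbitrary: s' t rule: exec.induct)
  case (Assign y e s) then show ?case using bits_value_le_cost[of e s] by auto
next
  case (Flip y s)
  then obtain b where "s' = s(y := of_bool b)" "t = 1" by auto
  moreover have "bits (of_bool b) \<le> 1" by (cases b) (simp_all add: bits_le_iff)
  ultimately show ?case by (cases "x = y") simp_all
next
  case (Seq c1 s r c2 q)
  then obtain s1 t1 t2 where "(s1, t1) \<in> set_pmf r" "(s', t2) \<in> set_pmf (q s1)" "t = t1 + t2"
    by auto
  with Seq.IH(1)[of s1 t1] Seq.IH(2)[of s1 t1 s' t2] show ?case by linarith
next
  case (WhileTrue e s c r q)
  then obtain s1 t1 t2 where "(s1, t1) \<in> set_pmf r" "(s', t2) \<in> set_pmf (q s1)"
    "t = 1 + cost e s + (t1 + t2)" by auto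
  with WhileTrue.IH(1)[of s1 t1] WhileTrue.IH(2)[of s1 t1 s' t2] show ?case by linarith
next
  case (IfTrue e s c1 r c2)
  then obtain t1 where "(s', t1) \<in> set_pmf r" "t = 1 + cost e s + t1" by auto
  with IfTrue.IH[of s' t1] show ?case by linarith
next
  case (IfFalse e s c2 r c1)
  then obtain t1 where "(s', t1) \<in> set_pmf r" "t = 1 + cost e s + t1" by auto
  with IfFalse.IH[of s' t1] show ?case by linarith
qed auto

section \<open>Matroid rank functions over the two-element field\<close>

context vector_space begin

text \<open>The vectors will be functions on \<open>nat\<close>, a space of infinite dimension, so
  the dimension is controlled through finite spanning sets.\<close>

lemma dim_insert_finite:
  assumes "finite S"
  shows "dim (insert x S) = (if x \<in> span S then dim S else Suc (dim S))"
proof (cases "x \<in> span S")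
  case True
  then have "span (insert x S) = span S" by (simp add: span_redundant)
  then have "dim (span (insert x S)) = dim (span S)" by simp
  then show ?thesis using True by (simp only: dim_span if_True)
next
  case False
  obtain B where B: "B \<subseteq> S" "independent B" "S \<subseteq> span B" "card B = dim S"
    using basis_exists by blast
  have fin: "finite B" using B(1) assms finite_subset by blast
  have x: "x \<notin> span B" using False span_mono[OF B(1)] by blast
  then have "x \<notin> B" using span_base by blast
  then have "card (insert x B) = Suc (dim S)" using fin B(4) by simp
  moreover have "independent (insert x B)" using x B(2) by (simp add: independent_insertI)
  moreover have "insert x S \<subseteq> span (insert x B)"
    using B(3) span_mono[of B "insert x B"] span_base[of x "insert x B"] by blast
  ultimately have "dim (insert x S) = Suc (dim S)"
    using B(1) by (intro dim_unique[of "insert x B"]) auto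
  then show ?thesis using False by simp
qed

lemma span_eqI: "S \<subseteq> span T \<Longrightarrow> T \<subseteq> span S \<Longrightarrow> span S = span T"
  by (simp add: span_minimal subset_antisym subspace_span)

lemma dim_eqI: "S \<subseteq> span T \<Longrightarrow> T \<subseteq> span S \<Longrightarrow> dim S = dim T"
  by (metis span_eqI dim_span)

lemma dim_mono_finite:
  assumes "finite T" "S \<subseteq> T" shows "dim S \<le> dim T"
proof -
  have "dim S \<le> dim (U \<union> S)" if "finite U" for U
    using that
  proof induction
    case (insert x U)
    have "finite S" using assms finite_subset by blast
    with insert have "dim (insert x (U \<union> S)) \<ge> dim (U \<union> S)" by (simp add: dim_insert_finite)
    with insert show ?case by simp
  qed simp
  from this[OF assms(1)] show ?thesis using assms(2) by (simp add: Un_absorb2)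
qed

text \<open>
  If removing \<open>i\<close> from \<open>X\<close> lowers the rank although \<open>i\<close> is spanned by \<open>Y\<close>, then a minimal subset
  of \<open>Y\<close> spanning \<open>i\<close> contains some \<open>j\<close> outside the span of \<open>X - {i}\<close>, which can be exchanged for \<open>i\<close>.
\<close>

lemma Mnat_concave_dim:
  fixes \<psi> :: "'i \<Rightarrow> 'b"
  assumes N: "finite N"
  shows "Mnat_concave N (\<lambda>S. real (dim (\<psi> ` S)))"
  unfolding Mnat_concave_def
proof (intro allI impI ballI)
  fix X Y i assume X: "X \<subseteq> N" and Y: "Y \<subseteq> N" and i: "i \<in> X - Y"
  let ?D = "\<lambda>S. dim (\<psi> ` S)"
  have fin: "finite X" "finite Y" using X Y N finite_subset by auto
  have ins: "?D (insert x S) = (if \<psi> x \<in> span (\<psi> ` S) then ?D S else Suc (?D S))"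
    if "finite S" for x S using that by (simp add: dim_insert_finite)
  have Xi: "insert i (X - {i}) = X" using i by blast
  have DX: "?D X = (if \<psi> i \<in> span (\<psi> ` (X - {i})) then ?D (X - {i}) else Suc (?D (X - {i})))"
    using ins[of "X - {i}" i] fin unfolding Xi by simp
  have DY: "?D (Y \<union> {i}) = (if \<psi> i \<in> span (\<psi> ` Y) then ?D Y else Suc (?D Y))"
    using ins[of Y i] fin by simp
  show "real (?D X) + real (?D Y) \<le> real (?D (X - {i})) + real (?D (Y \<union> {i})) \<or>
    (\<exists>j\<in>Y - X. real (?D X) + real (?D Y)
      \<le> real (?D (X - {i} \<union> {j})) + real (?D (Y \<union> {i} - {j})))"
  proof (cases "\<psi> i \<in> span (\<psi> ` (X - {i})) \<or> \<psi> i \<notin> span (\<psi> ` Y)")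
    \<comment> \<open>Either deleting \<open>i\<close> from \<open>X\<close> costs no rank, or
      adding it to \<open>Y\<close> gains one while the deletion costs at most one.\<close>
    case True
    then show ?thesis using DX DY by auto
  next
    case False
    define P where "P k \<longleftrightarrow> (\<exists>Z. Z \<subseteq> Y \<and> \<psi> i \<in> span (\<psi> ` Z) \<and> card Z = k)" for k
    have "P (card Y)" using False unfolding P_def by blast
    then have "P (LEAST k. P k)" by (rule LeastI)
    then obtain Z where Z: "Z \<subseteq> Y" "\<psi> i \<in> span (\<psi> ` Z)" "card Z = (LEAST k. P k)"
      unfolding P_def by blast
    have finZ: "finite Z" using Z fin finite_subset by blast
    obtain j where j: "j \<in> Z" "\<psi> j \<notin> span (\<psi> ` (X - {i}))"
      using Z(2) False span_minimal[of "\<psi> ` Z" "span (\<psi> ` (X - {i}))"] subspace_span by blast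
    have "\<psi> i \<notin> span (\<psi> ` (Z - {j}))"
    proof
      assume "\<psi> i \<in> span (\<psi> ` (Z - {j}))"
      then have "P (card (Z - {j}))" unfolding P_def using Z(1) by blast
      then have "card Z \<le> card (Z - {j})" unfolding Z(3) by (rule Least_le)
      then show False using card_Diff1_less[OF finZ j(1)] by linarith
    qed
    moreover have "insert (\<psi> j) (\<psi> ` (Z - {j})) = \<psi> ` Z" using j(1) by auto
    then have "\<psi> i \<in> span (insert (\<psi> j) (\<psi> ` (Z - {j})))" by (simp only: Z(2))
    ultimately have 1: "\<psi> j \<in> span (insert (\<psi> i) (\<psi> ` (Z - {j})))"
      by (rule in_span_insert[rotated])
    have "i \<noteq> j" using i j(1) Z(1) by blast
    then have "insert (\<psi> i) (\<psi> ` (Z - {j})) \<subseteq> \<psi> ` (Y \<union> {i} - {j})"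
      using Z(1) by auto
    from subsetD[OF span_mono[OF this] 1] have jY: "\<psi> j \<in> span (\<psi> ` (Y \<union> {i} - {j}))" .
    have "j \<in> Y" using j Z by blast
    moreover from this have "j \<noteq> i" using i by blast
    then have "j \<notin> X" using j(2) span_base[of "\<psi> j" "\<psi> ` (X - {i})"] by auto
    moreover have "?D (X - {i} \<union> {j}) = Suc (?D (X - {i}))"
      using ins[of "X - {i}" j] fin j(2) by simp
    moreover have "insert j (Y \<union> {i} - {j}) = Y \<union> {i}" using \<open>j \<in> Y\<close> by blast
    then have "?D (Y \<union> {i}) = ?D (Y \<union> {i} - {j})"
      using ins[of "Y \<union> {i} - {j}" j] fin jY by simp
    ultimately show ?thesis using DX DY False by (intro disjI2 bexI[of _ j]) auto
  qed
qed

end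

text \<open>Both kinds of exchange preserve the multiset sum of the two sets, so a modular term adds
  the same amount to both sides.\<close>

lemma Mnat_concave_linear:
  assumes f: "Mnat_concave N f" and "finite N" and "c \<ge> 0"
  shows "Mnat_concave N (\<lambda>S. c * (f S + sum w S))"
  unfolding Mnat_concave_def
proof (intro allI impI ballI)
  fix X Y i assume XY: "X \<subseteq> N" "Y \<subseteq> N" and i: "i \<in> X - Y"
  have fin: "finite X" "finite Y" using XY assms(2) finite_subset by auto
  have wX: "sum w X = w i + sum w (X - {i})" using i fin by (simp add: sum.remove)
  have wY: "sum w (Y \<union> {i}) = w i + sum w Y" using i fin by simp
  have "f X + f Y \<le> f (X - {i}) + f (Y \<union> {i}) \<or>
        (\<exists>j \<in> Y - X. f X + f Y \<le> f ((X - {i}) \<union> {j}) + f ((Y \<union> {i}) - {j}))"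
    using f XY i unfolding Mnat_concave_def by blast
  then consider "f X + f Y \<le> f (X - {i}) + f (Y \<union> {i})"
    | j where "j \<in> Y - X" "f X + f Y \<le> f ((X - {i}) \<union> {j}) + f ((Y \<union> {i}) - {j})" by blast
  then show "c * (f X + sum w X) + c * (f Y + sum w Y) \<le>
        c * (f (X - {i}) + sum w (X - {i})) + c * (f (Y \<union> {i}) + sum w (Y \<union> {i})) \<or>
        (\<exists>j \<in> Y - X. c * (f X + sum w X) + c * (f Y + sum w Y) \<le>
          c * (f ((X - {i}) \<union> {j}) + sum w ((X - {i}) \<union> {j})) +
          c * (f ((Y \<union> {i}) - {j}) + sum w ((Y \<union> {i}) - {j})))"
  proof cases
    case 1
    then show ?thesis unfolding distrib_left[symmetric]
      using wX wY assms(3) by (intro disjI1 mult_left_mono) auto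
  next
    case (2 j)
    have "sum w ((X - {i}) \<union> {j}) = w j + sum w (X - {i})" using 2(1) fin by simp
    moreover have "sum w (Y \<union> {i}) = w j + sum w ((Y \<union> {i}) - {j})"
      using 2(1) fin by (intro sum.remove) auto
    ultimately show ?thesis unfolding distrib_left[symmetric]
      using wX wY assms(3) 2 by (intro disjI2 bexI[of _ j] mult_left_mono) auto
  qed
qed

section \<open>Binary vectors and Gaussian elimination on lists\<close>

definition bit_scale :: "bit \<Rightarrow> (nat \<Rightarrow> bit) \<Rightarrow> nat \<Rightarrow> bit" where
  "bit_scale c v = (\<lambda>t. c * v t)"

interpretation bv: vector_space bit_scale
  by standard (simp_all only: bit_scale_def fun_eq_iff plus_fun_apply distrib_left distrib_right mult.assoc mult_1_left simp_thms)

text \<open>The offset \<open>k\<close> is the coordinate of the leading entry. It grows when the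
  leading column is dropped, so the other entries keep their coordinates and spans before and after
  a pass can be compared.\<close>

primrec row_vec :: "nat \<Rightarrow> nat list \<Rightarrow> nat \<Rightarrow> bit" where
  "row_vec k [] = (\<lambda>_. 0)"
| "row_vec k (d # ds) = (\<lambda>t. if t = k then of_nat d else row_vec (Suc k) ds t)"

lemma row_vec_below: "t < k \<Longrightarrow> row_vec k ds t = 0"
  by (induction ds arbitrary: k) auto

lemma row_vec_nth: "row_vec k ds t = (if k \<le> t \<and> t < k + length ds then of_nat (ds ! (t - k)) else 0)"
  by (induction ds arbitrary: k) (auto simp: nth_Cons' Suc_diff_le split: if_splits)

lemma row_vec_add: "length xs = length ys \<Longrightarrow> row_vec k (map2 (+) xs ys) = row_vec k xs + row_vec k ys"
  by (induction xs ys arbitrary: k rule: list_induct2) (auto simp: fun_eq_iff)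

lemma row_vec_replicate_0: "row_vec k (replicate j 0) = 0"
  by (induction j arbitrary: k) (auto simp: fun_eq_iff)

lemma of_nat_bit: "(of_nat m :: bit) = of_bool (odd m)"
  by (induction m) auto

lemma row_vec_tl:
  assumes "r \<noteq> []" "even (hd r)" shows "row_vec k r = row_vec (Suc k) (tl r)"
  using assms by (cases r) (auto simp: fun_eq_iff of_nat_bit row_vec_below)

text \<open>
  The pivot \<open>p\<close> is \<open>[]\<close> until a row with odd leading entry is met. The pivot row itself is
  replaced by zeros, and every pass drops the leading column, which has become even.
\<close>

definition new_pivot :: "nat list \<Rightarrow> nat list \<Rightarrow> nat list" where
  "new_pivot p r = (if odd (hd r) \<and> p = [] then r else p)"

definition new_row :: "nat list \<Rightarrow> nat list \<Rightarrow> nat list" where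
  "new_row p r = tl (if even (hd r) then r
     else if p = [] then replicate (length r) 0 else map2 (+) r p)"

primrec pass :: "nat list \<Rightarrow> nat list list \<Rightarrow> nat list list" where
  "pass p [] = []"
| "pass p (r # rs) = new_row p r # pass (new_pivot p r) rs"

primrec gauss_rank :: "nat \<Rightarrow> nat list list \<Rightarrow> nat" where
  "gauss_rank 0 rs = 0"
| "gauss_rank (Suc j) rs = of_bool (\<exists>r\<in>set rs. odd (hd r)) + gauss_rank j (pass [] rs)"

lemma length_new_row: "length r = Suc j \<Longrightarrow> p = [] \<or> length p = Suc j \<Longrightarrow> length (new_row p r) = j"
  by (auto simp: new_row_def)

lemma length_pass:
  "\<forall>r\<in>set rs. length r = Suc j \<Longrightarrow> p = [] \<or> length p = Suc j \<Longrightarrow> r \<in> set (pass p rs) \<Longrightarrow> length r = j"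
proof (induction rs arbitrary: p)
  case (Cons a rs)
  have "new_pivot p a = [] \<or> length (new_pivot p a) = Suc j"
    using Cons.prems by (auto simp: new_pivot_def)
  with Cons show ?case by (auto simp: length_new_row)
qed simp

lemma row_vec_new_row:
  assumes "length r = Suc j" "length p = Suc j" "odd (hd p)"
  shows "row_vec (Suc k) (new_row p r) = (if even (hd r) then row_vec k r else row_vec k r + row_vec k p)"
proof (cases "even (hd r)")
  case True
  then show ?thesis using assms row_vec_tl[of r k] by (cases r) (auto simp: new_row_def)
next
  case False
  have "row_vec k (map2 (+) r p) = row_vec (Suc k) (tl (map2 (+) r p))"
    using assms False by (intro row_vec_tl) (cases r; cases p; auto)+
  moreover have "p \<noteq> []" using assms by auto
  ultimately show ?thesis using False assms by (simp add: new_row_def row_vec_add)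
qed

text \<open>Once the pivot is fixed, a row changes by at most one copy of it, and in characteristic
  two adding the pivot again undoes the change. Hence the spans agree as soon as the pivot is
  included.\<close>

lemma pass_span_pivot:
  assumes "length p = Suc j" "odd (hd p)" "\<forall>r\<in>set rs. length r = Suc j"
  shows "row_vec k ` set rs \<subseteq> bv.span (insert (row_vec k p) (row_vec (Suc k) ` set (pass p rs))) \<and>
         row_vec (Suc k) ` set (pass p rs) \<subseteq> bv.span (insert (row_vec k p) (row_vec k ` set rs))"
proof -
  have np: "new_pivot p r = p" for r using assms(1) by (auto simp: new_pivot_def)
  have pass: "set (pass p rs) = new_row p ` set rs"
    using assms(3) by (induction rs) (auto simp: np)
  have self: "row_vec k p + row_vec k p = 0" by (auto simp: fun_eq_iff)
  have 1: "row_vec k r \<in> bv.span (insert (row_vec k p) (row_vec (Suc k) ` set (pass p rs)))" if "r \<in> set rs" for r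
  proof -
    let ?T = "insert (row_vec k p) (row_vec (Suc k) ` set (pass p rs))"
    have "row_vec (Suc k) (new_row p r) \<in> bv.span ?T" "row_vec k p \<in> bv.span ?T"
      by (rule bv.span_base; use that pass in auto)+
    moreover have "row_vec k r = row_vec (Suc k) (new_row p r) \<or> row_vec k r = row_vec (Suc k) (new_row p r) + row_vec k p"
      using row_vec_new_row[of r j p k] assms that by (auto simp: add.assoc self)
    ultimately show ?thesis using bv.span_add by metis
  qed
  have 2: "row_vec (Suc k) (new_row p r) \<in> bv.span (insert (row_vec k p) (row_vec k ` set rs))"
    if "r \<in> set rs" for r
  proof -
    let ?T = "insert (row_vec k p) (row_vec k ` set rs)"
    have "row_vec k r \<in> bv.span ?T" "row_vec k p \<in> bv.span ?T"
      by (rule bv.span_base; use that in auto)+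
    then show ?thesis
      using row_vec_new_row[of r j p k] assms that bv.span_add by (cases "even (hd r)") auto
  qed
  from 1 2 show ?thesis unfolding pass by auto
qed

text \<open>The witness is the first row with odd leading entry. The pass overwrites this row by
  zeros, so it has to be put back into the span separately.\<close>

lemma pass_span:
  assumes "\<forall>r\<in>set rs. length r = Suc j" "\<exists>r\<in>set rs. odd (hd r)"
  shows "\<exists>p. length p = Suc j \<and> odd (hd p) \<and>
         row_vec k ` set rs \<subseteq> bv.span (insert (row_vec k p) (row_vec (Suc k) ` set (pass [] rs))) \<and>
         insert (row_vec k p) (row_vec (Suc k) ` set (pass [] rs)) \<subseteq> bv.span (row_vec k ` set rs)"
  using assms
proof (induction rs)
  case (Cons r rs)
  show ?case
  proof (cases "odd (hd r)")
    case True
    have len: "length r = Suc j" using Cons.prems by simp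
    have r: "new_row [] r = replicate j 0" using True len by (simp add: new_row_def)
    have pass: "pass [] (r # rs) = replicate j 0 # pass r rs"
      using True r by (simp add: new_pivot_def)
    have zero: "row_vec (Suc k) (replicate j 0) \<in> bv.span T" for T
      by (simp add: row_vec_replicate_0 bv.span_zero)
    have *: "row_vec k ` set rs \<subseteq> bv.span (insert (row_vec k r) (row_vec (Suc k) ` set (pass r rs)))"
      "row_vec (Suc k) ` set (pass r rs) \<subseteq> bv.span (insert (row_vec k r) (row_vec k ` set rs))"
      using pass_span_pivot[OF len True, of rs k] Cons.prems by auto
    have sub: "bv.span (insert (row_vec k r) (row_vec (Suc k) ` set (pass r rs))) \<subseteq>
      bv.span (insert (row_vec k r) (row_vec (Suc k) ` set (pass [] (r # rs))))"
      unfolding pass by (rule bv.span_mono) auto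
    show ?thesis
      using len True * sub zero[of "insert (row_vec k r) (row_vec k ` set rs)"]
        bv.span_base[of "row_vec k r" "insert (row_vec k r) (row_vec (Suc k) ` set (pass [] (r # rs)))"]
        bv.span_base[of "row_vec k r" "insert (row_vec k r) (row_vec k ` set rs)"]
      unfolding pass by (intro exI[of _ r]) (auto simp del: pass.simps)
  next
    case False
    have "\<exists>r\<in>set rs. odd (hd r)" "\<forall>r\<in>set rs. length r = Suc j" using Cons.prems False by auto
    then obtain p where p: "length p = Suc j" "odd (hd p)"
      "row_vec k ` set rs \<subseteq> bv.span (insert (row_vec k p) (row_vec (Suc k) ` set (pass [] rs)))"
      "insert (row_vec k p) (row_vec (Suc k) ` set (pass [] rs)) \<subseteq> bv.span (row_vec k ` set rs)"
      using Cons.IH by blast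
    have r: "row_vec (Suc k) (tl r) = row_vec k r"
      using row_vec_tl[of r k] False Cons.prems by (cases r) auto
    have pass: "pass [] (r # rs) = tl r # pass [] rs"
      using False by (simp add: new_row_def new_pivot_def)
    let ?S = "insert (row_vec k p) (row_vec (Suc k) ` set (pass [] rs))"
    have S: "insert (row_vec k p) (row_vec (Suc k) ` set (pass [] (r # rs))) = insert (row_vec k r) ?S"
      unfolding pass by (auto simp: r)
    have "row_vec k ` set (r # rs) \<subseteq> bv.span (insert (row_vec k r) ?S)"
      using p(3) bv.span_mono[of ?S "insert (row_vec k r) ?S"] bv.span_base[of "row_vec k r" "insert (row_vec k r) ?S"]
      by (auto simp del: insert_iff simp: image_subset_iff)
    moreover have "insert (row_vec k r) ?S \<subseteq> bv.span (row_vec k ` set (r # rs))"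
      using p(4) bv.span_mono[of "row_vec k ` set rs" "row_vec k ` set (r # rs)"]
        bv.span_base[of "row_vec k r" "row_vec k ` set (r # rs)"]
      by auto
    ultimately show ?thesis using p(1,2) unfolding S[symmetric] by blast
  qed
qed simp

lemma span_coord_zero:
  assumes "v \<in> bv.span S" "\<And>x. x \<in> S \<Longrightarrow> x t = 0"
  shows "v t = 0"
proof -
  have "bv.subspace {v. v t = 0}" by (auto simp: bv.subspace_def bit_scale_def)
  then have "bv.span S \<subseteq> {v. v t = 0}" using assms(2) by (intro bv.span_minimal) auto
  then show ?thesis using assms(1) by blast
qed

lemma gauss_rank_eq_dim:
  "\<forall>r\<in>set rs. length r = j \<Longrightarrow> gauss_rank j rs = bv.dim (row_vec k ` set rs)"
proof (induction j arbitrary: rs k)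
  case 0
  then have "row_vec k ` set rs \<subseteq> {0}" by (auto simp: fun_eq_iff)
  moreover have "bv.dim {0} = 0"
    using bv.dim_insert_finite[of "{}" 0] bv.dim_eq_card_independent[of "{}"]
    by (simp add: bv.independent_empty bv.span_zero)
  ultimately have "bv.dim (row_vec k ` set rs) = 0"
    using bv.dim_mono_finite[of "{0}" "row_vec k ` set rs"] by simp
  then show ?case by simp
next
  case (Suc j)
  have len: "\<forall>r\<in>set (pass [] rs). length r = j" using length_pass[OF Suc.prems] by blast
  note IH = Suc.IH[OF len, of "Suc k"]
  show ?case
  proof (cases "\<exists>r\<in>set rs. odd (hd r)")
    case True
    obtain p where p: "length p = Suc j" "odd (hd p)"
      "row_vec k ` set rs \<subseteq> bv.span (insert (row_vec k p) (row_vec (Suc k) ` set (pass [] rs)))"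
      "insert (row_vec k p) (row_vec (Suc k) ` set (pass [] rs)) \<subseteq> bv.span (row_vec k ` set rs)"
      using pass_span[OF Suc.prems True, of k] by blast
    \<comment> \<open>The pivot is 1 at coordinate \<open>k\<close> and all remaining rows vanish
      there, so it adds exactly one to their rank.\<close>
    have "row_vec k p k = 1" using p(1,2) by (cases p) (auto simp: of_nat_bit)
    moreover have "x k = 0" if "x \<in> row_vec (Suc k) ` set (pass [] rs)" for x
      using that by (auto simp: row_vec_below)
    ultimately have "row_vec k p \<notin> bv.span (row_vec (Suc k) ` set (pass [] rs))"
      using span_coord_zero[of "row_vec k p" "row_vec (Suc k) ` set (pass [] rs)" k] by force
    then have "bv.dim (row_vec k ` set rs) = Suc (bv.dim (row_vec (Suc k) ` set (pass [] rs)))"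
      using bv.dim_eqI[OF p(3,4)] by (simp add: bv.dim_insert_finite)
    then show ?thesis using True IH by simp
  next
    case False
    have "pass [] rs = map tl rs" using False
      by (induction rs) (auto simp: new_row_def new_pivot_def)
    moreover have "row_vec k r = row_vec (Suc k) (tl r)" if "r \<in> set rs" for r
      using that False Suc.prems by (intro row_vec_tl) auto
    ultimately have "row_vec k ` set rs = row_vec (Suc k) ` set (pass [] rs)" by (force simp: image_iff)
    then show ?thesis using False IH by simp
  qed
qed


lemma gauss_rank_le: "gauss_rank j rs \<le> j"
  by (induction j arbitrary: rs) (auto simp: le_SucI)

section \<open>Ranks of submatrices as ranks of vectors over a fixed ground set\<close>

definition unit_vec :: "nat \<Rightarrow> nat \<Rightarrow> bit" where
  "unit_vec w = (\<lambda>t. of_bool (t = w))"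

lemma span_unit_vec:
  assumes "finite W" "\<And>t. t \<notin> W \<Longrightarrow> v t = 0"
  shows "v \<in> bv.span (unit_vec ` W)"
  using assms
proof (induction W arbitrary: v)
  case empty
  then have "v = 0" by (auto simp: fun_eq_iff)
  then show ?case using bv.span_zero by (simp only:)
next
  case (insert w W)
  have "v(w := 0) \<in> bv.span (unit_vec ` W)" using insert.prems by (intro insert.IH) auto
  then have 1: "v(w := 0) \<in> bv.span (unit_vec ` insert w W)"
    using bv.span_mono[of "unit_vec ` W" "unit_vec ` insert w W"] by blast
  have 2: "unit_vec w \<in> bv.span (unit_vec ` insert w W)" by (intro bv.span_base) simp
  show ?case
  proof (cases "v w = 0")
    case True
    then have "v(w := 0) = v" by (auto simp: fun_eq_iff)
    with 1 show ?thesis by simp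
  next
    case False
    then have "v = v(w := 0) + unit_vec w" by (auto simp: fun_eq_iff unit_vec_def)
    with bv.span_add[OF 1 2] show ?thesis by simp
  qed
qed

lemma dim_unit_vecs_Un:
  assumes "finite W" "finite M" "\<And>x w. x \<in> M \<Longrightarrow> w \<in> W \<Longrightarrow> x w = 0"
  shows "bv.dim (unit_vec ` W \<union> M) = card W + bv.dim M"
  using assms(1,3)
proof (induction W)
  case (insert w W)
  have "x w = 0" if "x \<in> unit_vec ` W \<union> M" for x
    using that insert.prems insert.hyps(2) by (auto simp: unit_vec_def)
  then have "unit_vec w w = 0" if "unit_vec w \<in> bv.span (unit_vec ` W \<union> M)"
    using span_coord_zero[OF that, of w] by blast
  then have "unit_vec w \<notin> bv.span (unit_vec ` W \<union> M)" by (auto simp: unit_vec_def)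
  then show ?case using insert assms(2) by (simp add: bv.dim_insert_finite)
qed simp

lemma dim_eq_0_iff:
  assumes "finite M" shows "bv.dim M = 0 \<longleftrightarrow> M \<subseteq> {0}"
proof -
  have sing: "bv.dim {x} = (if x = 0 then 0 else 1)" for x
    using bv.dim_insert_finite[of "{}" x] bv.dim_eq_card_independent[of "{}"]
    by (simp add: bv.independent_empty)
  show ?thesis
  proof
    assume 0: "bv.dim M = 0"
    show "M \<subseteq> {0}"
    proof
      fix x assume "x \<in> M"
      then have "bv.dim {x} \<le> bv.dim M" using assms by (intro bv.dim_mono_finite) auto
      then show "x \<in> {0}" using 0 sing[of x] by (cases "x = 0") auto
    qed
  next
    assume "M \<subseteq> {0}"
    then have "bv.dim M \<le> bv.dim {0}" by (intro bv.dim_mono_finite) auto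
    then show "bv.dim M = 0" using sing[of 0] by simp
  qed
qed

text \<open>
  Ground set \<open>{..<2 * n}\<close>: the element \<open>u < n\<close> is row \<open>u\<close> of the matrix \<open>a\<close>, the element
  \<open>n + v\<close> is the unit vector of column \<open>v\<close>. Column \<open>v\<close> is stored at coordinate \<open>n - 1 - v\<close>,
  the place where reading the row from left to right by Horner's rule puts it.
\<close>

definition ground_vec :: "nat \<Rightarrow> (nat \<Rightarrow> nat \<Rightarrow> bool) \<Rightarrow> nat \<Rightarrow> nat \<Rightarrow> bit" where
  "ground_vec n a x = (if x < n then (\<lambda>t. of_bool (t < n \<and> a x (n - 1 - t)))
                       else unit_vec (n - 1 - (x - n)))"

text \<open>Deleted rows and columns are set to zero instead of being removed: the rank is the same,
  and the elimination always sees \<open>n\<close> rows of length \<open>n\<close>.\<close>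

definition cut_vec :: "nat \<Rightarrow> (nat \<Rightarrow> nat \<Rightarrow> bool) \<Rightarrow> nat set \<Rightarrow> nat \<Rightarrow> nat \<Rightarrow> bit" where
  "cut_vec n a S u = (\<lambda>t. of_bool (t < n \<and> u \<in> S \<and> n + (n - 1 - t) \<notin> S \<and> a u (n - 1 - t)))"

definition cut_rank :: "nat \<Rightarrow> (nat \<Rightarrow> nat \<Rightarrow> bool) \<Rightarrow> nat set \<Rightarrow> nat" where
  "cut_rank n a S = bv.dim (cut_vec n a S ` {..<n})"

lemma cut_rank_eq_0_iff:
  "cut_rank n a S = 0 \<longleftrightarrow> (\<forall>u<n. \<forall>v<n. u \<in> S \<longrightarrow> n + v \<notin> S \<longrightarrow> \<not> a u v)"
proof -
  have "cut_rank n a S = 0 \<longleftrightarrow> (\<forall>u<n. cut_vec n a S u = 0)"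
    unfolding cut_rank_def by (subst dim_eq_0_iff) auto
  also have "\<dots> \<longleftrightarrow> (\<forall>u<n. \<forall>t<n. u \<in> S \<longrightarrow> n + (n - 1 - t) \<notin> S \<longrightarrow> \<not> a u (n - 1 - t))"
    by (auto simp: cut_vec_def fun_eq_iff)
  also have "\<dots> \<longleftrightarrow> (\<forall>u<n. \<forall>v<n. u \<in> S \<longrightarrow> n + v \<notin> S \<longrightarrow> \<not> a u v)"
  proof -
    have "(\<forall>t<n. u \<in> S \<longrightarrow> n + (n - 1 - t) \<notin> S \<longrightarrow> \<not> a u (n - 1 - t)) =
          (\<forall>v<n. u \<in> S \<longrightarrow> n + v \<notin> S \<longrightarrow> \<not> a u v)" (is "?l = ?r") for u
    proof
      assume l: ?l
      show ?r
      proof (intro allI impI)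
        fix v assume v: "v < n" "u \<in> S" "n + v \<notin> S"
        then have "n - 1 - (n - 1 - v) = v" "n - 1 - v < n" by auto
        with l[rule_format, of "n - 1 - v"] v show "\<not> a u v" by simp
      qed
    qed auto
    then show ?thesis by (simp only:)
  qed
  finally show ?thesis .
qed

text \<open>This is contraction in a matroid: modulo the unit vectors in \<open>S\<close>, a
  selected row equals its cut vector. Cut vectors vanish on the coordinates \<open>W\<close> of
  these unit vectors, which therefore contribute exactly their number to the rank.\<close>

lemma dim_ground_vec:
  assumes S: "S \<subseteq> {..<2 * n}"
  shows "bv.dim (ground_vec n a ` S) = card (S \<inter> {n..}) + cut_rank n a S"
proof -
  define W where "W = (\<lambda>x. n - 1 - (x - n)) ` (S \<inter> {n..})"
  have fin: "finite S" using S finite_subset by blast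
  have inj: "inj_on (\<lambda>x. n - 1 - (x - n)) (S \<inter> {n..})"
  proof (rule inj_onI)
    fix x y assume "x \<in> S \<inter> {n..}" "y \<in> S \<inter> {n..}" "n - 1 - (x - n) = n - 1 - (y - n)"
    moreover from this S have "x < 2 * n" "y < 2 * n" by auto
    ultimately show "x = y" by auto
  qed
  have W: "finite W" unfolding W_def using fin by simp
  have card_W: "card W = card (S \<inter> {n..})" unfolding W_def by (rule card_image[OF inj])
  have unit: "unit_vec ` W = ground_vec n a ` (S \<inter> {n..})"
    unfolding W_def image_image
  proof (rule image_cong)
    fix x assume "x \<in> S \<inter> {n..}"
    then have "\<not> x < n" by simp
    then show "unit_vec (n - 1 - (x - n)) = ground_vec n a x" by (simp only: ground_vec_def if_False)
  qed (rule refl)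
  have diff: "ground_vec n a u + cut_vec n a S u \<in> bv.span (unit_vec ` W)" if u: "u \<in> S" "u < n" for u
  proof (rule span_unit_vec[OF W])
    fix t assume t: "t \<notin> W"
    have "n + (n - 1 - t) \<notin> S" if "t < n"
    proof
      assume "n + (n - 1 - t) \<in> S"
      then have "n + (n - 1 - t) \<in> S \<inter> {n..}" by simp
      then have "n - 1 - (n + (n - 1 - t) - n) \<in> W" unfolding W_def by (rule imageI)
      with t that show False by simp
    qed
    then show "(ground_vec n a u + cut_vec n a S u) t = 0"
      using u by (auto simp: ground_vec_def cut_vec_def)
  qed
  have self: "x + x = 0" for x :: "nat \<Rightarrow> bit" by (auto simp: fun_eq_iff)
  have "bv.dim (ground_vec n a ` S) = bv.dim (unit_vec ` W \<union> cut_vec n a S ` {..<n})"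
  proof (rule bv.dim_eqI)
    let ?T = "unit_vec ` W \<union> cut_vec n a S ` {..<n}"
    have "ground_vec n a x \<in> bv.span ?T" if x: "x \<in> S" for x
    proof (cases "x < n")
      case True
      have "ground_vec n a x + cut_vec n a S x \<in> bv.span ?T"
        using diff[OF x True] bv.span_mono[of "unit_vec ` W" ?T] by blast
      moreover have "cut_vec n a S x \<in> bv.span ?T" using True by (intro bv.span_base) auto
      ultimately have "ground_vec n a x + cut_vec n a S x + cut_vec n a S x \<in> bv.span ?T"
        by (rule bv.span_add)
      then show ?thesis by (simp add: add.assoc self)
    next
      case False
      then have "ground_vec n a x \<in> unit_vec ` W" unfolding unit using x by auto
      then show ?thesis by (intro bv.span_base) auto
    qed
    then show "ground_vec n a ` S \<subseteq> bv.span ?T" by blast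
  next
    let ?T = "ground_vec n a ` S"
    have W_T: "unit_vec ` W \<subseteq> ?T" unfolding unit by blast
    have "cut_vec n a S u \<in> bv.span ?T" if "u < n" for u
    proof (cases "u \<in> S")
      case True
      have "ground_vec n a u + cut_vec n a S u \<in> bv.span ?T"
        using diff[OF True that] bv.span_mono[OF W_T] by blast
      moreover have "ground_vec n a u \<in> bv.span ?T" using True by (intro bv.span_base) auto
      ultimately have "ground_vec n a u + (ground_vec n a u + cut_vec n a S u) \<in> bv.span ?T"
        by (rule bv.span_add[rotated])
      then show ?thesis by (simp only: add.assoc[symmetric] self add_0)
    next
      case False
      then have "cut_vec n a S u = 0" by (auto simp: cut_vec_def fun_eq_iff)
      then show ?thesis by (simp add: bv.span_zero)
    qed
    moreover have "unit_vec ` W \<subseteq> bv.span ?T" using W_T bv.span_superset by blast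
    ultimately show "unit_vec ` W \<union> cut_vec n a S ` {..<n} \<subseteq> bv.span ?T" by blast
  qed
  also have "\<dots> = card W + cut_rank n a S"
    unfolding cut_rank_def
  proof (rule dim_unit_vecs_Un[OF W])
    fix x w assume "x \<in> cut_vec n a S ` {..<n}" "w \<in> W"
    then obtain u y where "x = cut_vec n a S u" "y \<in> S" "n \<le> y" "w = n - 1 - (y - n)"
      unfolding W_def by auto
    moreover from this S have "n + (n - 1 - w) = y" by fastforce
    ultimately show "x w = 0" by (simp add: cut_vec_def)
  qed simp
  finally show ?thesis using card_W by simp
qed

text \<open>Only the set of rows enters, so the program may store them in reverse order.\<close>

lemma gauss_rank_eq_cut_rank:
  assumes "set rs = (\<lambda>u. map (\<lambda>t. of_bool (u \<in> S \<and> n + (n - 1 - t) \<notin> S \<and> a u (n - 1 - t))) [0..<n]) ` {..<n}"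
  shows "gauss_rank n rs = cut_rank n a S"
proof -
  have "gauss_rank n rs = bv.dim (row_vec 0 ` set rs)"
    using assms by (intro gauss_rank_eq_dim) auto
  also have "row_vec 0 ` set rs = cut_vec n a S ` {..<n}"
    unfolding assms image_image
    by (rule image_cong) (auto simp: row_vec_nth cut_vec_def fun_eq_iff)
  finally show ?thesis by (simp add: cut_rank_def)
qed

text \<open>Each of the \<open>n\<close> columns of the elimination contributes at most one
  pivot.\<close>

lemma cut_rank_le: "cut_rank n a S \<le> n"
proof -
  define rs where "rs = map (\<lambda>u. map (\<lambda>t. of_bool (u \<in> S \<and> n + (n - 1 - t) \<notin> S \<and> a u (n - 1 - t)) :: nat) [0..<n]) [0..<n]"
  have "gauss_rank n rs = cut_rank n a S"
    by (rule gauss_rank_eq_cut_rank) (simp only: rs_def set_map set_upt atLeast0LessThan)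
  then show ?thesis using gauss_rank_le[of n rs] by simp
qed

lemma Mnat_concave_cong:
  assumes f: "Mnat_concave N f" and eq: "\<And>S. S \<subseteq> N \<Longrightarrow> f S = f' S"
  shows "Mnat_concave N f'"
  unfolding Mnat_concave_def
proof (intro allI impI ballI)
  fix X Y i assume XY: "X \<subseteq> N" "Y \<subseteq> N" and i: "i \<in> X - Y"
  have e: "f X = f' X" "f Y = f' Y" "f (X - {i}) = f' (X - {i})" "f (Y \<union> {i}) = f' (Y \<union> {i})"
    using XY i by (intro eq; auto)+
  consider "f X + f Y \<le> f (X - {i}) + f (Y \<union> {i})"
    | j where "j \<in> Y - X" "f X + f Y \<le> f ((X - {i}) \<union> {j}) + f ((Y \<union> {i}) - {j})"
    using f XY i unfolding Mnat_concave_def by blast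
  then show "f' X + f' Y \<le> f' (X - {i}) + f' (Y \<union> {i}) \<or>
    (\<exists>j \<in> Y - X. f' X + f' Y \<le> f' ((X - {i}) \<union> {j}) + f' ((Y \<union> {i}) - {j}))"
  proof cases
    case 1
    then show ?thesis using e by simp
  next
    case (2 j)
    then have "f ((X - {i}) \<union> {j}) = f' ((X - {i}) \<union> {j})" "f ((Y \<union> {i}) - {j}) = f' ((Y \<union> {i}) - {j})"
      using XY i by (intro eq; auto)+
    then show ?thesis using 2 e by (intro disjI2 bexI[of _ j]) simp_all
  qed
qed

definition cut_weight :: "nat \<Rightarrow> (nat \<Rightarrow> nat \<Rightarrow> bool) \<Rightarrow> nat \<Rightarrow> nat set \<Rightarrow> real" where
  "cut_weight n a q S = 1 / real (q ^ cut_rank n a S)"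

text \<open>Minus the logarithm of the weight is \<open>ln q\<close> times the difference of a
  matroid rank and the number of unit vectors in \<open>S\<close>; the assumption on
  \<open>q\<close> makes the factor nonnegative, which preserves concavity.\<close>

lemma Mnat_convex_ln_cut_weight:
  assumes "q \<ge> 1"
  shows "Mnat_convex {..<2 * n} (\<lambda>S. ln (cut_weight n a q S))"
proof -
  have "Mnat_concave {..<2 * n} (\<lambda>S. ln (real q) *
      (real (bv.dim (ground_vec n a ` S)) + sum (\<lambda>x. - of_bool (n \<le> x)) S))"
    using assms by (intro Mnat_concave_linear bv.Mnat_concave_dim) auto
  then have "Mnat_concave {..<2 * n} (\<lambda>S. - ln (cut_weight n a q S))"
  proof (rule Mnat_concave_cong)
    fix S assume S: "S \<subseteq> {..<2 * n}"
    then have "finite S" using finite_subset by blast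
    then have "sum (\<lambda>x. of_bool (n \<le> x)) S = real (card (S \<inter> {n..}))"
      by (simp add: of_bool_def sum.If_cases atLeast_def Collect_conj_eq)
    then show "ln (real q) * (real (bv.dim (ground_vec n a ` S)) + sum (\<lambda>x. - of_bool (n \<le> x)) S)
        = - ln (cut_weight n a q S)"
      using assms by (simp add: dim_ground_vec[OF S] cut_weight_def sum_negf ln_div ln_realpow)
  qed
  then show ?thesis unfolding Mnat_convex_def .
qed

section \<open>Gaussian elimination as a program\<close>

text \<open>Lowest digit first. The digits are not forced to lie below \<open>b\<close>, so adding
  two rows entrywise is plain addition of their values; a bound on the digits is needed only for
  reading them back.\<close>

primrec digits_val :: "nat \<Rightarrow> nat list \<Rightarrow> nat" where
  "digits_val b [] = 0"
| "digits_val b (d # ds) = d + b * digits_val b ds"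

lemma digits_val_less: "\<forall>d\<in>set ds. d < b \<Longrightarrow> digits_val b ds < b ^ length ds"
proof (induction ds)
  case (Cons d ds)
  have "d + b * digits_val b ds < b + b * digits_val b ds" using Cons.prems by simp
  also have "\<dots> = b * Suc (digits_val b ds)" by simp
  also have "\<dots> \<le> b * b ^ length ds" using Cons by (intro mult_le_mono2) (simp add: Suc_leI)
  finally show ?case by simp
qed simp

lemma digits_val_append: "digits_val b (xs @ ys) = digits_val b xs + b ^ length xs * digits_val b ys"
  by (induction xs) (auto simp: algebra_simps)

lemma digits_val_add:
  "length xs = length ys \<Longrightarrow> digits_val b (map2 (+) xs ys) = digits_val b xs + digits_val b ys"
  by (induction xs ys rule: list_induct2) (auto simp: algebra_simps)

lemma digits_val_replicate_0: "digits_val b (replicate j 0) = 0"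
  by (induction j) auto

lemma digits_val_div: "ds \<noteq> [] \<Longrightarrow> hd ds < b \<Longrightarrow> digits_val b ds div b = digits_val b (tl ds)"
  by (cases ds) auto

lemma odd_digits_val: "ds \<noteq> [] \<Longrightarrow> even b \<Longrightarrow> odd (digits_val b ds) = odd (hd ds)"
  by (cases ds) auto

lemma runs_step:
  "\<forall>x\<in>reads e. s x < 2 ^ K \<Longrightarrow> cost_bound K e < U \<Longrightarrow> runs c (s(x := value_of e s)) B A Q \<Longrightarrow>
   runs (Seq (Assign x e) c) s (U + B) A Q"
  by (intro runs_Assign_Seq cost_less)

lemma runs_last:
  "\<forall>x\<in>reads e. s x < 2 ^ K \<Longrightarrow> cost_bound K e < U \<Longrightarrow> Q (s(x := value_of e s)) a \<Longrightarrow>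
   runs (Assign x e) s U (return_pmf a) Q"
  by (intro runs_Assign cost_less)

lemma runs_Skip: "1 \<le> B \<Longrightarrow> Q s a \<Longrightarrow> runs Skip s B (return_pmf a) Q"
  unfolding runs_def by (intro runsT_Skip conjI)

abbreviation seq :: "com \<Rightarrow> com \<Rightarrow> com"  (infixr ";;" 55) where "c1 ;; c2 \<equiv> Seq c1 c2"
abbreviation asg :: "nat \<Rightarrow> expr \<Rightarrow> com"  (infix "::=" 60) where "x ::= e \<equiv> Assign x e"
abbreviation add_e (infixl "+\<^sub>e" 65) where "a +\<^sub>e b \<equiv> Bin Add a b"
abbreviation sub_e (infixl "-\<^sub>e" 65) where "a -\<^sub>e b \<equiv> Bin Sub a b"
abbreviation mul_e (infixl "*\<^sub>e" 70) where "a *\<^sub>e b \<equiv> Bin Mul a b"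
abbreviation div_e (infixl "div\<^sub>e" 70) where "a div\<^sub>e b \<equiv> Bin Div a b"
abbreviation mod_e (infixl "mod\<^sub>e" 70) where "a mod\<^sub>e b \<equiv> Bin Mod a b"

text \<open>
  Registers: 0 to 3 hold the input \<open>n\<close>, the graph code and the rounded reciprocals of \<open>\<epsilon>\<close> and
  \<open>\<delta>\<close>; 4 is \<open>2 ^ n\<close>, 5 the base of the digits of a row, 6 the base of the rows of a matrix, 7 its
  \<open>n\<close>-th power; 8 is the bit length of register 3 plus 1, 9 the accuracy asked of the sampler,
  10 the number of samples per marginal, 11 the base \<open>Q\<close> of the weights; 12 and 13 are the fraction
  to be output, 14 is \<open>2 ^ m\<close>, 15 to 17 are counters; 18 is an oracle query and 28 the answer, with
  19 to 27 as scratch space; register \<open>x\<close> of the sampler is \<open>x + 30\<close>.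

  A matrix is one number whose digits are its rows, each of which is a number in turn. The loops
  consume the lowest row and append its reduction at the top, so \<open>n\<close> rounds restore the order.
\<close>

definition read_entry :: com where
  "read_entry =
     26 ::= Reg 26 *\<^sub>e Reg 5 +\<^sub>e
            (Reg 22 mod\<^sub>e Const 2) *\<^sub>e (Reg 19 mod\<^sub>e Const 2) *\<^sub>e (Const 1 -\<^sub>e Reg 21 mod\<^sub>e Const 2) ;;
     22 ::= Reg 22 div\<^sub>e Const 2 ;;
     21 ::= Reg 21 div\<^sub>e Const 2 ;;
     25 ::= Reg 25 -\<^sub>e Const 1"

definition read_row :: com where
  "read_row =
     21 ::= Reg 20 ;;
     26 ::= Const 0 ;;
     25 ::= Reg 0 ;;
     While (Reg 25) read_entry ;;
     23 ::= Reg 23 *\<^sub>e Reg 6 +\<^sub>e Reg 26 ;;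
     19 ::= Reg 19 div\<^sub>e Const 2 ;;
     24 ::= Reg 24 -\<^sub>e Const 1"

text \<open>Register 27 holds the pivot, with zero for none; a genuine pivot has odd leading entry
  and thus a nonzero value. Each pivot found multiplies register 28 by \<open>Q\<close>, so the
  power of \<open>Q\<close> builds up along with the rank.\<close>

definition reduce_row :: com where
  "reduce_row =
     26 ::= Reg 23 mod\<^sub>e Reg 6 ;;
     If (Reg 26 mod\<^sub>e Const 2)
       (If (Reg 27)
          (26 ::= Reg 26 +\<^sub>e Reg 27)
          (27 ::= Reg 26 ;; 26 ::= Const 0 ;; 28 ::= Reg 28 *\<^sub>e Reg 11))
       Skip ;;
     23 ::= (Reg 23 +\<^sub>e (Reg 26 div\<^sub>e Reg 5) *\<^sub>e Reg 7) div\<^sub>e Reg 6 ;;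
     24 ::= Reg 24 -\<^sub>e Const 1"

definition reduce_column :: com where
  "reduce_column =
     27 ::= Const 0 ;;
     24 ::= Reg 0 ;;
     While (Reg 24) reduce_row ;;
     25 ::= Reg 25 -\<^sub>e Const 1"

text \<open>The restriction to vertices below \<open>m\<close> is done by masking the query: the
  selected rows from \<open>m\<close> on are cleared, and all columns from \<open>m\<close> on are
  declared deleted by adding the block of ones \<open>2 ^ n - 2 ^ m\<close>. The graph code itself
  is left alone.\<close>

definition eval_weight :: com where
  "eval_weight =
     19 ::= Reg 18 mod\<^sub>e Reg 14 ;;
     20 ::= Reg 18 div\<^sub>e Reg 4 mod\<^sub>e Reg 14 +\<^sub>e (Reg 4 -\<^sub>e Reg 14) ;;
     22 ::= Reg 1 ;;
     23 ::= Const 0 ;;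
     24 ::= Reg 0 ;;
     While (Reg 24) read_row ;;
     28 ::= Const 1 ;;
     25 ::= Reg 0 ;;
     While (Reg 25) reduce_column"

lemma div_pow_mod_2: "x div 2 ^ k mod 2 = of_bool (k \<in> set_decode x)"
  by (simp add: set_decode_def mod_2_eq_odd)

lemma set_decode_bit: "k \<in> set_decode x \<longleftrightarrow> bit x k"
  by (simp add: set_decode_def bit_iff_odd)

lemma set_decode_mod: "k \<in> set_decode (x mod 2 ^ m) \<longleftrightarrow> k < m \<and> k \<in> set_decode x"
  by (simp add: set_decode_bit take_bit_eq_mod[symmetric] bit_take_bit_iff)

lemma set_decode_div: "k \<in> set_decode (x div 2 ^ n) \<longleftrightarrow> n + k \<in> set_decode x"
  by (simp add: set_decode_def power_add div_mult2_eq)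

text \<open>\<open>K\<close> bounds the bit lengths of register contents: there is room for
  \<open>n\<close> rows of \<open>n\<close> digits, and for one factor \<open>Q\<close> beyond the
  largest possible rank, since the product is bounded before it is known whether a column has a
  pivot.\<close>

locale eval_context =
  fixes n code m Q K :: nat
  assumes n: "0 < n" and m: "m \<le> n" and code: "code < 2 ^ K"
    and CC: "((2 ^ Suc n) ^ n) ^ n < (2::nat) ^ K" and Q: "0 < Q" "Q ^ Suc n < 2 ^ K"
begin

text \<open>Entries start at 0 or 1 and at most double in each of the \<open>n\<close> passes, so
  they stay at most \<open>2 ^ n\<close> and digits never carry. Since \<open>B\<close> is even, the
  parity of the value of a row is the parity of its leading entry.\<close>

definition "B = (2::nat) ^ Suc n"
definition "C = B ^ n"
abbreviation "U \<equiv> 40 * Suc K"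

definition conf :: "state \<Rightarrow> bool" where
  "conf s \<longleftrightarrow> s 0 = n \<and> s 1 = code \<and> s 4 = 2 ^ n \<and> s 5 = B \<and> s 6 = C \<and> s 7 = C ^ n \<and>
     s 11 = Q \<and> s 14 = 2 ^ m"

lemma one_less_B: "1 < B"
  unfolding B_def by (rule one_less_power) auto

lemma even_B: "even B"
  by (simp add: B_def)

lemma C_pos: "0 < C"
  using one_less_B by (simp add: C_def)

lemma C_le: "C \<le> C ^ n" and B_le: "B \<le> C"
proof -
  have "B ^ 1 \<le> B ^ n" using n one_less_B by (intro power_increasing) auto
  then show "B \<le> C" by (simp add: C_def)
  have "C ^ 1 \<le> C ^ n" using n C_pos by (intro power_increasing) auto
  then show "C \<le> C ^ n" by simp
qed

lemma small: "B < 2 ^ K" "C < 2 ^ K" "C ^ n < 2 ^ K" "2 ^ n < (2::nat) ^ K" "2 ^ m < (2::nat) ^ K"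
  "n < 2 ^ K" "Q < 2 ^ K" "1 < (2::nat) ^ K"
proof -
  show 1: "B < 2 ^ K" "C < 2 ^ K" "C ^ n < 2 ^ K" using C_le B_le CC[folded B_def, folded C_def] by linarith+
  have "(2::nat) ^ n < B" by (simp add: B_def)
  then show 2: "2 ^ n < (2::nat) ^ K" using 1(1) by linarith
  have "(2::nat) ^ m \<le> 2 ^ n" using m by (intro power_increasing) auto
  then show "2 ^ m < (2::nat) ^ K" using 2 by linarith
  have "n < 2 ^ n" by simp
  then show "n < 2 ^ K" using 2 by linarith
  have "Q ^ 1 \<le> Q ^ Suc n" using Q by (intro power_increasing) auto
  then show "Q < 2 ^ K" using Q(2) by (simp only: power_one_right)
  have "(1::nat) \<le> 2 ^ n" by simp
  then show "1 < (2::nat) ^ K" using 2 by linarith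
qed

lemma div_less: "(a::nat) < 2 ^ K \<Longrightarrow> a div b < 2 ^ K"
  using div_le_dividend le_less_trans by blast

lemma mod_less: "(a::nat) < 2 ^ K \<Longrightarrow> a mod b < 2 ^ K"
  using mod_less_eq_dividend le_less_trans by blast

lemma bits_n: "j \<le> n \<Longrightarrow> 2 + bits j \<le> U"
  using small(6) bits_le_iff[of j K] by simp

lemma div_pow_Suc: "(c::nat) div 2 ^ i div 2 = c div 2 ^ Suc i"
  by (simp add: div_mult2_eq[symmetric] mult.commute)

lemma read_entries:
  assumes s: "s 5 = B" "s 25 = n" "s 26 = 0" "s 19 < 2 ^ K" "s 21 < 2 ^ K" "s 22 < 2 ^ K"
  shows "runs (While (Reg 25) read_entry) s (n * (U + 4 * U) + U) (return_pmf ()) (\<lambda>s' _.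
     s' 26 = digits_val B (rev (map (\<lambda>v. (s 22 div 2 ^ v mod 2) * (s 19 mod 2) * (1 - s 21 div 2 ^ v mod 2)) [0..<n])) \<and>
     s' 22 = s 22 div 2 ^ n \<and> (\<forall>x. x \<notin> {21, 22, 25, 26} \<longrightarrow> s' x = s x))"
proof -
  define f where "f = (\<lambda>v. (s 22 div 2 ^ v mod 2) * (s 19 mod 2) * (1 - s 21 div 2 ^ v mod 2))"
  have f: "f v \<le> 1" for v
  proof -
    have "f v \<le> 1 * 1 * 1" unfolding f_def by (intro mult_le_mono) auto
    then show ?thesis by simp
  qed
  define Inv where "Inv j s' \<longleftrightarrow> j \<le> n \<and> s' 25 = j \<and> s' 26 = digits_val B (rev (map f [0..<n - j])) \<and>
    s' 22 = s 22 div 2 ^ (n - j) \<and> s' 21 = s 21 div 2 ^ (n - j) \<and>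
    (\<forall>x. x \<notin> {21, 22, 25, 26} \<longrightarrow> s' x = s x)" for j s'
  have val: "digits_val B (rev (map f [0..<i])) < 2 ^ K" if "i \<le> n" for i
  proof -
    have "digits_val B (rev (map f [0..<i])) < B ^ length (rev (map f [0..<i]))"
    proof (rule digits_val_less, rule ballI)
      fix d assume "d \<in> set (rev (map f [0..<i]))"
      then have "d \<le> 1" using f by auto
      also note one_less_B
      finally show "d < B" .
    qed
    also have "\<dots> \<le> C" unfolding C_def using that one_less_B by (intro power_increasing) auto
    finally show ?thesis using small(2) by linarith
  qed
  have "runs (While (Reg 25) read_entry) s (n * (U + 4 * U) + U) (return_pmf ()) (\<lambda>s' _. Inv 0 s')"
  proof (rule runs_count_det)
    fix j s' assume I: "Inv (Suc j) s'" and j: "j < n"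
    let ?i = "n - Suc j"
    have i: "n - j = Suc ?i" using j by simp
    have r: "s' 25 = Suc j" "s' 26 = digits_val B (rev (map f [0..<?i]))" "s' 22 = s 22 div 2 ^ ?i"
      "s' 21 = s 21 div 2 ^ ?i" "s' 19 = s 19" "s' 5 = B" "\<forall>x. x \<notin> {21, 22, 25, 26} \<longrightarrow> s' x = s x"
      using I s unfolding Inv_def by auto
    have new: "digits_val B (rev (map f [0..<n - j])) = s' 26 * s' 5 + (s' 22 mod 2) * (s' 19 mod 2) * (1 - s' 21 mod 2)"
      unfolding i r by (simp add: f_def)
    have b: "s' 25 < 2 ^ K" "s' 26 < 2 ^ K" "s' 22 < 2 ^ K" "s' 21 < 2 ^ K" "s' 19 < 2 ^ K" "s' 5 < 2 ^ K"
      using val[of ?i] s j small div_less unfolding r by auto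
    define s2 where "s2 = s'(26 := s' 26 * s' 5 + (s' 22 mod 2) * (s' 19 mod 2) * (1 - s' 21 mod 2),
      22 := s' 22 div 2, 21 := s' 21 div 2, 25 := s' 25 - 1)"
    have "Inv j s2" using j unfolding Inv_def new
      by (auto simp: s2_def r(7)) (auto simp: r i div_pow_Suc)
    then show "runs read_entry s' (4 * U) (return_pmf ()) (\<lambda>s'' _. Inv j s'')"
      unfolding read_entry_def
      apply -
      apply (rule runs_le)
       apply (rule runs_step[where K = K and U = U], (use b in simp; fail), (simp; fail))+
       apply (rule runs_last[where K = K and U = U], (use b in simp; fail), (simp; fail))
       apply (simp add: s2_def)
      by simp
  next
    show "s' 25 = j \<and> 2 + bits j \<le> U" if "Inv j s'" "j \<le> n" for j s'
      using that bits_n unfolding Inv_def by blast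
  next
    show "Inv n s" unfolding Inv_def using s by simp
  qed
  then show ?thesis by (rule runs_mono) (auto simp: Inv_def f_def)
qed

definition entry :: "nat \<Rightarrow> nat \<Rightarrow> nat \<Rightarrow> nat \<Rightarrow> nat" where
  "entry qa qb u v = (code div 2 ^ (u * n + v) mod 2) * (qa div 2 ^ u mod 2) * (1 - qb div 2 ^ v mod 2)"

lemma entry_le: "entry qa qb u v \<le> 1"
proof -
  have "entry qa qb u v \<le> 1 * 1 * 1" unfolding entry_def by (intro mult_le_mono) auto
  then show ?thesis by simp
qed

lemma digits_val_less_C:
  assumes "\<forall>d\<in>set ds. d < B" "length ds \<le> n"
  shows "digits_val B ds < C"
proof -
  have "digits_val B ds < B ^ length ds" using assms(1) by (rule digits_val_less)
  also have "\<dots> \<le> C" unfolding C_def using assms(2) one_less_B by (intro power_increasing) auto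
  finally show ?thesis .
qed

lemma rows_val_less:
  assumes "\<forall>r\<in>set rs. \<forall>d\<in>set r. d < B" "\<forall>r\<in>set rs. length r \<le> n" "length rs \<le> n"
  shows "digits_val C (map (digits_val B) rs) < 2 ^ K"
proof -
  have "digits_val C (map (digits_val B) rs) < C ^ length (map (digits_val B) rs)"
    using assms(1,2) by (intro digits_val_less) (auto intro: digits_val_less_C)
  also have "\<dots> \<le> C ^ n" using assms(3) C_pos by (intro power_increasing) auto
  finally show ?thesis using small(3) by linarith
qed

definition row_list :: "nat \<Rightarrow> nat \<Rightarrow> nat \<Rightarrow> nat list" where
  "row_list qa qb u = rev (map (entry qa qb u) [0..<n])"

lemma row_list: "length (row_list qa qb u) = n" "d \<in> set (row_list qa qb u) \<Longrightarrow> d \<le> 1"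
  using entry_le by (auto simp: row_list_def)

lemma read_rows:
  assumes conf: "conf s" and s: "s 24 = n" "s 23 = 0" "s 22 = code" "s 19 < 2 ^ K" "s 20 < 2 ^ K"
  shows "runs (While (Reg 24) read_row) s (n * (U + (5 * n + 7) * U) + U) (return_pmf ()) (\<lambda>s' _.
     s' 23 = digits_val C (map (digits_val B) (rev (map (row_list (s 19) (s 20)) [0..<n]))) \<and>
     (\<forall>x. x \<notin> {19, 21, 22, 23, 24, 25, 26} \<longrightarrow> s' x = s x))"
proof -
  define R where "R = row_list (s 19) (s 20)"
  define X where "X i = digits_val C (map (digits_val B) (rev (map R [0..<i])))" for i
  define Inv where "Inv j s' \<longleftrightarrow> j \<le> n \<and> s' 24 = j \<and> s' 23 = X (n - j) \<and>
    s' 22 = code div 2 ^ ((n - j) * n) \<and> s' 19 = s 19 div 2 ^ (n - j) \<and>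
    (\<forall>x. x \<notin> {19, 21, 22, 23, 24, 25, 26} \<longrightarrow> s' x = s x)" for j s'
  have R: "\<forall>d\<in>set (R u). d < B" "length (R u) = n" for u
    using row_list le_less_trans[OF _ one_less_B] unfolding R_def by auto
  have X: "X i < 2 ^ K" if "i \<le> n" for i
    unfolding X_def using R that by (intro rows_val_less) auto
  have "runs (While (Reg 24) read_row) s (n * (U + (5 * n + 7) * U) + U) (return_pmf ()) (\<lambda>s' _. Inv 0 s')"
  proof (rule runs_count_det)
    fix j s' assume I: "Inv (Suc j) s'" and j: "j < n"
    let ?i = "n - Suc j"
    have i: "n - j = Suc ?i" using j by simp
    have r: "s' 24 = Suc j" "s' 23 = X ?i" "s' 22 = code div 2 ^ (?i * n)"
      "s' 19 = s 19 div 2 ^ ?i" "s' 20 = s 20" "s' 0 = n" "s' 5 = B" "s' 6 = C"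
      using I s conf unfolding Inv_def conf_def by auto
    have fr: "\<forall>x. x \<notin> {19, 21, 22, 23, 24, 25, 26} \<longrightarrow> s' x = s x" using I unfolding Inv_def by blast
    define s1 where "s1 = s'(21 := s 20, 26 := 0, 25 := n)"
    have "runs (While (Reg 25) read_entry) s1 (n * (U + 4 * U) + U) (return_pmf ()) (\<lambda>s2 _.
      s2 26 = digits_val B (rev (map (\<lambda>v. (s1 22 div 2 ^ v mod 2) * (s1 19 mod 2) * (1 - s1 21 div 2 ^ v mod 2)) [0..<n])) \<and>
      s2 22 = s1 22 div 2 ^ n \<and> (\<forall>x. x \<notin> {21, 22, 25, 26} \<longrightarrow> s2 x = s1 x))"
      by (rule read_entries) (use r s code in \<open>auto simp: s1_def intro: div_less\<close>)
    moreover have "(\<lambda>v. (s1 22 div 2 ^ v mod 2) * (s1 19 mod 2) * (1 - s1 21 div 2 ^ v mod 2)) = entry (s 19) (s 20) ?i"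
      by (simp add: fun_eq_iff entry_def s1_def r power_add div_mult2_eq)
    ultimately have loop: "runs (While (Reg 25) read_entry) s1 (n * (U + 4 * U) + U) (return_pmf ()) (\<lambda>s2 _.
      s2 26 = digits_val B (R ?i) \<and> s2 22 = code div 2 ^ (Suc ?i * n) \<and>
      (\<forall>x. x \<notin> {21, 22, 25, 26} \<longrightarrow> s2 x = s1 x))"
      by (simp add: R_def row_list_def s1_def r div_mult2_eq[symmetric] power_add mult.commute)
    have rest: "runs (23 ::= Reg 23 *\<^sub>e Reg 6 +\<^sub>e Reg 26 ;; 19 ::= Reg 19 div\<^sub>e Const 2 ;; 24 ::= Reg 24 -\<^sub>e Const 1)
        s2 (3 * U) (return_pmf ()) (\<lambda>s'' _. Inv j s'')"
      if s2: "s2 26 = digits_val B (R ?i)" "s2 22 = code div 2 ^ (Suc ?i * n)"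
        "\<forall>x. x \<notin> {21, 22, 25, 26} \<longrightarrow> s2 x = s1 x" for s2
    proof -
      have r2: "s2 24 = Suc j" "s2 23 = X ?i" "s2 19 = s 19 div 2 ^ ?i" "s2 6 = C"
        using s2(3) by (auto simp: s1_def r)
      have "digits_val B (R ?i) < C" using R by (intro digits_val_less_C) auto
      then have b: "s2 26 < 2 ^ K" "s2 24 < 2 ^ K" "s2 23 < 2 ^ K" "s2 19 < 2 ^ K" "s2 6 < 2 ^ K"
        using small X[of ?i] j s div_less by (auto simp: s2 r2)
      define s3 where "s3 = s2(23 := s2 23 * s2 6 + s2 26, 19 := s2 19 div 2, 24 := s2 24 - 1)"
      have "X (n - j) = X ?i * C + digits_val B (R ?i)" unfolding i by (simp add: X_def)
      then have "Inv j s3" using j unfolding Inv_def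
        by (auto simp: s3_def s2 r2) (auto simp: i div_pow_Suc s1_def fr)
      then show ?thesis
        apply -
        apply (rule runs_le)
         apply (rule runs_step[where K = K and U = U], (use b in simp; fail), (simp; fail))+
         apply (rule runs_last[where K = K and U = U], (use b in simp; fail), (simp; fail))
         apply (simp add: s3_def)
        by simp
    qed
    have b: "s' 20 < 2 ^ K" "s' 0 < 2 ^ K" using s small by (auto simp: r)
    show "runs read_row s' ((5 * n + 7) * U) (return_pmf ()) (\<lambda>s'' _. Inv j s'')"
      unfolding read_row_def
      apply (rule runs_le)
       apply (rule runs_step[where K = K and U = U], (use b in simp; fail), (simp; fail))+
       apply (rule runs_Seq_det)
       apply (simp add: r)
       apply (rule runs_mono[OF loop[unfolded s1_def]])
        apply (rule order_refl)
       apply (rule rest[unfolded One_nat_def]; simp add: s1_def)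
      by (simp add: algebra_simps)
  next
    show "s' 24 = j \<and> 2 + bits j \<le> U" if "Inv j s'" "j \<le> n" for j s'
      using that bits_n unfolding Inv_def by blast
  next
    show "Inv n s" unfolding Inv_def using s by (simp add: X_def)
  qed
  then show ?thesis by (rule runs_mono) (auto simp: Inv_def X_def R_def)
qed

lemma set_new_row:
  assumes "\<forall>d\<in>set r. d \<le> D" "\<forall>d\<in>set p. d \<le> D"
  shows "\<forall>d\<in>set (if even (hd r) then r else if p = [] then replicate (length r) 0 else map2 (+) r p). d \<le> 2 * (D::nat)"
  using assms by (auto dest!: set_zip_leftD set_zip_rightD elim!: in_set_zipE) fastforce+

lemma reduce_row_run:
  assumes conf: "conf s" and len: "length (r # rs) = n" "\<forall>r'\<in>set (r # rs). length r' \<le> n"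
    and digits: "\<forall>r'\<in>set (r # rs). \<forall>d\<in>set r'. d < B" and r: "length r = Suc j" "\<forall>d\<in>set r. d \<le> D"
    and p: "p = [] \<or> length p = Suc j \<and> odd (hd p)" "\<forall>d\<in>set p. d \<le> D" and D: "2 * D < B"
    and s: "s 23 = digits_val C (map (digits_val B) (r # rs))" "s 27 = digits_val B p"
      "s 24 = Suc i" "i < n" "s 28 < 2 ^ K" "p = [] \<longrightarrow> s 28 * Q < 2 ^ K"
  shows "runs reduce_row s (8 * U) (return_pmf ()) (\<lambda>s' _.
    s' 23 = digits_val C (map (digits_val B) (rs @ [new_row p r])) \<and>
    s' 27 = digits_val B (new_pivot p r) \<and> s' 24 = i \<and>
    s' 28 = (if p = [] \<and> odd (hd r) then s 28 * Q else s 28) \<and>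
    (\<forall>x. x \<notin> {23, 24, 26, 27, 28} \<longrightarrow> s' x = s x))"
proof -
  define r' where "r' = (if even (hd r) then r else if p = [] then replicate (length r) 0 else map2 (+) r p)"
  have r'_D: "\<forall>d\<in>set r'. d \<le> 2 * D" unfolding r'_def by (rule set_new_row[OF r(2) p(2)])
  then have r'_B: "\<forall>d\<in>set r'. d < B" using D by auto
  have len_r': "length r' = Suc j" using r(1) p(1) by (auto simp: r'_def)
  have j: "Suc j \<le> n" using len(2) r(1) by auto
  have val_r: "digits_val B r < C" using len(2) digits by (intro digits_val_less_C) auto
  have val_r': "digits_val B r' < C" using r'_B len_r' j by (intro digits_val_less_C) auto
  have val_p: "digits_val B p < C" using p D j by (intro digits_val_less_C) auto
  have X: "s 23 < 2 ^ K" unfolding s by (rule rows_val_less) (use len digits in auto)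
  have c: "s 5 = B" "s 6 = C" "s 7 = C ^ n" "s 11 = Q" using conf unfolding conf_def by auto
  have modC: "s 23 mod C = digits_val B r" and divC: "s 23 div C = digits_val C (map (digits_val B) rs)"
    using val_r by (auto simp: s)
  have div_r': "digits_val B r' div B = digits_val B (new_row p r)"
    unfolding new_row_def r'_def[symmetric] using len_r' r'_B by (intro digits_val_div) (cases r'; auto)+
  \<comment> \<open>The reduced row is added at position \<open>n\<close>, above the
    \<open>n\<close> stored rows; the division by \<open>C\<close> then discards the lowest row,
    which need not be cleared first.\<close>
  have shift: "(s 23 + digits_val B (new_row p r) * C ^ n) div C = digits_val C (map (digits_val B) (rs @ [new_row p r]))"
  proof -
    have "C ^ n = C * C ^ length rs" using len(1) by (metis length_Cons power_Suc)
    then have "s 23 + digits_val B (new_row p r) * C ^ n = s 23 + C * (C ^ length rs * digits_val B (new_row p r))"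
      by (simp only: mult_ac)
    also have "\<dots> div C = C ^ length rs * digits_val B (new_row p r) + s 23 div C"
      by (rule div_mult_self2) (use C_pos in simp)
    finally show ?thesis unfolding divC by (simp add: digits_val_append)
  qed
  have parity: "odd (digits_val B r) = odd (hd r)" using r(1) even_B by (intro odd_digits_val) auto
  have pivot0: "digits_val B p = 0 \<longleftrightarrow> p = []"
  proof (cases "p = []")
    case False
    then have "odd (digits_val B p)" using p(1) even_B by (subst odd_digits_val) auto
    then show ?thesis using False by (auto intro: Nat.gr0I)
  qed simp
  define s1 where "s1 = s(26 := digits_val B r)"
  define s2 where "s2 = s(26 := digits_val B r', 27 := digits_val B (new_pivot p r),
     28 := (if p = [] \<and> odd (hd r) then s 28 * Q else s 28))"
  have cond: "runs (If (Reg 26 mod\<^sub>e Const 2)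
       (If (Reg 27) (26 ::= Reg 26 +\<^sub>e Reg 27)
          (27 ::= Reg 26 ;; 26 ::= Const 0 ;; 28 ::= Reg 28 *\<^sub>e Reg 11)) Skip) s1 (U + (U + 3 * U))
     (return_pmf ()) (\<lambda>s' _. s' = s2)"
  proof (rule runs_If)
    have "s1 26 < 2 ^ K" using val_r small by (auto simp: s1_def)
    then show "1 + cost (Reg 26 mod\<^sub>e Const 2) s1 \<le> U" by (intro cost_less[where K = K]) auto
    assume "value_of (Reg 26 mod\<^sub>e Const 2) s1 \<noteq> 0"
    then have odd: "odd (hd r)" by (simp add: s1_def mod_2_eq_odd parity)
    show "runs (If (Reg 27) (26 ::= Reg 26 +\<^sub>e Reg 27)
          (27 ::= Reg 26 ;; 26 ::= Const 0 ;; 28 ::= Reg 28 *\<^sub>e Reg 11)) s1 (U + 3 * U)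
     (return_pmf ()) (\<lambda>s' _. s' = s2)"
    proof (rule runs_If)
      have "s1 27 < 2 ^ K" using val_p small by (auto simp: s1_def s)
      then show "1 + cost (Reg 27) s1 \<le> U" by (intro cost_less[where K = K]) auto
      show "runs (26 ::= Reg 26 +\<^sub>e Reg 27) s1 (3 * U) (return_pmf ()) (\<lambda>s' _. s' = s2)"
        if "value_of (Reg 27) s1 \<noteq> 0"
      proof -
        have "p \<noteq> []" using that by (simp add: s1_def s pivot0)
        then have "s2 = s1(26 := s1 26 + s1 27)"
          using odd r(1) p(1) s(2) by (auto simp: s1_def s2_def r'_def new_pivot_def digits_val_add fun_eq_iff)
        moreover have "s1 26 < 2 ^ K" "s1 27 < 2 ^ K" using val_p val_r small by (auto simp: s1_def s)
        ultimately show ?thesis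
          by (intro runs_le[OF runs_last[where K = K and U = U]]) auto
      qed
      show "runs (27 ::= Reg 26 ;; 26 ::= Const 0 ;; 28 ::= Reg 28 *\<^sub>e Reg 11) s1 (3 * U) (return_pmf ()) (\<lambda>s' _. s' = s2)"
        if "value_of (Reg 27) s1 = 0"
      proof -
        have p0: "p = []" using that by (simp add: s1_def s pivot0)
        have e: "s2 = s1(27 := s1 26, 26 := 0, 28 := s1 28 * s1 11)"
          using odd p0 by (auto simp: s1_def s2_def r'_def new_pivot_def digits_val_replicate_0 c fun_eq_iff)
        have b: "s1 26 < 2 ^ K" "s1 28 < 2 ^ K" "s1 11 < 2 ^ K"
          using val_r small s c by (auto simp: s1_def)
        show ?thesis
          apply (rule runs_le)
           apply (rule runs_step[where K = K and U = U], (use b in simp; fail), (simp; fail))+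
           apply (rule runs_last[where K = K and U = U], (use b in simp; fail), (simp; fail))
           apply (simp add: e)
          by simp
      qed
    qed
  next
    assume "value_of (Reg 26 mod\<^sub>e Const 2) s1 = 0"
    then have "even (hd r)" by (simp add: s1_def mod_2_eq_odd parity)
    then have "s1 = s2" using s(2) by (auto simp: s1_def s2_def r'_def new_pivot_def fun_eq_iff)
    then show "runs Skip s1 (U + 3 * U) (return_pmf ()) (\<lambda>s' _. s' = s2)" by (intro runs_Skip) auto
  qed
  have rest: "runs (23 ::= (Reg 23 +\<^sub>e (Reg 26 div\<^sub>e Reg 5) *\<^sub>e Reg 7) div\<^sub>e Reg 6 ;; 24 ::= Reg 24 -\<^sub>e Const 1)
     s2 (2 * U) (return_pmf ()) (\<lambda>s' _.
       s' 23 = digits_val C (map (digits_val B) (rs @ [new_row p r])) \<and>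
       s' 27 = digits_val B (new_pivot p r) \<and> s' 24 = i \<and>
       s' 28 = (if p = [] \<and> odd (hd r) then s 28 * Q else s 28) \<and>
       (\<forall>x. x \<notin> {23, 24, 26, 27, 28} \<longrightarrow> s' x = s x))" (is "runs _ _ _ _ ?post")
  proof -
    have b: "s2 23 < 2 ^ K" "s2 26 < 2 ^ K" "s2 5 < 2 ^ K" "s2 7 < 2 ^ K" "s2 6 < 2 ^ K" "s2 24 < 2 ^ K"
      using X val_r' small c s by (auto simp: s2_def)
    have "(s2 23 + s2 26 div s2 5 * s2 7) div s2 6 = digits_val C (map (digits_val B) (rs @ [new_row p r]))"
      using shift by (simp add: s2_def c div_r' del: power_Suc)
    then have "?post (s2(23 := (s2 23 + s2 26 div s2 5 * s2 7) div s2 6, 24 := s2 24 - 1)) ()"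
      using s by (simp add: s2_def)
    then show ?thesis
      apply -
      apply (rule runs_le)
       apply (rule runs_step[where K = K and U = U], (use b in simp; fail), (simp; fail))+
       apply (rule runs_last[where K = K and U = U], (use b in simp; fail), (simp; fail))
       apply (simp only: value_of.simps apply_op.simps fun_upd_other fun_upd_same, simp)
      by simp
  qed
  have b: "s 23 < 2 ^ K" "s 6 < 2 ^ K" using X c small by auto
  show ?thesis
    unfolding reduce_row_def
    apply (rule runs_le)
     apply (rule runs_step[where K = K and U = U], (use b in simp; fail), (simp; fail))
     apply (rule runs_Seq_det)
     apply (rule runs_mono[where P = "\<lambda>s' _. s' = s2"])
       apply (simp only: value_of.simps apply_op.simps c modC)
       apply (rule cond[unfolded s1_def])
      apply (rule order_refl)
     apply (simp only:)
     apply (rule rest)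
    by simp
qed

lemma reduce_rows:
  assumes conf: "conf s" and len: "length rs = n" "\<forall>r\<in>set rs. length r = Suc j" and j: "j < n"
    and D: "\<forall>r\<in>set rs. \<forall>d\<in>set r. d \<le> D" "2 * D < B"
    and s: "s 23 = digits_val C (map (digits_val B) rs)" "s 24 = n" "s 27 = 0" "s 28 * Q < 2 ^ K"
  shows "runs (While (Reg 24) reduce_row) s (n * (U + 8 * U) + U) (return_pmf ()) (\<lambda>s' _.
     s' 23 = digits_val C (map (digits_val B) (pass [] rs)) \<and>
     s' 28 = s 28 * Q ^ of_bool (\<exists>r\<in>set rs. odd (hd r)) \<and>
     (\<forall>r\<in>set (pass [] rs). length r = j \<and> (\<forall>d\<in>set r. d \<le> 2 * D)) \<and>
     (\<forall>x. x \<notin> {23, 24, 26, 27, 28} \<longrightarrow> s' x = s x))"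
proof -
  define Inv where "Inv i s' \<longleftrightarrow> (\<exists>done todo p. i \<le> n \<and> s' 24 = i \<and> length todo = i \<and>
    length done = n - i \<and> pass [] rs = done @ pass p todo \<and>
    s' 23 = digits_val C (map (digits_val B) (todo @ done)) \<and> s' 27 = digits_val B p \<and>
    (p = [] \<or> length p = Suc j \<and> odd (hd p)) \<and> (\<forall>d\<in>set p. d \<le> D) \<and> set todo \<subseteq> set rs \<and>
    ((\<exists>r\<in>set rs. odd (hd r)) \<longleftrightarrow> p \<noteq> [] \<or> (\<exists>r\<in>set todo. odd (hd r))) \<and>
    s' 28 = (if p = [] then s 28 else s 28 * Q) \<and>
    (\<forall>r\<in>set done. length r = j \<and> (\<forall>d\<in>set r. d \<le> 2 * D)) \<and>
    (\<forall>x. x \<notin> {23, 24, 26, 27, 28} \<longrightarrow> s' x = s x))" for i s'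
  have s28: "s 28 < 2 ^ K"
  proof -
    have "s 28 * 1 \<le> s 28 * Q" using Q(1) by (intro mult_le_mono2) simp
    then show ?thesis using s(4) by linarith
  qed
  have "runs (While (Reg 24) reduce_row) s (n * (U + 8 * U) + U) (return_pmf ()) (\<lambda>s' _. Inv 0 s')"
  proof (rule runs_count_det)
    fix i s' assume I: "Inv (Suc i) s'" and i: "i < n"
    then obtain "done" todo p where todo': "length todo = Suc i" and I':
      "s' 24 = Suc i" "length done = n - Suc i" "pass [] rs = done @ pass p todo"
      "s' 23 = digits_val C (map (digits_val B) (todo @ done))" "s' 27 = digits_val B p"
      "p = [] \<or> length p = Suc j \<and> odd (hd p)" "\<forall>d\<in>set p. d \<le> D" "set todo \<subseteq> set rs"
      "(\<exists>r\<in>set rs. odd (hd r)) \<longleftrightarrow> p \<noteq> [] \<or> (\<exists>r\<in>set todo. odd (hd r))"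
      "s' 28 = (if p = [] then s 28 else s 28 * Q)"
      "\<forall>r\<in>set done. length r = j \<and> (\<forall>d\<in>set r. d \<le> 2 * D)"
      "\<forall>x. x \<notin> {23, 24, 26, 27, 28} \<longrightarrow> s' x = s x"
      unfolding Inv_def by (elim exE conjE) (rule that)
    from todo' obtain r rest where todo: "todo = r # rest" "length rest = i"
      by (cases todo) auto
    have r: "r \<in> set rs" "length r = Suc j" "\<forall>d\<in>set r. d \<le> D" and rest: "set rest \<subseteq> set rs"
      using I'(8) len(2) D(1) unfolding todo by auto
    have lens: "\<forall>r'\<in>set (r # rest @ done). length r' \<le> n"
      using rest len(2) r(2) I'(11) j by auto
    have digits: "\<forall>r'\<in>set (r # rest @ done). \<forall>d\<in>set r'. d < B"
    proof (intro ballI)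
      fix r' d assume "r' \<in> set (r # rest @ done)" "d \<in> set r'"
      then have "d \<le> D \<or> d \<le> 2 * D" using rest r(3) D(1) I'(11) by auto
      then show "d < B" using D(2) by auto
    qed
    have conf': "conf s'" using conf I'(12) unfolding conf_def by auto
    have row: "length (new_row p r) = j" using I'(6) r(2) by (intro length_new_row) auto
    have tl: "set (tl xs) \<subseteq> set xs" for xs :: "nat list" by (cases xs) auto
    have row_D: "\<forall>d\<in>set (new_row p r). d \<le> 2 * D"
      unfolding new_row_def using set_new_row[OF r(3) I'(7)] subsetD[OF tl] by blast
    have "runs reduce_row s' (8 * U) (return_pmf ()) (\<lambda>s'' _.
      s'' 23 = digits_val C (map (digits_val B) ((rest @ done) @ [new_row p r])) \<and>
      s'' 27 = digits_val B (new_pivot p r) \<and> s'' 24 = i \<and>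
      s'' 28 = (if p = [] \<and> odd (hd r) then s' 28 * Q else s' 28) \<and>
      (\<forall>x. x \<notin> {23, 24, 26, 27, 28} \<longrightarrow> s'' x = s' x))"
    proof (rule reduce_row_run[OF conf' _ lens digits r(2,3) I'(6,7) D(2) _ I'(5,1) i])
      show "length (r # rest @ done) = n" using todo I'(2) i by simp
      show "s' 23 = digits_val C (map (digits_val B) (r # rest @ done))" using I'(4) by (simp add: todo)
      show "s' 28 < 2 ^ K" "p = [] \<longrightarrow> s' 28 * Q < 2 ^ K" using s28 s(4) by (auto simp: I'(10))
    qed
    then show "runs reduce_row s' (8 * U) (return_pmf ()) (\<lambda>s'' _. Inv i s'')"
    proof (rule runs_mono)
      fix s'' assume s'': "s'' 23 = digits_val C (map (digits_val B) ((rest @ done) @ [new_row p r])) \<and>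
        s'' 27 = digits_val B (new_pivot p r) \<and> s'' 24 = i \<and>
        s'' 28 = (if p = [] \<and> odd (hd r) then s' 28 * Q else s' 28) \<and>
        (\<forall>x. x \<notin> {23, 24, 26, 27, 28} \<longrightarrow> s'' x = s' x)"
      have "r \<noteq> []" using r(2) by auto
      then have np: "new_pivot p r = [] \<longleftrightarrow> p = [] \<and> even (hd r)" by (auto simp: new_pivot_def)
      have 1: "pass [] rs = (done @ [new_row p r]) @ pass (new_pivot p r) rest" using I'(3) by (simp add: todo)
      have 2: "new_pivot p r = [] \<or> length (new_pivot p r) = Suc j \<and> odd (hd (new_pivot p r))"
        using I'(6) r by (auto simp: new_pivot_def)
      have 3: "\<forall>d\<in>set (new_pivot p r). d \<le> D"
        using I'(7) r by (auto simp: new_pivot_def)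
      have 4: "(\<exists>r\<in>set rs. odd (hd r)) \<longleftrightarrow> new_pivot p r \<noteq> [] \<or> (\<exists>r\<in>set rest. odd (hd r))"
        unfolding np I'(9) todo by auto
      have 5: "s'' 28 = (if new_pivot p r = [] then s 28 else s 28 * Q)"
        using s'' unfolding np I'(10) by simp
      have 6: "\<forall>x. x \<notin> {23, 24, 26, 27, 28} \<longrightarrow> s'' x = s x" using s'' I'(12) by simp
      have 7: "\<forall>r\<in>set (done @ [new_row p r]). length r = j \<and> (\<forall>d\<in>set r. d \<le> 2 * D)"
        using I'(11) row row_D by auto
      show "Inv i s''"
        unfolding Inv_def
      proof (intro exI conjI)
        show "s'' 23 = digits_val C (map (digits_val B) (rest @ done @ [new_row p r]))"
          "s'' 24 = i" "s'' 27 = digits_val B (new_pivot p r)" using s'' by simp_all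
        show "length (done @ [new_row p r]) = n - i" using i I'(2) by simp
      qed (fact 1 2 3 4 5 6 7 todo(2) rest | use i in simp)+
    qed simp
  next
    show "s' 24 = i \<and> 2 + bits i \<le> U" if "Inv i s'" "i \<le> n" for i s'
    proof
      show "s' 24 = i" using that(1) unfolding Inv_def by (elim exE conjE)
      show "2 + bits i \<le> U" by (rule bits_n[OF that(2)])
    qed
  next
    show "Inv n s" unfolding Inv_def
      by (rule exI[of _ "[]"], rule exI[of _ rs], rule exI[of _ "[]"]) (use len s in auto)
  qed
  then show ?thesis
  proof (rule runs_mono)
    fix s' assume "Inv 0 s'"
    then obtain "done" todo p where "length todo = 0" "pass [] rs = done @ pass p todo"
      "s' 23 = digits_val C (map (digits_val B) (todo @ done))"
      "(\<exists>r\<in>set rs. odd (hd r)) \<longleftrightarrow> p \<noteq> [] \<or> (\<exists>r\<in>set todo. odd (hd r))"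
      "s' 28 = (if p = [] then s 28 else s 28 * Q)"
      "\<forall>r\<in>set done. length r = j \<and> (\<forall>d\<in>set r. d \<le> 2 * D)"
      "\<forall>x. x \<notin> {23, 24, 26, 27, 28} \<longrightarrow> s' x = s x"
      unfolding Inv_def by (elim exE conjE) (rule that)
    then show "s' 23 = digits_val C (map (digits_val B) (pass [] rs)) \<and>
      s' 28 = s 28 * Q ^ of_bool (\<exists>r\<in>set rs. odd (hd r)) \<and>
      (\<forall>r\<in>set (pass [] rs). length r = j \<and> (\<forall>d\<in>set r. d \<le> 2 * D)) \<and>
      (\<forall>x. x \<notin> {23, 24, 26, 27, 28} \<longrightarrow> s' x = s x)" by simp
  qed simp
qed

lemma reduce_columns:
  assumes conf: "conf s" and len: "length rs = n" "\<forall>r\<in>set rs. length r = n"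
    and le1: "\<forall>r\<in>set rs. \<forall>d\<in>set r. d \<le> 1"
    and s: "s 23 = digits_val C (map (digits_val B) rs)" "s 25 = n" "s 28 = 1"
  shows "runs (While (Reg 25) reduce_column) s (n * (U + (9 * n + 4) * U) + U) (return_pmf ()) (\<lambda>s' _.
     s' 28 = Q ^ gauss_rank n rs \<and> (\<forall>x. x \<notin> {23, 24, 25, 26, 27, 28} \<longrightarrow> s' x = s x))"
proof -
  \<comment> \<open>Register 28 times the power of \<open>Q\<close> for the rank still to be found
    is constant, while the bound on the entries doubles with every column.\<close>
  define Inv where "Inv i s' \<longleftrightarrow> (\<exists>rs'. i \<le> n \<and> s' 25 = i \<and> length rs' = n \<and>
    (\<forall>r\<in>set rs'. length r = i \<and> (\<forall>d\<in>set r. d \<le> 2 ^ (n - i))) \<and>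
    s' 23 = digits_val C (map (digits_val B) rs') \<and> s' 28 * Q ^ gauss_rank i rs' = Q ^ gauss_rank n rs \<and>
    (\<forall>x. x \<notin> {23, 24, 25, 26, 27, 28} \<longrightarrow> s' x = s x))" for i s'
  have "runs (While (Reg 25) reduce_column) s (n * (U + (9 * n + 4) * U) + U) (return_pmf ()) (\<lambda>s' _. Inv 0 s')"
  proof (rule runs_count_det)
    fix i s' assume I: "Inv (Suc i) s'" and i: "i < n"
    then obtain rs' where I': "s' 25 = Suc i" "length rs' = n"
      "\<forall>r\<in>set rs'. length r = Suc i \<and> (\<forall>d\<in>set r. d \<le> 2 ^ (n - Suc i))"
      "s' 23 = digits_val C (map (digits_val B) rs')" "s' 28 * Q ^ gauss_rank (Suc i) rs' = Q ^ gauss_rank n rs"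
      "\<forall>x. x \<notin> {23, 24, 25, 26, 27, 28} \<longrightarrow> s' x = s x"
      unfolding Inv_def by (elim exE conjE) (rule that)
    have conf': "conf s'" using conf I'(6) unfolding conf_def by simp
    define s1 where "s1 = s'(27 := 0, 24 := n)"
    have s1: "conf s1" using conf' unfolding conf_def s1_def by simp
    have pow: "2 * 2 ^ (n - Suc i) = (2::nat) ^ (n - i)" using i by (simp flip: power_Suc add: Suc_diff_Suc)
    have D: "2 * 2 ^ (n - Suc i) < B" unfolding pow B_def by (rule power_strict_increasing) auto
    have le: "Q ^ gauss_rank n rs \<le> Q ^ n" using gauss_rank_le Q(1) by (intro power_increasing) auto
    have den: "s' 28 \<le> Q ^ n"
    proof -
      have "s' 28 * 1 \<le> s' 28 * Q ^ gauss_rank (Suc i) rs'" using Q(1) by (intro mult_le_mono2) simp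
      then show ?thesis using le unfolding I'(5) by linarith
    qed
    have den_Q: "s1 28 * Q < 2 ^ K"
    proof -
      have "s' 28 * Q \<le> Q ^ n * Q" using den by (rule mult_le_mono1)
      also have "\<dots> = Q ^ Suc n" by simp
      also note Q(2)
      finally show ?thesis by (simp add: s1_def)
    qed
    have loop: "runs (While (Reg 24) reduce_row) s1 (n * (U + 8 * U) + U) (return_pmf ()) (\<lambda>s2 _.
      s2 23 = digits_val C (map (digits_val B) (pass [] rs')) \<and>
      s2 28 = s1 28 * Q ^ of_bool (\<exists>r\<in>set rs'. odd (hd r)) \<and>
      (\<forall>r\<in>set (pass [] rs'). length r = i \<and> (\<forall>d\<in>set r. d \<le> 2 * 2 ^ (n - Suc i))) \<and>
      (\<forall>x. x \<notin> {23, 24, 26, 27, 28} \<longrightarrow> s2 x = s1 x))"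
      by (rule reduce_rows[OF s1 I'(2) _ i _ D _ _ _ den_Q]) (use I' in \<open>auto simp: s1_def\<close>)
    have rest: "runs (25 ::= Reg 25 -\<^sub>e Const 1) s2 U (return_pmf ()) (\<lambda>s'' _. Inv i s'')"
      if s2: "s2 23 = digits_val C (map (digits_val B) (pass [] rs'))"
        "s2 28 = s1 28 * Q ^ of_bool (\<exists>r\<in>set rs'. odd (hd r))"
        "\<forall>r\<in>set (pass [] rs'). length r = i \<and> (\<forall>d\<in>set r. d \<le> 2 * 2 ^ (n - Suc i))"
        "\<forall>x. x \<notin> {23, 24, 26, 27, 28} \<longrightarrow> s2 x = s1 x" for s2
    proof -
      have lp: "length (pass p xs) = length xs" for p xs by (induction xs arbitrary: p) auto
      have 25: "s2 25 = Suc i" using s2(4) by (simp add: s1_def I'(1))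
      have "Inv i (s2(25 := s2 25 - 1))" unfolding Inv_def
      proof (intro exI conjI)
        show "\<forall>x. x \<notin> {23, 24, 25, 26, 27, 28} \<longrightarrow> (s2(25 := s2 25 - 1)) x = s x"
          using s2(4) I'(6) by (simp add: s1_def)
        show "(s2(25 := s2 25 - 1)) 23 = digits_val C (map (digits_val B) (pass [] rs'))" using s2(1) by simp
        show "\<forall>r\<in>set (pass [] rs'). length r = i \<and> (\<forall>d\<in>set r. d \<le> 2 ^ (n - i))" using s2(3) unfolding pow .
        show "(s2(25 := s2 25 - 1)) 28 * Q ^ gauss_rank i (pass [] rs') = Q ^ gauss_rank n rs"
          using I'(5) s2(2) by (simp add: s1_def power_add mult.assoc)
      qed (use i 25 lp I'(2) in simp_all)
      moreover have "s2 25 < 2 ^ K" unfolding 25 using i small(6) by linarith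
      ultimately show ?thesis by (intro runs_last[where K = K]) simp_all
    qed
    have c0: "s' 0 = n" using conf' by (simp add: conf_def)
    have b: "s' 0 < 2 ^ K" unfolding c0 by (rule small)
    show "runs reduce_column s' ((9 * n + 4) * U) (return_pmf ()) (\<lambda>s'' _. Inv i s'')"
      unfolding reduce_column_def
      apply (rule runs_le)
       apply (rule runs_step[where K = K and U = U], (use b in simp; fail), (simp; fail))+
       apply (rule runs_Seq_det)
       apply (simp add: c0)
       apply (rule runs_mono[OF loop[unfolded s1_def]])
        apply (rule order_refl)
       apply (rule rest[unfolded One_nat_def]; simp add: s1_def)
      by (simp add: algebra_simps)
  next
    show "s' 25 = i \<and> 2 + bits i \<le> U" if "Inv i s'" "i \<le> n" for i s'
    proof
      show "s' 25 = i" using that(1) unfolding Inv_def by (elim exE conjE)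
      show "2 + bits i \<le> U" by (rule bits_n[OF that(2)])
    qed
  next
    show "Inv n s" unfolding Inv_def using len le1 s by (intro exI[of _ rs]) auto
  qed
  then show ?thesis
  proof (rule runs_mono)
    fix s' assume "Inv 0 s'"
    then obtain rs' where "s' 28 * Q ^ gauss_rank 0 rs' = Q ^ gauss_rank n rs"
      "\<forall>x. x \<notin> {23, 24, 25, 26, 27, 28} \<longrightarrow> s' x = s x"
      unfolding Inv_def by (elim exE conjE) (rule that)
    then show "s' 28 = Q ^ gauss_rank n rs \<and> (\<forall>x. x \<notin> {23, 24, 25, 26, 27, 28} \<longrightarrow> s' x = s x)" by simp
  qed simp
qed

definition edge :: "nat \<Rightarrow> nat \<Rightarrow> bool" where
  "edge u v \<longleftrightarrow> u < m \<and> v < m \<and> u * n + v \<in> set_decode code"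

text \<open>The number \<open>2 ^ n - 2 ^ m\<close> has exactly the bits from \<open>m\<close> to
  \<open>n - 1\<close>, disjoint from those of \<open>x mod 2 ^ m\<close>; the addition has no
  carries and acts as a union.\<close>

lemma set_decode_mask:
  assumes "k < n"
  shows "k \<in> set_decode (x mod 2 ^ m + (2 ^ n - 2 ^ m)) \<longleftrightarrow> (k < m \<longrightarrow> k \<in> set_decode x)"
proof -
  have "(2::nat) ^ n - 2 ^ m = push_bit m (mask (n - m))"
    using m by (simp add: push_bit_eq_mult mask_eq_exp_minus_1 diff_mult_distrib flip: power_add)
  then have "x mod 2 ^ m + (2 ^ n - 2 ^ m) = take_bit m x + push_bit m (mask (n - m))"
    by (simp add: take_bit_eq_mod)
  moreover have "bit (take_bit m x + push_bit m (mask (n - m))) k \<longleftrightarrow>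
      bit (take_bit m x) k \<or> bit (push_bit m (mask (n - m)) :: nat) k"
    by (subst disjunctive_add_eq_or)
       (auto simp: bit_eq_iff bit_and_iff bit_or_iff bit_take_bit_iff bit_push_bit_iff)
  ultimately show ?thesis using assms
    by (auto simp: set_decode_bit bit_take_bit_iff bit_push_bit_iff bit_mask_iff)
qed

lemma entry_eq:
  assumes "u < n" "v < n"
  shows "entry (q mod 2 ^ m) (q div 2 ^ n mod 2 ^ m + (2 ^ n - 2 ^ m)) u v =
    of_bool (u \<in> set_decode q \<and> n + v \<notin> set_decode q \<and> edge u v)"
  unfolding entry_def div_pow_mod_2 set_decode_mod set_decode_mask[OF assms(2)] set_decode_div edge_def
  by auto

lemma runs_eval_weight:
  assumes conf: "conf s" and q: "s 18 < 2 ^ K"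
  shows "runs eval_weight s ((14 * n ^ 2 + 15 * n + 9) * U) (return_pmf ()) (\<lambda>s' _.
     s' 28 = Q ^ cut_rank n edge (set_decode (s 18)) \<and> (\<forall>x. x \<notin> {19..28} \<longrightarrow> s' x = s x))"
proof -
  define qa qb where "qa = s 18 mod 2 ^ m" and "qb = s 18 div 2 ^ n mod 2 ^ m + (2 ^ n - 2 ^ m)"
  define rs where "rs = rev (map (row_list qa qb) [0..<n])"
  define s1 where "s1 = s(19 := qa, 20 := qb, 22 := code, 23 := 0, 24 := n)"
  have c: "s 0 = n" "s 1 = code" "s 4 = 2 ^ n" "s 14 = 2 ^ m" "s (Suc 0) = code" using conf by (simp_all add: conf_def)
  have conf1: "conf s1" using conf unfolding conf_def s1_def by simp
  have qab: "qa < 2 ^ K" "qb < 2 ^ K"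
  proof -
    show "qa < 2 ^ K" unfolding qa_def using q by (rule mod_less)
    have "s 18 div 2 ^ n mod 2 ^ m < 2 ^ m" by simp
    moreover have "(2::nat) ^ m \<le> 2 ^ n" using m by (intro power_increasing) auto
    ultimately have "qb < 2 ^ n" unfolding qb_def by linarith
    then show "qb < 2 ^ K" using small(4) by linarith
  qed
  have read: "runs (While (Reg 24) read_row) s1 (n * (U + (5 * n + 7) * U) + U) (return_pmf ()) (\<lambda>s2 _.
     s2 23 = digits_val C (map (digits_val B) rs) \<and>
     (\<forall>x. x \<notin> {19, 21, 22, 23, 24, 25, 26} \<longrightarrow> s2 x = s1 x))"
    using read_rows[OF conf1] qab by (simp add: s1_def rs_def)
  have rank: "gauss_rank n rs = cut_rank n edge (set_decode (s 18))"
  proof (rule gauss_rank_eq_cut_rank)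
    have "row_list qa qb u = map (\<lambda>t. of_bool (u \<in> set_decode (s 18) \<and> n + (n - 1 - t) \<notin> set_decode (s 18) \<and>
        edge u (n - 1 - t))) [0..<n]" if "u < n" for u
      by (rule nth_equalityI) (use that in \<open>auto simp: row_list_def rev_nth entry_eq qa_def qb_def\<close>)
    then show "set rs = (\<lambda>u. map (\<lambda>t. of_bool (u \<in> set_decode (s 18) \<and> n + (n - 1 - t) \<notin> set_decode (s 18) \<and>
        edge u (n - 1 - t))) [0..<n]) ` {..<n}"
      unfolding rs_def set_rev set_map set_upt atLeast0LessThan by (intro image_cong) auto
  qed
  have rest: "runs (28 ::= Const 1 ;; 25 ::= Reg 0 ;; While (Reg 25) reduce_column) s2
      (U + (U + (n * (U + (9 * n + 4) * U) + U))) (return_pmf ()) (\<lambda>s' _.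
        s' 28 = Q ^ cut_rank n edge (set_decode (s 18)) \<and> (\<forall>x. x \<notin> {19..28} \<longrightarrow> s' x = s x))"
    if s2: "s2 23 = digits_val C (map (digits_val B) rs)"
      "\<forall>x. x \<notin> {19, 21, 22, 23, 24, 25, 26} \<longrightarrow> s2 x = s1 x" for s2
  proof -
    have c2: "s2 0 = n" using s2(2) c by (simp add: s1_def)
    have conf3: "conf (s2(28 := 1, 25 := n))" using conf1 s2(2) unfolding conf_def by simp
    have "runs (While (Reg 25) reduce_column) (s2(28 := 1, 25 := n)) (n * (U + (9 * n + 4) * U) + U) (return_pmf ()) (\<lambda>s' _.
      s' 28 = Q ^ gauss_rank n rs \<and>
      (\<forall>x. x \<notin> {23, 24, 25, 26, 27, 28} \<longrightarrow> s' x = (s2(28 := 1, 25 := n)) x))"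
      by (rule reduce_columns[OF conf3]) (use row_list s2(1) in \<open>auto simp: rs_def\<close>)
    then have loop: "runs (While (Reg 25) reduce_column) (s2(28 := 1, 25 := n)) (n * (U + (9 * n + 4) * U) + U) (return_pmf ()) (\<lambda>s' _.
      s' 28 = Q ^ cut_rank n edge (set_decode (s 18)) \<and> (\<forall>x. x \<notin> {19..28} \<longrightarrow> s' x = s x))"
    proof (rule runs_mono, goal_cases)
      case (2 s')
      have "s' x = s x" if x: "x \<notin> {19..28}" for x
      proof -
        have "x \<noteq> 19" "x \<noteq> 20" "x \<noteq> 21" "x \<noteq> 22" "x \<noteq> 23" "x \<noteq> 24" "x \<noteq> 25" "x \<noteq> 26" "x \<noteq> 27" "x \<noteq> 28"
          using x by auto
        then show ?thesis using 2(2) s2(2) by (simp add: s1_def)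
      qed
      then show ?case using 2(2) rank by simp
    qed simp
    have b: "s2 0 < 2 ^ K" unfolding c2 by (rule small)
    show ?thesis
      apply (rule runs_step[where K = K and U = U], (use b in simp; fail), (simp; fail))+
      using loop by (simp add: c2)
  qed
  have b: "s 18 < 2 ^ K" "s 14 < 2 ^ K" "s 4 < 2 ^ K" "s 1 < 2 ^ K" "s 0 < 2 ^ K" "s (Suc 0) < 2 ^ K"
    using q small code by (simp_all add: c)
  define P where "P s2 \<longleftrightarrow> s2 23 = digits_val C (map (digits_val B) rs) \<and>
     (\<forall>x. x \<notin> {19, 21, 22, 23, 24, 25, 26} \<longrightarrow> s2 x = s1 x)" for s2
  show ?thesis
    unfolding eval_weight_def
    apply (rule runs_le)
     apply (rule runs_step[where K = K and U = U], (use b in simp; fail), (simp; fail))+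
     apply (rule runs_Seq_det)
     apply (rule runs_mono[where P = "\<lambda>s2 _. P s2"])
       apply (simp only: value_of.simps apply_op.simps fun_upd_other fun_upd_same)
       apply (simp add: c qa_def[symmetric] qb_def[symmetric])
       apply (rule read[folded P_def, unfolded s1_def])
      apply (rule order_refl)
     apply (rule rest; simp add: P_def)
    by (simp add: algebra_simps power2_eq_square)
qed

end

section \<open>Simulating the sampler\<close>

primrec shift_expr :: "expr \<Rightarrow> expr" where
  "shift_expr (Const k) = Const k"
| "shift_expr (Reg x) = Reg (x + 30)"
| "shift_expr (Bin f e1 e2) = Bin f (shift_expr e1) (shift_expr e2)"

text \<open>A query is reduced modulo \<open>4 ^ n\<close> because the sampler may ask about any
  number, however long, and the elimination has to work on bounded ones. The numerator of the answer
  is always 1.\<close>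

primrec simulate :: "com \<Rightarrow> com" where
  "simulate Skip = Skip"
| "simulate (Assign x e) = Assign (x + 30) (shift_expr e)"
| "simulate (Flip x) = Flip (x + 30)"
| "simulate (Query x y e) =
     18 ::= shift_expr e mod\<^sub>e (Reg 4 *\<^sub>e Reg 4) ;;
     eval_weight ;;
     (x + 30) ::= Const 1 ;;
     (y + 30) ::= Reg 28"
| "simulate (Seq c1 c2) = Seq (simulate c1) (simulate c2)"
| "simulate (If e c1 c2) = If (shift_expr e) (simulate c1) (simulate c2)"
| "simulate (While e c) = While (shift_expr e) (simulate c)"

lemma query_free_eval_weight: "query_free eval_weight"
  by (simp add: eval_weight_def read_row_def read_entry_def reduce_column_def reduce_row_def)

lemma query_free_simulate: "query_free (simulate c)"
  by (induction c) (simp_all add: query_free_eval_weight)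

text \<open>Registers 18 to 29 are left unconstrained, since the evaluation of weights overwrites
  scratch space there.\<close>

definition sim :: "state \<Rightarrow> state \<Rightarrow> state \<Rightarrow> bool" where
  "sim s0 s' s \<longleftrightarrow> (\<forall>x. s' (x + 30) = s x) \<and> (\<forall>x<18. s' x = s0 x)"

lemma value_of_shift_expr: "sim s0 s' s \<Longrightarrow> value_of (shift_expr e) s' = value_of e s"
  by (induction e) (simp_all add: sim_def)

lemma cost_shift_expr:
  assumes "sim s0 s' s" shows "cost (shift_expr e) s' = cost e s"
  using value_of_shift_expr[OF assms] assms by (induction e) (simp_all add: sim_def)

lemma sim_upd: "sim s0 s' s \<Longrightarrow> sim s0 (s'(x + 30 := v)) (s(x := v))"
  by (auto simp: sim_def)

context eval_context
begin

text \<open>On codes of subsets of the ground set the reduction changes nothing; elsewhere it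
  specifies the answers that the simulation gives.\<close>

definition weight_oracle :: oracle_fun where
  "weight_oracle q = (1, Q ^ cut_rank n edge (set_decode (q mod (2 ^ n * 2 ^ n))))"

abbreviation "W \<equiv> (14 * n ^ 2 + 15 * n + 20) * U"

lemma sim_conf: "sim s0 s' s \<Longrightarrow> conf s0 \<Longrightarrow> conf s'"
  by (simp add: sim_def conf_def)

lemma four_pow_le: "2 ^ n * 2 ^ n \<le> C"
proof -
  have "2 * n \<le> Suc n * n" using n by (intro mult_le_mono1) simp
  then have "(2::nat) ^ (2 * n) \<le> 2 ^ (Suc n * n)" by (intro power_increasing) auto
  also have "\<dots> = C" by (simp only: C_def B_def power_mult)
  finally show ?thesis by (simp only: power_add[symmetric] mult_2)
qed

lemma four_pow: "2 ^ n * 2 ^ n < (2::nat) ^ K"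
  using four_pow_le small(2) by linarith

lemma simulate_query:
  assumes sim: "sim s0 s' s" and conf: "conf s0" and ab: "weight_oracle (value_of e s) = (a, b)"
  shows "runs (simulate (Query x y e)) s' (cost e s + W) (return_pmf ()) (\<lambda>s'' _. sim s0 s'' (s(x := a, y := b)))"
proof -
  have conf': "conf s'" using sim_conf[OF sim conf] .
  define q where "q = value_of e s mod (2 ^ n * 2 ^ n)"
  have c: "s' 4 = 2 ^ n" using conf' by (simp add: conf_def)
  have "q < 2 ^ n * 2 ^ n" unfolding q_def by (rule mod_less_divisor) simp
  then have q: "q < 2 ^ K" using four_pow by linarith
  have val_q: "value_of (shift_expr e mod\<^sub>e (Reg 4 *\<^sub>e Reg 4)) s' = q"
    by (simp add: value_of_shift_expr[OF sim] c q_def)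
  have cost: "1 + cost (shift_expr e mod\<^sub>e (Reg 4 *\<^sub>e Reg 4)) s' \<le> cost e s + U"
  proof -
    have "cost (Reg 4 *\<^sub>e Reg 4) s' \<le> cost_bound K (Reg 4 *\<^sub>e Reg 4)"
      by (rule cost_le) (simp add: c small)
    moreover have "bits q \<le> K" using q by (simp add: bits_le_iff)
    ultimately show ?thesis
      using val_q by (simp add: cost_shift_expr[OF sim] del: cost.simps(1,2))
  qed
  have ab': "a = 1" "b = Q ^ cut_rank n edge (set_decode q)"
    using ab by (simp_all add: weight_oracle_def q_def)
  define s1 where "s1 = s'(18 := q)"
  have "conf s1" using conf' by (simp add: conf_def s1_def)
  moreover have "s1 18 < 2 ^ K" using q by (simp add: s1_def)
  ultimately have ev: "runs eval_weight s1 ((14 * n ^ 2 + 15 * n + 9) * U) (return_pmf ()) (\<lambda>s2 _.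
     s2 28 = b \<and> (\<forall>x. x \<notin> {19..28} \<longrightarrow> s2 x = s1 x))"
    using runs_eval_weight[of s1] by (simp add: ab' s1_def)
  have b: "b < 2 ^ K"
  proof -
    have "b \<le> Q ^ Suc n" unfolding ab' using cut_rank_le Q(1) by (intro power_increasing) (auto intro: le_SucI)
    then show ?thesis using Q(2) by linarith
  qed
  have rest: "runs ((x + 30) ::= Const 1 ;; (y + 30) ::= Reg 28) s2 (2 * U) (return_pmf ())
      (\<lambda>s'' _. sim s0 s'' (s(x := a, y := b)))"
    if s2: "s2 28 = b" "\<forall>x. x \<notin> {19..28} \<longrightarrow> s2 x = s1 x" for s2
  proof -
    have "sim s0 s2 s" using sim s2(2) by (simp add: sim_def s1_def)
    then have "sim s0 (s2(x + 30 := a, y + 30 := b)) (s(x := a, y := b))" by (intro sim_upd)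
    then show ?thesis
      apply -
      apply (rule runs_le)
       apply (rule runs_step[where K = K and U = U], (use b s2 in simp; fail), (simp; fail))+
       apply (rule runs_last[where K = K and U = U], (use b s2 in simp; fail), (simp; fail))
       apply (use ab' s2 in simp)
      by simp
  qed
  show ?thesis
    unfolding simulate.simps
    apply (rule runs_le)
     apply (rule runs_Assign_Seq[OF cost])
     apply (rule runs_Seq_det)
     apply (rule runs_mono)
       apply (simp only: val_q)
       apply (rule ev[unfolded s1_def])
      apply (rule order_refl)
     apply (rule rest; simp add: s1_def)
    by (simp add: algebra_simps)
qed

text \<open>The ideal distribution is the sampler's own run, including its running time. Time is
  thus compared outcome by outcome: every unit spent by the sampler pays for \<open>W\<close> units
  of the simulation, enough for one elimination per query.\<close>

lemma runsT_simulate: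
  assumes "exec weight_oracle c s r" "conf s0" "sim s0 s' s"
  shows "runsT (simulate c) s' r (\<lambda>s'' t' (s1, t1). sim s0 s'' s1 \<and> t' \<le> W * t1)"
proof -
  define w where "w = W"
  have w: "1 \<le> w" unfolding w_def by simp
  have le: "k \<le> w * k" for k using mult_le_mono1[OF w, of k] by simp
  have delayed: "runsT c s (delay k r) (\<lambda>s'' t' (s1, t1). sim s0 s'' s1 \<and> k' + t' \<le> w * t1)"
    if "runsT c s r (\<lambda>s'' t' (s1, t1). sim s0 s'' s1 \<and> t' \<le> w * t1)" "k' \<le> w * k" for c s r k k'
    unfolding runsT_map using that(1)
    by (rule runsT_mono) (use that(2) in \<open>auto simp: distrib_left intro: add_mono\<close>)
  have seq: "runsT (Seq c1 c2) s' (bind_pmf r (\<lambda>(s1, t1). delay t1 (q s1)))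
      (\<lambda>s'' t' (s1, t1). sim s0 s'' s1 \<and> t' \<le> w * t1)"
    if c1: "runsT c1 s' r (\<lambda>s'' t' (s1, t1). sim s0 s'' s1 \<and> t' \<le> w * t1)"
      and c2: "\<And>s1 t1 s1'. (s1, t1) \<in> set_pmf r \<Longrightarrow> sim s0 s1' s1 \<Longrightarrow>
        runsT c2 s1' (q s1) (\<lambda>s'' t' (s1, t1). sim s0 s'' s1 \<and> t' \<le> w * t1)" for c1 c2 s' r q
  proof (rule runsT_Seq[OF c1])
    fix s1' t1' a
    assume a: "a \<in> set_pmf r" "case a of (s1, t1) \<Rightarrow> sim s0 s1' s1 \<and> t1' \<le> w * t1"
    obtain s1 t1 where a_eq: "a = (s1, t1)" by (cases a)
    show "runsT c2 s1' (case a of (s1, t1) \<Rightarrow> delay t1 (q s1))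
       (\<lambda>s2 t2 (s3, t3). sim s0 s2 s3 \<and> t1' + t2 \<le> w * t3)"
      unfolding a_eq prod.case by (rule delayed[OF c2]) (use a a_eq in auto)
  qed
  from assms(1,3) have "runsT (simulate c) s' r (\<lambda>s'' t' (s1, t1). sim s0 s'' s1 \<and> t' \<le> w * t1)"
  proof (induction arbitrary: s' rule: exec.induct)
    case (Skip s)
    then show ?case using w by (auto intro!: runsT_Skip)
  next
    case (Assign x e s)
    then show ?case
      using sim_upd[OF Assign] le[of "1 + cost e s"]
      by (auto intro!: runsT_Assign simp: value_of_shift_expr cost_shift_expr)
  next
    case (Flip x s)
    then show ?case using sim_upd[OF Flip] w by (auto intro!: runsT_Flip)
  next
    case (Query e s a b x y)
    let ?t = "1 + cost e s + bits a + bits b"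
    have "runs (simulate (Query x y e)) s' (cost e s + w) (return_pmf ()) (\<lambda>s'' _. sim s0 s'' (s(x := a, y := b)))"
      unfolding w_def using simulate_query[OF Query.prems assms(2) Query.hyps] .
    moreover have "cost e s + w \<le> w * ?t"
    proof -
      have "cost e s + w \<le> w * cost e s + w" using le by simp
      also have "\<dots> = w * (1 + cost e s)" by simp
      also have "\<dots> \<le> w * ?t" by (intro mult_le_mono2) simp
      finally show ?thesis .
    qed
    ultimately have "runsT (simulate (Query x y e)) s' (map_pmf (\<lambda>_. (s(x := a, y := b), ?t)) (return_pmf ()))
       (\<lambda>s'' t' (s1, t1). sim s0 s'' s1 \<and> t' \<le> w * t1)"
      unfolding runs_def runsT_map by (elim runsT_mono) auto
    then show ?case by simp
  next
    case (Seq c1 s r c2 q)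
    show ?case unfolding simulate.simps by (rule seq[OF Seq.IH(1)[OF Seq.prems] Seq.IH(2)])
  next
    case (IfTrue e s c1 r c2)
    show ?case unfolding simulate.simps
    proof (rule runsT_If, unfold value_of_shift_expr[OF IfTrue.prems] cost_shift_expr[OF IfTrue.prems])
      show "runsT (if value_of e s \<noteq> 0 then simulate c1 else simulate c2) s' (delay (1 + cost e s) r)
        (\<lambda>s' t (s1, t1). sim s0 s' s1 \<and> 1 + cost e s + t \<le> w * t1)"
        using delayed[OF IfTrue.IH[OF IfTrue.prems] le[of "1 + cost e s"]] IfTrue.hyps(1) by simp
    qed
  next
    case (IfFalse e s c2 r c1)
    show ?case unfolding simulate.simps
    proof (rule runsT_If, unfold value_of_shift_expr[OF IfFalse.prems] cost_shift_expr[OF IfFalse.prems])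
      show "runsT (if value_of e s \<noteq> 0 then simulate c1 else simulate c2) s' (delay (1 + cost e s) r)
        (\<lambda>s' t (s1, t1). sim s0 s' s1 \<and> 1 + cost e s + t \<le> w * t1)"
        using delayed[OF IfFalse.IH[OF IfFalse.prems] le[of "1 + cost e s"]] IfFalse.hyps(1) by simp
    qed
  next
    case (WhileFalse e s c)
    then show ?case
      using le[of "1 + cost e s"]
      by (auto intro!: runsT_WhileFalse simp: value_of_shift_expr cost_shift_expr)
  next
    case (WhileTrue e s c r q)
    have "runsT (Seq (simulate c) (simulate (While e c))) s' (bind_pmf r (\<lambda>(s1, t1). delay t1 (q s1)))
      (\<lambda>s'' t' (s1, t1). sim s0 s'' s1 \<and> t' \<le> w * t1)"
      by (rule seq[OF WhileTrue.IH(1)[OF WhileTrue.prems] WhileTrue.IH(2)])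
    note d = delayed[OF this le[of "1 + cost e s"]]
    show ?case unfolding simulate.simps
    proof (rule runsT_WhileTrue, unfold value_of_shift_expr[OF WhileTrue.prems] cost_shift_expr[OF WhileTrue.prems])
      show "value_of e s \<noteq> 0" by fact
      show "runsT (simulate c ;; While (shift_expr e) (simulate c)) s'
         (delay (1 + cost e s) (bind_pmf r (\<lambda>(s1, t1). delay t1 (q s1))))
         (\<lambda>s' t (s1, t1). sim s0 s' s1 \<and> 1 + cost e s + t \<le> w * t1)"
        using d by simp
    qed
  qed
  then show ?thesis unfolding w_def .
qed

end

text \<open>The guarantee of the sampler concerns a start state that is zero outside the input
  registers, so the leftovers of the previous call have to be erased.\<close>

primrec clear :: "nat \<Rightarrow> com" where
  "clear 0 = Skip"
| "clear (Suc k) = clear k ;; (k + 30) ::= Const 0"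

lemma query_free_clear: "query_free (clear k)"
  by (induction k) auto

lemma runs_clear:
  "2 \<le> U \<Longrightarrow> runs (clear k) s (Suc k * U) (return_pmf ()) (\<lambda>s' _. s' = (\<lambda>x. if 30 \<le> x \<and> x < 30 + k then 0 else s x))"
proof (induction k)
  case 0
  then show ?case by (auto intro!: runs_Skip simp: fun_eq_iff)
next
  case (Suc k)
  have "runs (clear (Suc k)) s (Suc k * U + U) (return_pmf ())
    (\<lambda>s' _. s' = (\<lambda>x. if 30 \<le> x \<and> x < 30 + Suc k then 0 else s x))"
    unfolding clear.simps
  proof (rule runs_Seq_det, rule runs_mono[OF Suc.IH[OF Suc.prems]])
    fix s' assume s': "s' = (\<lambda>x. if 30 \<le> x \<and> x < 30 + k then 0 else s x)"
    show "runs ((k + 30) ::= Const 0) s' U (return_pmf ())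
      (\<lambda>s' _. s' = (\<lambda>x. if 30 \<le> x \<and> x < 30 + Suc k then 0 else s x))"
      by (rule runs_Assign) (use Suc.prems in \<open>auto simp: s' fun_eq_iff floorlog_def\<close>)
  qed simp
  then show ?case by (rule runs_le) simp
qed

text \<open>Half of register 14 is \<open>2 ^ (m - 1)\<close>, so the test reads bit
  \<open>m - 1\<close> of the sample; register 16 counts the samples that avoid this vertex. The
  sampler is given twice the number of vertices, for rows and columns.\<close>

definition sample_step :: "nat \<Rightarrow> com \<Rightarrow> com" where
  "sample_step R c =
     clear R ;;
     30 ::= Reg 0 *\<^sub>e Const 2 ;;
     31 ::= Reg 9 ;;
     simulate c ;;
     16 ::= Reg 16 +\<^sub>e (Const 1 -\<^sub>e Reg 30 div\<^sub>e (Reg 14 div\<^sub>e Const 2) mod\<^sub>e Const 2) ;;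
     17 ::= Reg 17 -\<^sub>e Const 1"

lemma query_free_sample_step: "query_free (sample_step R c)"
  by (simp add: sample_step_def query_free_clear query_free_simulate)

text \<open>The zeros beyond the sampler's registers reappear in the postcondition so that the step
  can be repeated. The hypothesis on \<open>K\<close> covers the length of the sampled code, which
  grows at most with the running time.\<close>

lemma (in eval_context) runs_sample_step:
  assumes conf: "conf s" and m: "0 < m" and R: "writes c \<subseteq> {..<R}" "2 \<le> R"
    and r: "exec weight_oracle c (input [2 * n, E]) r" "\<forall>(s, t)\<in>set_pmf r. t \<le> T"
    and s: "s 9 = E" "s 17 = Suc j" "\<forall>x\<ge>30 + R. s x = 0" "s 16 < 2 ^ K" "s 17 < 2 ^ K"
    and K: "bits (2 * n) + bits E + T \<le> K"
  shows "runs (sample_step R c) s ((R + 5) * U + W * T)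
     (map_pmf (\<lambda>(s1, _). s 16 + of_bool (m - 1 \<notin> set_decode (s1 0))) r)
     (\<lambda>s' a. s' 16 = a \<and> s' 17 = j \<and> (\<forall>x<16. s' x = s x) \<and> (\<forall>x\<ge>30 + R. s' x = 0))"
proof -
  define s1 where "s1 = (\<lambda>x. if 30 \<le> x \<and> x < 30 + R then 0 else s x)"
  define s2 where "s2 = s1(30 := 2 * n, 31 := E)"
  have c: "s 0 = n" "s 14 = 2 ^ m" using conf by (simp_all add: conf_def)
  have sim: "sim s s2 (input [2 * n, E])"
    unfolding sim_def
  proof (intro conjI allI impI)
    fix x
    show "s2 (x + 30) = input [2 * n, E] x"
    proof -
      consider "x = 0" | "x = 1" | "2 \<le> x" by linarith
      then show ?thesis
        by cases (use R(2) s(3) in \<open>auto simp: s2_def s1_def input_def\<close>)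
    qed
  qed (simp add: s2_def s1_def)
  have out: "\<forall>x\<ge>30 + R. s3 x = 0" "s3 30 < 2 ^ K"
    if s3: "sim s s3 s3'" and in_r: "(s3', t) \<in> set_pmf r" for s3 s3' t
  proof -
    have eq: "s3 (x + 30) = s3' x" for x using s3 by (simp add: sim_def)
    have "s3' x = 0" if "R \<le> x" for x
    proof -
      have "x \<notin> writes c" using R(1) that by auto
      with exec_frame[OF r(1) in_r] have "s3' x = input [2 * n, E] x" by blast
      then show ?thesis using that R(2) by (simp add: input_def)
    qed
    then show "\<forall>x\<ge>30 + R. s3 x = 0" using eq by (metis add.commute add_le_cancel_left le_Suc_ex le_add1 le_trans)
    have "bits (s3' 0) \<le> bits (input [2 * n, E] 0) + t" by (rule exec_bits[OF r(1) in_r])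
    also have "\<dots> \<le> K" using K r(2) in_r by (auto simp: input_def)
    finally show "s3 30 < 2 ^ K" using eq[of 0] by (simp add: bits_le_iff)
  qed
  have rest: "runs (16 ::= Reg 16 +\<^sub>e (Const 1 -\<^sub>e Reg 30 div\<^sub>e (Reg 14 div\<^sub>e Const 2) mod\<^sub>e Const 2) ;;
     17 ::= Reg 17 -\<^sub>e Const 1) s3 (2 * U)
     (return_pmf (s 16 + of_bool (m - 1 \<notin> set_decode (s3' 0))))
     (\<lambda>s' a. s' 16 = a \<and> s' 17 = j \<and> (\<forall>x<16. s' x = s x) \<and> (\<forall>x\<ge>30 + R. s' x = 0))"
    if s3: "sim s s3 s3'" and in_r: "(s3', t) \<in> set_pmf r" for s3 s3' t
  proof -
    have lo: "s3 x = s x" if "x < 18" for x using s3 that by (simp add: sim_def)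
    have "s3 30 = s3' 0" using s3 by (metis add_0 sim_def)
    have half: "(2::nat) ^ m div 2 = 2 ^ (m - 1)" using m by (cases m) auto
    have new: "s3 16 + (1 - s3 30 div (s3 14 div 2) mod 2) = s 16 + of_bool (m - 1 \<notin> set_decode (s3' 0))"
      unfolding \<open>s3 30 = s3' 0\<close> using lo[of 14] lo[of 16] by (simp add: c half div_pow_mod_2)
    have b: "s3 16 < 2 ^ K" "s3 17 < 2 ^ K" "s3 14 < 2 ^ K" "s3 30 < 2 ^ K"
      using lo s small out(2)[OF s3 in_r] by (simp_all add: c)
    show ?thesis
      apply (rule runs_le)
       apply (rule runs_step[where K = K and U = U], (use b in simp; fail), (simp; fail))
       apply (rule runs_last[where K = K and U = U], (use b in simp; fail), (simp; fail))
       apply (simp only: value_of.simps apply_op.simps new)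
      using lo s(2) out(1)[OF s3 in_r] by simp_all
  qed
  have sim_run: "runs (simulate c) s2 (W * T) r (\<lambda>s3 (s3', t). sim s s3 s3')"
    unfolding runs_def
  proof (rule runsT_mono[OF runsT_simulate[OF r(1) conf sim]])
    fix s3 t' a assume a: "a \<in> set_pmf r" "case a of (s1, t1) \<Rightarrow> sim s s3 s1 \<and> t' \<le> W * t1"
    obtain s1 t1 where a_eq: "a = (s1, t1)" by (cases a)
    have "t1 \<le> T" using r(2) a(1) unfolding a_eq by auto
    then have "W * t1 \<le> W * T" by (rule mult_le_mono2)
    moreover have "t' \<le> W * t1" "sim s s3 s1" using a(2) unfolding a_eq by simp_all
    ultimately show "t' \<le> W * T \<and> (case a of (s3', t) \<Rightarrow> sim s s3 s3')"
      unfolding a_eq prod.case by (blast intro: order_trans)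
  qed
  have main: "runs (simulate c ;; 16 ::= Reg 16 +\<^sub>e (Const 1 -\<^sub>e Reg 30 div\<^sub>e (Reg 14 div\<^sub>e Const 2) mod\<^sub>e Const 2) ;;
     17 ::= Reg 17 -\<^sub>e Const 1) s2 (W * T + 2 * U)
     (bind_pmf r (\<lambda>a. return_pmf (s 16 + of_bool (m - 1 \<notin> set_decode (fst a 0)))))
     (\<lambda>s' a. s' 16 = a \<and> s' 17 = j \<and> (\<forall>x<16. s' x = s x) \<and> (\<forall>x\<ge>30 + R. s' x = 0))"
  proof (rule runs_Seq[OF sim_run])
    fix s3 a assume a: "a \<in> set_pmf r" "case a of (s3', t) \<Rightarrow> sim s s3 s3'"
    obtain s3' t where a_eq: "a = (s3', t)" by (cases a)
    show "runs (16 ::= Reg 16 +\<^sub>e (Const 1 -\<^sub>e Reg 30 div\<^sub>e (Reg 14 div\<^sub>e Const 2) mod\<^sub>e Const 2) ;;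
     17 ::= Reg 17 -\<^sub>e Const 1) s3 (2 * U)
     (return_pmf (s 16 + of_bool (m - 1 \<notin> set_decode (fst a 0))))
     (\<lambda>s' a. s' 16 = a \<and> s' 17 = j \<and> (\<forall>x<16. s' x = s x) \<and> (\<forall>x\<ge>30 + R. s' x = 0))"
      unfolding a_eq fst_conv by (rule rest) (use a a_eq in auto)
  qed
  have map: "bind_pmf r (\<lambda>a. return_pmf (s 16 + of_bool (m - 1 \<notin> set_decode (fst a 0)))) =
    map_pmf (\<lambda>(s1, _). s 16 + of_bool (m - 1 \<notin> set_decode (s1 0))) r"
    by (simp add: map_pmf_def case_prod_unfold)
  have b: "s1 0 < 2 ^ K" "s1 9 < 2 ^ K"
  proof -
    show "s1 0 < 2 ^ K" using small by (simp add: s1_def c)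
    have "bits E \<le> K" using K by simp
    then show "s1 9 < 2 ^ K" by (simp add: s1_def s(1) bits_le_iff)
  qed
  have s2: "s2 = s1(30 := s1 0 * 2, 31 := (s1(30 := s1 0 * 2)) 9)"
    by (simp add: s2_def s1_def c s(1) mult.commute)
  show ?thesis
    unfolding sample_step_def map[symmetric]
    apply (rule runs_le)
     apply (rule runs_Seq_det)
     apply (rule runs_mono[OF runs_clear[where U = U]], simp)
      apply (rule order_refl)
     apply (simp only: s1_def[symmetric])
     apply (rule runs_step[where K = K and U = U], (use b in simp; fail), (simp; fail))+
     apply (use main[unfolded s2] in simp)
    by (simp add: algebra_simps)
qed

section \<open>Independent sets and marginals\<close>

lemma embed_finite_pmf:
  fixes g :: "'a \<Rightarrow> real"
  assumes "finite A" "A \<noteq> {}" "\<And>x. x \<in> A \<Longrightarrow> 0 < g x"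
  shows "\<exists>\<pi>. set_pmf \<pi> \<subseteq> A \<and> (\<forall>x\<in>A. pmf \<pi> x = g x / sum g A)"
proof -
  have pos: "0 < sum g A" using assms by (intro sum_pos)
  define f where "f x = (if x \<in> A then g x / sum g A else 0)" for x
  have nonneg: "0 \<le> f x" for x using pos assms(3)[of x] by (auto simp: f_def)
  have "(\<integral>\<^sup>+ x. ennreal (f x) \<partial>count_space UNIV) = (\<Sum>x\<in>A. ennreal (f x))"
    by (rule nn_integral_count_space') (use assms in \<open>auto simp: f_def\<close>)
  also have "\<dots> = ennreal (\<Sum>x\<in>A. f x)" by (rule sum_ennreal) (use nonneg in auto)
  also have "(\<Sum>x\<in>A. f x) = 1" using pos by (simp add: f_def sum_divide_distrib[symmetric])
  finally have one: "(\<integral>\<^sup>+ x. ennreal (f x) \<partial>count_space UNIV) = 1" by simp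
  have "pmf (embed_pmf f) x = f x" for x using nonneg one by (intro pmf_embed_pmf) auto
  then show ?thesis
    by (intro exI[of _ "embed_pmf f"]) (auto simp: f_def set_pmf_iff split: if_splits)
qed

lemma cut_weight_pos: "0 < q \<Longrightarrow> 0 < cut_weight n a q S"
  by (simp add: cut_weight_def)

lemma cut_weight_dist_exists:
  assumes "1 \<le> q"
  shows "\<exists>\<pi>. log_Mnat_convex_dist {..<2 * n} (cut_weight n a q) \<pi>"
proof -
  have "\<exists>\<pi>. set_pmf \<pi> \<subseteq> Pow {..<2 * n} \<and>
      (\<forall>S\<in>Pow {..<2 * n}. pmf \<pi> S = cut_weight n a q S / sum (cut_weight n a q) (Pow {..<2 * n}))"
    by (rule embed_finite_pmf) (use assms in \<open>auto intro!: cut_weight_pos\<close>)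
  then obtain \<pi> where "set_pmf \<pi> \<subseteq> Pow {..<2 * n}"
    "\<forall>S\<in>Pow {..<2 * n}. pmf \<pi> S = cut_weight n a q S / sum (cut_weight n a q) (Pow {..<2 * n})" by blast
  then show ?thesis
    unfolding log_Mnat_convex_dist_def
    using assms Mnat_convex_ln_cut_weight[OF assms] by (intro exI[of _ \<pi>]) (auto intro: cut_weight_pos)
qed

definition zero_cuts :: "nat \<Rightarrow> (nat \<Rightarrow> nat \<Rightarrow> bool) \<Rightarrow> nat set set" where
  "zero_cuts n a = {S. S \<subseteq> {..<2 * n} \<and> cut_rank n a S = 0}"

text \<open>Zero cuts weigh exactly 1, and all other sets together weigh at most
  \<open>4 ^ n / q\<close>. Since there is at least one zero cut, adding these small weights to
  numerator and denominator moves the quotient by at most their total.\<close>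

lemma prob_cut_weight:
  assumes dist: "log_Mnat_convex_dist {..<2 * n} (cut_weight n a q) \<pi>" and q: "1 \<le> q"
  shows "\<bar>measure_pmf.prob \<pi> {S. P S} - card {S \<in> zero_cuts n a. P S} / card (zero_cuts n a)\<bar> \<le> 4 ^ n / q"
proof -
  define N where "N = Pow {..<2 * n}"
  define g where "g = cut_weight n a q"
  define F where "F = zero_cuts n a"
  have N: "finite N" "card N = 4 ^ n" by (simp_all add: N_def card_Pow power_mult)
  have F: "F \<subseteq> N" "finite F" using N(1) finite_subset by (auto simp: F_def zero_cuts_def N_def)
  have g1: "g S = 1" if "S \<in> F" for S using that by (simp add: F_def zero_cuts_def g_def cut_weight_def)
  have gpos: "0 < g S" for S unfolding g_def using q by (intro cut_weight_pos) simp
  have gle: "g S \<le> 1 / q" if "S \<in> N - F" for S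
  proof -
    have "cut_rank n a S \<noteq> 0" using that by (auto simp: F_def N_def zero_cuts_def)
    then have "q ^ 1 \<le> q ^ cut_rank n a S" using q by (intro power_increasing) auto
    then have "real q \<le> real (q ^ cut_rank n a S)" by (simp only: power_one_right of_nat_le_iff)
    then show ?thesis using q unfolding g_def cut_weight_def by (intro divide_left_mono) auto
  qed
  define e where "e A = sum g (A - F)" for A
  have e: "0 \<le> e A" "e A \<le> e N" "e N \<le> 4 ^ n / q" if "A \<subseteq> N" for A
  proof -
    show "0 \<le> e A" unfolding e_def using gpos by (intro sum_nonneg) (auto intro: less_imp_le)
    show "e A \<le> e N" unfolding e_def using that N(1) gpos
      by (intro sum_mono2) (auto intro: less_imp_le)
    have "e N \<le> card (N - F) * (1 / q)" unfolding e_def using gle by (rule sum_bounded_above)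
    also have "\<dots> \<le> card N * (1 / q)" using N(1) by (intro mult_right_mono) (auto intro: card_mono)
    finally show "e N \<le> 4 ^ n / q" by (simp add: N(2))
  qed
  have split: "sum g A = card (A \<inter> F) + e A" if "A \<subseteq> N" for A
  proof -
    have "finite A" using that N(1) finite_subset by blast
    then have "sum g A = sum g (A \<inter> F) + e A" unfolding e_def by (metis sum.Int_Diff)
    then show ?thesis using g1 by simp
  qed
  define A where "A = {S \<in> N. P S}"
  have A: "A \<subseteq> N" by (auto simp: A_def)
  have pmf: "pmf \<pi> S = g S / sum g N" if "S \<in> N" for S
    using dist that by (simp add: log_Mnat_convex_dist_def N_def g_def)
  have "measure_pmf.prob \<pi> {S. P S} = measure_pmf.prob \<pi> ({S. P S} \<inter> set_pmf \<pi>)"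
    by (simp add: measure_Int_set_pmf)
  also have "\<dots> = measure_pmf.prob \<pi> (A \<inter> set_pmf \<pi>)"
    using dist by (intro arg_cong[where f = "measure_pmf.prob \<pi>"]) (auto simp: A_def N_def log_Mnat_convex_dist_def)
  also have "\<dots> = measure_pmf.prob \<pi> A" by (simp add: measure_Int_set_pmf)
  also have "\<dots> = (\<Sum>S\<in>A. pmf \<pi> S)" using N(1) A finite_subset by (intro measure_measure_pmf_finite) blast
  also have "\<dots> = sum g A / sum g N" using A pmf by (simp add: sum_divide_distrib subset_eq)
  finally have prob: "measure_pmf.prob \<pi> {S. P S} = (card (A \<inter> F) + e A) / (card F + e N)"
    using split[OF A] split[of N] F by (simp add: Int_absorb1)
  have AF: "{S \<in> zero_cuts n a. P S} = A \<inter> F" using F(1) by (auto simp: A_def F_def)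
  define x y where "x = real (card (A \<inter> F))" and "y = real (card F)"
  have "{} \<in> F" by (simp add: F_def zero_cuts_def cut_rank_eq_0_iff)
  then have y: "1 \<le> y" using F(2) by (auto simp: y_def Suc_le_eq card_gt_0_iff)
  have x: "0 \<le> x" "x \<le> y" using F(2) by (auto simp: x_def y_def intro: card_mono)
  have eq: "(x + e A) / (y + e N) - x / y = (e A * y - x * e N) / (y * (y + e N))"
    using y e(1)[of N] by (simp add: field_simps)
  \<comment> \<open>A difference of two numbers that both lie between 0 and
    \<open>e N * y\<close>.\<close>
  have num: "\<bar>e A * y - x * e N\<bar> \<le> e N * y"
  proof -
    have "0 \<le> e A * y" "e A * y \<le> e N * y" using e[OF A] y by (auto intro: mult_right_mono)
    moreover have "0 \<le> x * e N" "x * e N \<le> y * e N" using x e(1)[of N] by (auto intro: mult_right_mono)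
    ultimately show ?thesis by (simp add: abs_le_iff mult.commute)
  qed
  have pos: "0 < y * (y + e N)" using y e(1)[of N] by simp
  have "\<bar>(x + e A) / (y + e N) - x / y\<bar> = \<bar>e A * y - x * e N\<bar> / (y * (y + e N))"
    by (simp only: eq abs_divide abs_of_pos[OF pos])
  also have "\<dots> \<le> e N * y / (y * (y + e N))" using num pos by (intro divide_right_mono) auto
  also have "\<dots> = e N / (y + e N)" using y by simp
  also have "\<dots> \<le> e N / 1" using y e(1)[of N] by (intro divide_left_mono) auto
  finally show ?thesis using e(3)[of N] by (simp add: prob AF x_def y_def F_def)
qed

text \<open>
  The zero cuts are the independent sets of the bipartite double cover, which for a bipartite graph
  consists of two copies of the graph. So no bipartition has to be computed.
\<close>

definition prefix_independent :: "nat \<Rightarrow> (nat \<times> nat) set \<Rightarrow> nat \<Rightarrow> nat set set" where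
  "prefix_independent n E m = {I. I \<subseteq> {..<n} \<and> (\<forall>u\<in>I. \<forall>v\<in>I. u < m \<longrightarrow> v < m \<longrightarrow> (u, v) \<notin> E)}"

lemma finite_prefix_independent: "finite (prefix_independent n E m)"
  by (rule finite_subset[of _ "Pow {..<n}"]) (auto simp: prefix_independent_def)

text \<open>In a zero cut no edge below \<open>m\<close> leads from the chosen rows \<open>A\<close>
  to the undeleted columns \<open>B\<close>. Edges cross \<open>P\<close>, so rows in
  \<open>P\<close> with columns outside \<open>P\<close> form one copy of the graph, and the
  remaining rows and columns the other. The row \<open>w\<close> belongs to the first copy if
  \<open>w \<in> P\<close> and to the second otherwise; the count is the same either way.\<close>

lemma card_zero_cuts:
  fixes n m w :: nat
  assumes sym: "sym E" and P: "\<forall>(u, v)\<in>E. u \<in> P \<longleftrightarrow> v \<notin> P" and w: "w < n"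
  defines "F \<equiv> zero_cuts n (\<lambda>u v. u < m \<and> v < m \<and> (u, v) \<in> E)" and "I \<equiv> prefix_independent n E m"
  shows "card F = card I * card I" and "card {S \<in> F. w \<notin> S} = card I * card {J \<in> I. w \<notin> J}"
proof -
  define f where "f S = (let A = S \<inter> {..<n}; B = {v. v < n \<and> n + v \<notin> S} in
     ((A \<inter> P) \<union> (B - P), (A - P) \<union> (B \<inter> P)))" for S
  define f' where "f' IJ = (let I = fst IJ; J = snd IJ in
     (I \<inter> P) \<union> (J - P) \<union> {x. n \<le> x \<and> x < 2 * n \<and> x - n \<notin> (I - P) \<union> (J \<inter> P)})" for IJ
  have F: "S \<in> F \<longleftrightarrow> S \<subseteq> {..<2 * n} \<and>
     (\<forall>u<n. \<forall>v<n. u \<in> S \<longrightarrow> n + v \<notin> S \<longrightarrow> \<not> (u < m \<and> v < m \<and> (u, v) \<in> E))" for S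
    by (simp add: F_def zero_cuts_def cut_rank_eq_0_iff)
  have symE: "(u, v) \<in> E \<Longrightarrow> (v, u) \<in> E" for u v using sym by (auto simp: sym_def)
  have PE: "(u, v) \<in> E \<Longrightarrow> u \<in> P \<longleftrightarrow> v \<notin> P" for u v using P by auto
  have fF: "f S \<in> I \<times> I" if "S \<in> F" for S
  proof -
    have "(u, v) \<notin> E" if "u < m" "v < m" "u < n" "v < n" "u \<in> S" "n + v \<notin> S" for u v
      using \<open>S \<in> F\<close> that unfolding F by blast
    then show ?thesis
      unfolding f_def Let_def I_def prefix_independent_def using symE PE by auto
  qed
  have f'F: "f' IJ \<in> F" if "IJ \<in> I \<times> I" for IJ
  proof -
    obtain X Y where IJ: "IJ = (X, Y)" by (cases IJ)
    have X: "X \<subseteq> {..<n}" "\<And>u v. u \<in> X \<Longrightarrow> v \<in> X \<Longrightarrow> u < m \<Longrightarrow> v < m \<Longrightarrow> (u, v) \<notin> E"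
      and Y: "Y \<subseteq> {..<n}" "\<And>u v. u \<in> Y \<Longrightarrow> v \<in> Y \<Longrightarrow> u < m \<Longrightarrow> v < m \<Longrightarrow> (u, v) \<notin> E"
      using that unfolding IJ I_def prefix_independent_def by auto
    have "f' IJ \<subseteq> {..<2 * n}" using X(1) Y(1) unfolding f'_def IJ by auto
    moreover have False if "u < n" "v < n" "u \<in> f' IJ" "n + v \<notin> f' IJ" "u < m" "v < m" "(u, v) \<in> E" for u v
    proof -
      have "u \<in> (X \<inter> P) \<union> (Y - P)" using that(1,3) unfolding f'_def IJ by auto
      moreover have "v \<in> (X - P) \<union> (Y \<inter> P)" using that(2,4) unfolding f'_def IJ by auto
      ultimately show False using X(2)[of u v] Y(2)[of u v] PE[OF that(7)] that(5,6,7) by blast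
    qed
    ultimately show ?thesis unfolding F by blast
  qed
  have inv1: "f' (f S) = S" if "S \<in> F" for S
  proof (rule set_eqI)
    fix x
    have S: "S \<subseteq> {..<2 * n}" using that F by blast
    consider "x < n" | "n \<le> x" "x < 2 * n" | "2 * n \<le> x" by linarith
    then show "x \<in> f' (f S) \<longleftrightarrow> x \<in> S"
    proof cases
      case 3
      then show ?thesis using S unfolding f_def f'_def Let_def by auto
    qed (auto simp: f_def f'_def Let_def)
  qed
  have inv2: "f (f' IJ) = IJ" if "IJ \<in> I \<times> I" for IJ
  proof -
    obtain X Y where IJ: "IJ = (X, Y)" by (cases IJ)
    have XY: "X \<subseteq> {..<n}" "Y \<subseteq> {..<n}" using that unfolding IJ I_def prefix_independent_def by auto
    have A: "f' IJ \<inter> {..<n} = (X \<inter> P) \<union> (Y - P)" using XY unfolding f'_def IJ by auto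
    have B: "{v. v < n \<and> n + v \<notin> f' IJ} = (X - P) \<union> (Y \<inter> P)" using XY unfolding f'_def IJ by auto
    show ?thesis unfolding f_def A B Let_def unfolding IJ by auto
  qed
  have bij: "bij_betw f F (I \<times> I)"
    by (rule bij_betw_byWitness[where f' = f']) (use inv1 inv2 fF f'F in blast)+
  then show "card F = card I * card I" by (simp add: bij_betw_same_card card_cartesian_product)
  let ?Iw = "{J \<in> I. w \<notin> J}"
  define D where "D = (if w \<in> P then ?Iw \<times> I else I \<times> ?Iw)"
  have w_iff: "w \<notin> S \<longleftrightarrow> f S \<in> D" if "S \<in> F" for S
    using fF[OF that] w unfolding D_def f_def Let_def by auto
  have "bij_betw f {S \<in> F. w \<notin> S} D"
  proof (rule bij_betw_byWitness[where f' = f'])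
    have D: "D \<subseteq> I \<times> I" by (auto simp: D_def)
    show "\<forall>x\<in>{S \<in> F. w \<notin> S}. f' (f x) = x" using inv1 by blast
    show "\<forall>x\<in>D. f (f' x) = x" using inv2 D by blast
    show "f ` {S \<in> F. w \<notin> S} \<subseteq> D" using w_iff by blast
    show "f' ` D \<subseteq> {S \<in> F. w \<notin> S}"
    proof
      fix S assume "S \<in> f' ` D"
      then obtain x where x: "x \<in> D" "S = f' x" by blast
      then have "S \<in> F" "f S \<in> D" using f'F inv2 D by auto
      then show "S \<in> {S \<in> F. w \<notin> S}" using w_iff by blast
    qed
  qed
  then have "card {S \<in> F. w \<notin> S} = card D" by (rule bij_betw_same_card)
  also have "\<dots> = card I * card ?Iw" by (simp add: D_def card_cartesian_product)
  finally show "card {S \<in> F. w \<notin> S} = card I * card ?Iw" .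
qed

text \<open>At stage \<open>m\<close> the vertex \<open>m\<close> is isolated and may be added
  freely, and the sets avoiding \<open>m\<close> are the same at both stages. This turns a marginal
  into a ratio of consecutive counts.\<close>

lemma card_prefix_independent_Suc:
  assumes E: "\<And>u. (u, u) \<notin> E" and m: "m < n"
  shows "card (prefix_independent n E m) = 2 * card {J \<in> prefix_independent n E (Suc m). m \<notin> J}"
proof -
  let ?D = "{J \<in> prefix_independent n E (Suc m). m \<notin> J}"
  have D: "?D = {J \<in> prefix_independent n E m. m \<notin> J}"
    by (auto simp: prefix_independent_def less_Suc_eq)
  have "prefix_independent n E m = ?D \<union> insert m ` ?D"
  proof (rule set_eqI)
    fix I
    show "I \<in> prefix_independent n E m \<longleftrightarrow> I \<in> ?D \<union> insert m ` ?D"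
    proof
      assume I: "I \<in> prefix_independent n E m"
      show "I \<in> ?D \<union> insert m ` ?D"
      proof (cases "m \<in> I")
        case True
        then have "I = insert m (I - {m})" by blast
        moreover have "I - {m} \<in> ?D" unfolding D using I by (auto simp: prefix_independent_def)
        ultimately show ?thesis by blast
      qed (use I D in blast)
    next
      assume "I \<in> ?D \<union> insert m ` ?D"
      then show "I \<in> prefix_independent n E m" unfolding D using m by (auto simp: prefix_independent_def)
    qed
  qed
  moreover have "?D \<inter> insert m ` ?D = {}" by blast
  moreover have "finite ?D" using finite_prefix_independent by simp
  moreover have "card (insert m ` ?D) = card ?D"
    by (rule card_image) (auto simp: inj_on_def insert_ident)
  ultimately show ?thesis by (simp add: card_Un_disjoint)
qed

lemma prefix_independent_0: "prefix_independent n E 0 = Pow {..<n}"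
  by (auto simp: prefix_independent_def)

lemma prefix_independent_n: "prefix_independent n E n = independent_sets (n, E)"
  by (auto simp: prefix_independent_def independent_sets_def)

section \<open>Total variation, union bounds and binomial tails\<close>

lemma prob_le_tv_dist: "\<bar>measure_pmf.prob p A - measure_pmf.prob q A\<bar> \<le> tv_dist p q"
  unfolding tv_dist_def
proof (rule cSUP_upper)
  show "bdd_above (range (\<lambda>A. \<bar>measure_pmf.prob p A - measure_pmf.prob q A\<bar>))"
  proof (rule bdd_aboveI2)
    fix A
    have "0 \<le> measure_pmf.prob p A" "measure_pmf.prob p A \<le> 1"
      "0 \<le> measure_pmf.prob q A" "measure_pmf.prob q A \<le> 1" by auto
    then show "\<bar>measure_pmf.prob p A - measure_pmf.prob q A\<bar> \<le> 1" by linarith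
  qed
qed simp

lemma prob_bind_pmf_le:
  assumes "\<And>x. x \<in> set_pmf A \<Longrightarrow> P x \<Longrightarrow> measure_pmf.prob (F x) S \<le> c" "0 \<le> c"
  shows "measure_pmf.prob (bind_pmf A F) S \<le> measure_pmf.prob A {x. \<not> P x} + c"
proof -
  have "emeasure (bind_pmf A F) S = (\<integral>\<^sup>+ x. emeasure (F x) S \<partial>A)" by simp
  also have "\<dots> \<le> (\<integral>\<^sup>+ x. indicator {x. \<not> P x} x + ennreal c \<partial>A)"
  proof (rule nn_integral_mono_AE, rule AE_pmfI)
    fix x assume x: "x \<in> set_pmf A"
    show "emeasure (F x) S \<le> indicator {x. \<not> P x} x + ennreal c"
    proof (cases "P x")
      case True
      then show ?thesis using assms(1)[OF x] by (simp add: measure_pmf.emeasure_eq_measure ennreal_leI)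
    next
      case False
      have "emeasure (F x) S \<le> 1" by (rule measure_pmf.emeasure_le_1)
      also have "1 \<le> 1 + ennreal c" by simp
      finally show ?thesis using False by simp
    qed
  qed
  also have "\<dots> = emeasure A {x. \<not> P x} + ennreal c"
    by (subst nn_integral_add) (auto simp: measure_pmf.emeasure_space_1)
  finally show ?thesis using assms(2)
    by (simp add: measure_pmf.emeasure_eq_measure ennreal_plus[symmetric] del: ennreal_plus)
qed

text \<open>A union bound in adaptive form: the failure probability of a round is bounded only when
  the round starts from a good value.\<close>

lemma prob_iterate_le:
  assumes "\<And>j a. j < k \<Longrightarrow> Good (Suc j) a \<Longrightarrow> measure_pmf.prob (F j a) {x. \<not> Good j x} \<le> \<beta>"
    and "Good k a" "0 \<le> \<beta>"
  shows "measure_pmf.prob (iterate F k a) {x. \<not> Good 0 x} \<le> real k * \<beta>"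
  using assms(1,2)
proof (induction k arbitrary: a)
  case (Suc k)
  have "measure_pmf.prob (iterate F (Suc k) a) {x. \<not> Good 0 x} \<le>
      measure_pmf.prob (F k a) {x. \<not> Good k x} + real k * \<beta>"
    unfolding iterate.simps
    by (rule prob_bind_pmf_le) (use Suc assms(3) in auto)
  also have "measure_pmf.prob (F k a) {x. \<not> Good k x} \<le> \<beta>" using Suc.prems by blast
  finally show ?case by (simp add: algebra_simps)
qed simp

lemma bool_pmf_eq_bernoulli: "p = bernoulli_pmf (pmf p True)"
proof (rule pmf_eqI)
  have "pmf p False = 1 - pmf p True"
  proof -
    have "(\<Sum>b\<in>UNIV. pmf p b) = 1" by (rule sum_pmf_eq_1) auto
    then show ?thesis by (simp add: UNIV_bool)
  qed
  then show "pmf p b = pmf (bernoulli_pmf (pmf p True)) b" for b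
    by (cases b) (auto simp: pmf_le_1)
qed

lemma iterate_binomial:
  assumes "p \<in> {0..1}"
  shows "iterate (\<lambda>_ a. map_pmf (\<lambda>b. a + of_bool b) (bernoulli_pmf p)) N a = map_pmf (\<lambda>k. a + k) (binomial_pmf N p)"
proof (induction N arbitrary: a)
  case 0
  then show ?case using assms by (simp add: binomial_pmf_0)
next
  case (Suc N)
  show ?case
    unfolding iterate.simps Suc.IH binomial_pmf_Suc[OF assms]
    by (simp add: map_pmf_def bind_assoc_pmf bind_return_pmf of_bool_def add.assoc)
qed

text \<open>Hoeffding's inequality for the relative frequency.\<close>

lemma binomial_tail:
  assumes "p \<in> {0..1}" "0 < N" "0 \<le> \<epsilon>"
  shows "measure_pmf.prob (binomial_pmf N p) {k. \<epsilon> \<le> \<bar>real k / N - p\<bar>} \<le> 2 * exp (- 2 * N * \<epsilon>\<^sup>2)"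
proof -
  interpret binomial_distribution N p by unfold_locales (rule assms(1))
  show ?thesis using prob_abs_ge'[OF assms(2,3)] by simp
qed

section \<open>The counting program\<close>

definition times_pow :: "nat \<Rightarrow> nat \<Rightarrow> com" where
  "times_pow x y = x ::= Const 1 ;; 24 ::= Reg 0 ;; While (Reg 24) (x ::= Reg x *\<^sub>e Reg y ;; 24 ::= Reg 24 -\<^sub>e Const 1)"

lemma runs_times_pow:
  assumes xy: "x \<noteq> 24" "x \<noteq> 0" "y \<noteq> 24" "y \<noteq> x"
    and K: "s 0 < 2 ^ K" "s y < 2 ^ K" "s y ^ s 0 < 2 ^ K" "0 < s y" and U: "U = 40 * Suc K"
  shows "runs (times_pow x y) s ((3 * s 0 + 3) * U) (return_pmf ()) (\<lambda>s' _. s' = s(x := s y ^ s 0, 24 := 0))"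
proof -
  define n where "n = s 0"
  define Inv where "Inv j s' \<longleftrightarrow> j \<le> n \<and> s' = s(x := s y ^ (n - j), 24 := j)" for j s'
  define s1 where "s1 = s(x := 1, 24 := n)"
  have small: "s y ^ i < 2 ^ K" if "i \<le> n" for i
  proof -
    have "s y ^ i \<le> s y ^ n" using K(4) that by (intro power_increasing) auto
    then show ?thesis using K(3) by (simp add: n_def)
  qed
  have loop: "runs (While (Reg 24) (x ::= Reg x *\<^sub>e Reg y ;; 24 ::= Reg 24 -\<^sub>e Const 1)) s1 (n * (U + 2 * U) + U)
    (return_pmf ()) (\<lambda>s' _. Inv 0 s')"
  proof (rule runs_count_det)
    fix j s' assume I: "Inv (Suc j) s'" and j: "j < n"
    have s': "s' = s(x := s y ^ (n - Suc j), 24 := Suc j)" using I by (simp add: Inv_def)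
    have "n - j = Suc (n - Suc j)" using j by simp
    then have "Inv j (s'(x := s' x * s' y, 24 := s' 24 - 1))"
      using xy j by (auto simp: Inv_def s' fun_eq_iff mult.commute)
    moreover have b: "s' x < 2 ^ K" "s' y < 2 ^ K" "s' 24 < 2 ^ K"
      using xy K j small[of "n - Suc j"] by (auto simp: s' n_def)
    ultimately show "runs (x ::= Reg x *\<^sub>e Reg y ;; 24 ::= Reg 24 -\<^sub>e Const 1) s' (2 * U) (return_pmf ()) (\<lambda>s' _. Inv j s')"
      using xy unfolding U
      apply -
      apply (rule runs_le)
       apply (rule runs_step[where K = K and U = U, unfolded U], (use b in simp; fail), (simp; fail))
       apply (rule runs_last[where K = K and U = U, unfolded U], (use b in simp; fail), (simp; fail))
       apply simp
      by simp
  next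
    show "s' 24 = j \<and> 2 + bits j \<le> U" if "Inv j s'" "j \<le> n" for j s'
    proof
      show "s' 24 = j" using that by (simp add: Inv_def)
      have "bits j \<le> K" using that K(1) by (simp add: bits_le_iff n_def)
      then show "2 + bits j \<le> U" by (simp add: U)
    qed
  next
    show "Inv n s1" by (simp add: Inv_def s1_def)
  qed
  have s1: "s(x := value_of (Const 1) s, 24 := value_of (Reg 0) (s(x := value_of (Const 1) s))) = s1"
    using xy by (simp add: s1_def n_def)
  show ?thesis
    unfolding times_pow_def
    apply (rule runs_le)
     apply (rule runs_step[where K = K and U = U], simp, simp add: U)
     apply (rule runs_step[where K = K and U = U], use xy K in simp, simp add: U)
     apply (simp only: s1)
     apply (rule runs_mono[OF loop])
      apply (rule order_refl)
     apply (simp add: Inv_def n_def)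
    by (simp add: n_def algebra_simps)
qed

lemma query_free_times_pow: "query_free (times_pow x y)"
  by (simp add: times_pow_def)

text \<open>Register 3 holds about \<open>1 / \<delta>\<close>, while the time may depend only on
  its logarithm; hence just its bit length enters the number of samples.\<close>

definition bit_length_loop :: com where
  "bit_length_loop =
     8 ::= Const 1 ;;
     25 ::= Reg 3 ;;
     While (Reg 25) (8 ::= Reg 8 +\<^sub>e Const 1 ;; 25 ::= Reg 25 div\<^sub>e Const 2)"

lemma bits_div_2: "bits x = Suc j \<Longrightarrow> bits (x div 2) = j"
  by (subst (asm) compute_floorlog) (simp split: if_splits)

lemma bits_eq_0: "bits x = 0 \<longleftrightarrow> x = 0"
  by (simp add: floorlog_eq_zero_iff)

lemma runs_bit_length_loop:
  assumes K: "s 3 < 2 ^ K" "Suc (bits (s 3)) < 2 ^ K" and U: "U = 40 * Suc K"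
  shows "runs bit_length_loop s ((3 * K + 3) * U) (return_pmf ()) (\<lambda>s' _. s' = s(8 := Suc (bits (s 3)), 25 := 0))"
proof -
  define k where "k = bits (s 3)"
  have k: "k \<le> K" using K(1) by (simp add: k_def bits_le_iff)
  define Inv where "Inv j s' \<longleftrightarrow> j \<le> k \<and> bits (s' 25) = j \<and> s' 25 \<le> s 3 \<and> s' 8 + j = Suc k \<and>
    (\<forall>x. x \<notin> {8, 25} \<longrightarrow> s' x = s x)" for j s'
  have loop: "runs (While (Reg 25) (8 ::= Reg 8 +\<^sub>e Const 1 ;; 25 ::= Reg 25 div\<^sub>e Const 2)) (s(8 := 1, 25 := s 3))
     (k * (U + 2 * U) + U) (return_pmf ()) (\<lambda>s' _. Inv 0 s')"
  proof (rule runs_loop_det)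
    fix j s' assume I: "Inv (Suc j) s'" and j: "j < k"
    have "Inv j (s'(8 := s' 8 + 1, 25 := s' 25 div 2))"
      using I j bits_div_2[of "s' 25" j] div_le_dividend[of "s' 25" 2] unfolding Inv_def by auto
    moreover have "s' 8 \<le> Suc k" "s' 25 \<le> s 3" using I by (auto simp: Inv_def)
    then have b: "s' 8 < 2 ^ K" "s' 25 < 2 ^ K" using K by (simp_all add: k_def)
    ultimately show "runs (8 ::= Reg 8 +\<^sub>e Const 1 ;; 25 ::= Reg 25 div\<^sub>e Const 2) s' (2 * U) (return_pmf ()) (\<lambda>s' _. Inv j s')"
      apply -
      apply (rule runs_le)
       apply (rule runs_step[where K = K and U = U], (use b in simp; fail), (simp add: U; fail))
       apply (rule runs_last[where K = K and U = U], (use b in simp; fail), (simp add: U; fail))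
       apply simp
      by simp
  next
    show "(s' 25 = 0 \<longleftrightarrow> j = 0) \<and> 2 + bits (s' 25) \<le> U" if "Inv j s'" "j \<le> k" for j s'
      using that k bits_eq_0[of "s' 25"] by (auto simp: Inv_def U)
  next
    show "Inv k (s(8 := 1, 25 := s 3))" by (auto simp: Inv_def k_def)
  qed
  have e: "s' = s(8 := Suc k, 25 := 0)" if "Inv 0 s'" for s'
    using that bits_eq_0[of "s' 25"] by (auto simp: Inv_def fun_eq_iff)
  have "k * (U + 2 * U) + U \<le> (3 * K + 1) * U"
  proof -
    have "3 * U * k \<le> 3 * U * K" using k by (rule mult_le_mono2)
    then show ?thesis by (simp add: algebra_simps)
  qed
  then have t: "U + (U + (k * (U + 2 * U) + U)) \<le> (3 * K + 3) * U" by (simp add: algebra_simps)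
  show ?thesis
    unfolding bit_length_loop_def
    apply (rule runs_le[OF _ t])
    apply (rule runs_step[where K = K and U = U], simp, simp add: U)
    apply (rule runs_step[where K = K and U = U], use K in simp, simp add: U)
    apply (rule runs_mono[OF _ order_refl])
    apply (use loop in simp)
    by (simp add: e[unfolded k_def])
qed

definition prelude :: com where
  "prelude =
     5 ::= Const 2 ;;
     times_pow 4 5 ;;
     5 ::= Reg 4 *\<^sub>e Const 2 ;;
     times_pow 6 5 ;;
     times_pow 7 6 ;;
     bit_length_loop ;;
     9 ::= Const 16 *\<^sub>e Reg 0 *\<^sub>e Reg 2 ;;
     10 ::= Reg 9 *\<^sub>e Reg 9 *\<^sub>e (Reg 8 +\<^sub>e Reg 0) ;;
     11 ::= Reg 7 *\<^sub>e Reg 9 ;;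
     12 ::= Const 1 ;;
     13 ::= Const 1 ;;
     14 ::= Const 1 ;;
     15 ::= Reg 0"

definition estimate_step :: "nat \<Rightarrow> com \<Rightarrow> com" where
  "estimate_step R c =
     14 ::= Reg 14 *\<^sub>e Const 2 ;;
     16 ::= Const 0 ;;
     17 ::= Reg 10 ;;
     While (Reg 17) (sample_step R c) ;;
     12 ::= Reg 12 *\<^sub>e Reg 10 ;;
     13 ::= Reg 13 *\<^sub>e Reg 16 ;;
     15 ::= Reg 15 -\<^sub>e Const 1"

definition count_program :: "nat \<Rightarrow> com \<Rightarrow> com" where
  "count_program R c =
     prelude ;;
     While (Reg 15) (estimate_step R c) ;;
     0 ::= Reg 12 ;;
     1 ::= Reg 13"

lemma query_free_count_program: "query_free (count_program R c)"
  by (simp add: count_program_def prelude_def estimate_step_def bit_length_loop_def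
      query_free_times_pow query_free_sample_step)

section \<open>Parameters and analysis of the counting program\<close>

locale bis_run =
  fixes n code e d K :: nat
begin

definition "L = Suc (bits d)"
text \<open>Over \<open>n\<close> stages, a relative error of \<open>6 / E\<close> per stage adds up
  to \<open>3 / (8 * e)\<close>, at most \<open>3 / 8\<close> of \<epsilon>; the rest is slack for
  taking the reciprocal.\<close>

definition "E = 16 * n * e"
text \<open>Hoeffding's bound for deviation \<open>1 / E\<close> becomes
  \<open>2 * exp (- 2 * (L + n))\<close>: the summand \<open>n\<close> pays for the union bound over
  the stages and \<open>L\<close> for \<delta>.\<close>

definition "N = E * E * (L + n)"
definition "M = ((2::nat) ^ Suc n) ^ n"
text \<open>\<open>M ^ n\<close> is at hand as a base of the elimination and is at least
  \<open>4 ^ n\<close> when \<open>n\<close> is positive, so \<open>4 ^ n / Q\<close> is at most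
  \<open>1 / E\<close>.\<close>

definition "Q = M ^ n * E"

abbreviation "U \<equiv> 40 * Suc K"

definition small_values :: bool where
  "small_values \<longleftrightarrow> n < 2 ^ K \<and> code < 2 ^ K \<and> e < 2 ^ K \<and> d < 2 ^ K \<and> L < 2 ^ K \<and> E < 2 ^ K \<and> N < 2 ^ K \<and>
     N ^ n < 2 ^ K \<and> 2 ^ Suc n < (2::nat) ^ K \<and> M < 2 ^ K \<and> M ^ n < 2 ^ K \<and> Q < 2 ^ K \<and> Q ^ Suc n < 2 ^ K"

definition ready :: "state \<Rightarrow> bool" where
  "ready s \<longleftrightarrow> s 0 = n \<and> s 1 = code \<and> s 4 = 2 ^ n \<and> s 5 = 2 ^ Suc n \<and> s 6 = M \<and> s 7 = M ^ n \<and>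
     s 9 = E \<and> s 10 = N \<and> s 11 = Q"

lemma runs_prelude:
  assumes s: "s 0 = n" "s 1 = code" "s 2 = e" "s 3 = d" and small: small_values
  shows "runs prelude s ((9 * n + 3 * K + 30) * U) (return_pmf ()) (\<lambda>s' _. ready s' \<and>
     s' 12 = 1 \<and> s' 13 = 1 \<and> s' 14 = 1 \<and> s' 15 = n \<and> (\<forall>x\<ge>30. s' x = s x))"
proof -
  have b: "n < 2 ^ K" "code < 2 ^ K" "e < 2 ^ K" "d < 2 ^ K" "L < 2 ^ K" "E < 2 ^ K" "N < 2 ^ K"
     "2 ^ Suc n < (2::nat) ^ K" "M < 2 ^ K" "M ^ n < 2 ^ K" "Q < 2 ^ K"
    using small by (auto simp: small_values_def)
  have pow: "(2::nat) ^ n < 2 ^ K" using b(8) by (rule le_less_trans[rotated]) simp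
  have "2 ^ 1 \<le> (2::nat) ^ Suc n" by (rule power_increasing) auto
  then have two: "(2::nat) < 2 ^ K" using b(8)
    by (cases n) (auto intro: le_less_trans[OF _ b(8)])
  then have K: "0 < K" by (cases K) auto
  define s1 where "s1 = s(5 := 2)"
  define s2 where "s2 = s(5 := 2, 4 := 2 ^ n, 24 := 0)"
  define s3 where "s3 = s(4 := 2 ^ n, 24 := 0, 5 := 2 ^ Suc n)"
  define s4 where "s4 = s(4 := 2 ^ n, 5 := 2 ^ Suc n, 6 := M, 24 := 0)"
  define s5 where "s5 = s(4 := 2 ^ n, 5 := 2 ^ Suc n, 6 := M, 7 := M ^ n, 24 := 0)"
  define s6 where "s6 = s(4 := 2 ^ n, 5 := 2 ^ Suc n, 6 := M, 7 := M ^ n, 24 := 0, 8 := L, 25 := 0)"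
  have M: "0 < M" by (simp add: M_def)
  have p1: "runs (times_pow 4 5) s1 ((3 * n + 3) * U) (return_pmf ()) (\<lambda>s' _. s' = s2)"
    using runs_times_pow[of 4 5 s1 K U] b pow two s by (simp add: s1_def s2_def)
  have p2: "runs (times_pow 6 5) s3 ((3 * n + 3) * U) (return_pmf ()) (\<lambda>s' _. s' = s4)"
    using runs_times_pow[of 6 5 s3 K U] b s
    by (simp add: s3_def s4_def M_def fun_upd_twist cong del: if_cong)
  have p3: "runs (times_pow 7 6) s4 ((3 * n + 3) * U) (return_pmf ()) (\<lambda>s' _. s' = s5)"
    using runs_times_pow[of 7 6 s4 K U] b s M by (simp add: s4_def s5_def fun_upd_twist)
  have p4: "runs bit_length_loop s5 ((3 * K + 3) * U) (return_pmf ()) (\<lambda>s' _. s' = s6)"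
    using runs_bit_length_loop[of s5 K U] b s by (simp add: s5_def s6_def L_def)
  define post where "post s' \<longleftrightarrow> ready s' \<and>
     s' 12 = 1 \<and> s' 13 = 1 \<and> s' 14 = 1 \<and> s' 15 = n \<and> (\<forall>x\<ge>30. s' x = s x)" for s'
  define tail where "tail =
     (9 ::= Const 16 *\<^sub>e Reg 0 *\<^sub>e Reg 2 ;;
     10 ::= Reg 9 *\<^sub>e Reg 9 *\<^sub>e (Reg 8 +\<^sub>e Reg 0) ;;
     11 ::= Reg 7 *\<^sub>e Reg 9 ;;
     12 ::= Const 1 ;;
     13 ::= Const 1 ;;
     14 ::= Const 1 ;;
     15 ::= Reg 0)"
  have post: "post (s6(9 := E, 10 := N, 11 := Q, 12 := 1, 13 := 1, 14 := 1, 15 := n))"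
    using s by (simp add: post_def ready_def s6_def)
  have c6: "s6 0 = n" "s6 2 = e" "s6 7 = M ^ n" "s6 8 = L" using s by (simp_all add: s6_def)
  have q7: "runs tail s6 (7 * U) (return_pmf ()) (\<lambda>s' _. post s')"
    unfolding tail_def
    apply (rule runs_le)
     apply (rule runs_step[where K = K and U = U], (use b c6 in simp; fail), (use K in simp; fail),
        simp add: c6 E_def[symmetric])+
     apply (rule runs_last[where K = K and U = U], (use b c6 in simp; fail), (use K in simp; fail))
     apply (use post in \<open>simp add: c6 N_def[symmetric] Q_def[symmetric]\<close>)
    by simp
  have q4: "runs (bit_length_loop ;; tail) s5 ((3 * K + 3) * U + 7 * U) (return_pmf ()) (\<lambda>s' _. post s')"
    by (rule runs_Seq_det, rule runs_mono[OF p4 order_refl]) (use q7 in simp)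
  have q3: "runs (times_pow 7 6 ;; bit_length_loop ;; tail) s4 ((3 * n + 3) * U + ((3 * K + 3) * U + 7 * U))
      (return_pmf ()) (\<lambda>s' _. post s')"
    by (rule runs_Seq_det, rule runs_mono[OF p3 order_refl]) (use q4 in simp)
  have q2: "runs (times_pow 6 5 ;; times_pow 7 6 ;; bit_length_loop ;; tail) s3
      ((3 * n + 3) * U + ((3 * n + 3) * U + ((3 * K + 3) * U + 7 * U))) (return_pmf ()) (\<lambda>s' _. post s')"
    by (rule runs_Seq_det, rule runs_mono[OF p2 order_refl]) (use q3 in simp)
  have "s2(5 := s2 4 * 2) = s3" by (auto simp: s2_def s3_def fun_eq_iff)
  then have q1: "runs (5 ::= Reg 4 *\<^sub>e Const 2 ;; times_pow 6 5 ;; times_pow 7 6 ;; bit_length_loop ;; tail) s2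
      (U + ((3 * n + 3) * U + ((3 * n + 3) * U + ((3 * K + 3) * U + 7 * U)))) (return_pmf ()) (\<lambda>s' _. post s')"
    using q2 pow by (intro runs_step[where K = K]) (simp_all add: s2_def)
  have q0: "runs (times_pow 4 5 ;; 5 ::= Reg 4 *\<^sub>e Const 2 ;; times_pow 6 5 ;; times_pow 7 6 ;; bit_length_loop ;; tail) s1
      ((3 * n + 3) * U + (U + ((3 * n + 3) * U + ((3 * n + 3) * U + ((3 * K + 3) * U + 7 * U))))) (return_pmf ()) (\<lambda>s' _. post s')"
    by (rule runs_Seq_det, rule runs_mono[OF p1 order_refl]) (use q1 in simp)
  have "runs prelude s (U + ((3 * n + 3) * U + (U + ((3 * n + 3) * U + ((3 * n + 3) * U + ((3 * K + 3) * U + 7 * U))))))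
      (return_pmf ()) (\<lambda>s' _. post s')"
    unfolding prelude_def tail_def[symmetric]
    by (rule runs_step[where K = K]) (use q0 in \<open>simp_all add: s1_def\<close>)
  then show ?thesis unfolding post_def by (rule runs_le) (simp add: algebra_simps)
qed

lemma eval_context: "small_values \<Longrightarrow> 0 < n \<Longrightarrow> 0 < e \<Longrightarrow> m \<le> n \<Longrightarrow> eval_context n code m Q K"
  by unfold_locales (auto simp: small_values_def M_def Q_def E_def)

end

text \<open>\<open>r m\<close> is the run of the sampler on the weights of stage \<open>m\<close>.
  Fixing it as a parameter separates the analysis of the program from the promise about the
  sampler.\<close>

locale bis_sampler = bis_run +
  fixes c :: com and R T :: nat and r :: "nat \<Rightarrow> (state \<times> nat) pmf"
  assumes small: small_values and e: "0 < e"
    and R: "writes c \<subseteq> {..<R}" "2 \<le> R"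
    and K: "bits (2 * n) + bits E + T \<le> K"
    and exec: "\<And>m. 0 < m \<Longrightarrow> m \<le> n \<Longrightarrow> exec (eval_context.weight_oracle n code m Q) c (input [2 * n, E]) (r m)"
    and time: "\<And>m. 0 < m \<Longrightarrow> m \<le> n \<Longrightarrow> \<forall>(s, t)\<in>set_pmf (r m). t \<le> T"
begin

text \<open>The probability under the actual output of the sampler, for which the number of hits is
  exactly binomial; its distance from the true marginal is accounted for separately.\<close>

definition p :: "nat \<Rightarrow> real" where
  "p m = measure_pmf.prob (r m) {(s, t). m - 1 \<notin> set_decode (s 0)}"

abbreviation "S \<equiv> (R + 5) * U + (14 * n ^ 2 + 15 * n + 20) * U * T"

lemma p_range: "p m \<in> {0..1}"
  by (simp add: p_def)

text \<open>Every call starts from the same cleared registers, so the samples are independent and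
  identically distributed.\<close>

lemma runs_samples:
  assumes m: "0 < m" "m \<le> n" and s: "ready s" "s 14 = 2 ^ m" "s 16 = 0" "s 17 = N" "\<forall>x\<ge>30 + R. s x = 0"
  shows "runs (While (Reg 17) (sample_step R c)) s (N * (U + S) + U) (binomial_pmf N (p m))
    (\<lambda>s' k. s' 16 = k \<and> (\<forall>x<16. s' x = s x) \<and> (\<forall>x\<ge>30 + R. s' x = 0))"
proof -
  interpret ev: eval_context n code m Q K using eval_context small e m by simp
  have N: "N < 2 ^ K" using small by (simp add: small_values_def)
  have bern: "map_pmf (\<lambda>(s1, _). a + of_bool (m - 1 \<notin> set_decode (s1 0))) (r m) =
      map_pmf (\<lambda>b. a + of_bool b) (bernoulli_pmf (p m))" for a :: nat
  proof -
    have "map_pmf (\<lambda>(s1, _). m - 1 \<notin> set_decode (s1 0)) (r m) = bernoulli_pmf (p m)"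
      unfolding p_def
      by (subst bool_pmf_eq_bernoulli) (auto simp: pmf_map vimage_def case_prod_unfold)
    then have "map_pmf (\<lambda>b. a + of_bool b) (map_pmf (\<lambda>(s1, _). m - 1 \<notin> set_decode (s1 0)) (r m)) =
      map_pmf (\<lambda>b. a + of_bool b) (bernoulli_pmf (p m))" by simp
    then show ?thesis by (simp add: map_pmf_comp case_prod_unfold)
  qed
  define Inv where "Inv i s' k \<longleftrightarrow> i \<le> N \<and> s' 17 = i \<and> s' 16 = k \<and> k + i \<le> N \<and> (\<forall>x<16. s' x = s x) \<and>
    (\<forall>x\<ge>30 + R. s' x = 0)" for i s' k
  have "runs (While (Reg 17) (sample_step R c)) s (N * (U + S) + U)
     (iterate (\<lambda>_ a. map_pmf (\<lambda>b. a + of_bool b) (bernoulli_pmf (p m))) N 0) (Inv 0)"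
  proof (rule runs_loop)
    fix i s' k assume I: "Inv (Suc i) s' k" and i: "i < N"
    have lo: "s' x = s x" if "x < 16" for x using I that by (simp add: Inv_def)
    have conf: "ev.conf s'"
      using s(1,2) unfolding ev.conf_def ready_def
      by (simp add: lo ev.C_def ev.B_def M_def)
    have k: "s' 16 = k" "s' 17 = Suc i" "k + Suc i \<le> N" using I by (simp_all add: Inv_def)
    have "runs (sample_step R c) s' S
     (map_pmf (\<lambda>(s1, _). s' 16 + of_bool (m - 1 \<notin> set_decode (s1 0))) (r m))
     (\<lambda>s'' a. s'' 16 = a \<and> s'' 17 = i \<and> (\<forall>x<16. s'' x = s' x) \<and> (\<forall>x\<ge>30 + R. s'' x = 0))"
    proof (rule ev.runs_sample_step[OF conf m(1) R exec[OF m] time[OF m] _ k(2) _ _ _ K])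
      show "s' 9 = E" using s(1) by (simp add: lo ready_def)
      show "\<forall>x\<ge>30 + R. s' x = 0" using I by (simp add: Inv_def)
      show "s' 16 < 2 ^ K" "s' 17 < 2 ^ K" using k N by simp_all
    qed
    then show "runs (sample_step R c) s' S (map_pmf (\<lambda>b. k + of_bool b) (bernoulli_pmf (p m))) (Inv i)"
      unfolding k(1) bern
    proof (rule runs_mono[OF _ order_refl])
      fix s'' a assume a: "a \<in> set_pmf (map_pmf (\<lambda>b. k + of_bool b) (bernoulli_pmf (p m)))"
        and s'': "s'' 16 = a \<and> s'' 17 = i \<and> (\<forall>x<16. s'' x = s' x) \<and> (\<forall>x\<ge>30 + R. s'' x = 0)"
      obtain b :: bool where "a = k + of_bool b" using a by auto
      then have "a \<le> Suc k" by (cases b) auto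
      then show "Inv i s'' a" unfolding Inv_def using s'' k(3) lo i by simp
    qed
  next
    show "(s' 17 = 0 \<longleftrightarrow> i = 0) \<and> 2 + bits (s' 17) \<le> U" if "Inv i s' k" "i \<le> N" for i s' k
    proof -
      have "bits i \<le> K" using that N by (simp add: bits_le_iff)
      then show ?thesis using that by (simp add: Inv_def)
    qed
  next
    show "Inv N s 0" using s by (simp add: Inv_def)
  qed
  moreover have "iterate (\<lambda>_ a. map_pmf (\<lambda>b. a + of_bool b) (bernoulli_pmf (p m))) N 0 = binomial_pmf N (p m)"
  proof -
    have "(\<lambda>k. 0 + k) = (id :: nat \<Rightarrow> nat)" by auto
    then show ?thesis unfolding iterate_binomial[OF p_range] by (simp only: pmf.map_id)
  qed
  ultimately show ?thesis
    by (auto simp: Inv_def intro: runs_mono[OF _ order_refl])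
qed

text \<open>A product of hit counts. Divided by \<open>N ^ n\<close> it approximates the reciprocal
  of the number of independent sets, which is why the program outputs it as the denominator.\<close>

definition estimate :: "nat \<Rightarrow> nat pmf" where
  "estimate j = iterate (\<lambda>j a. map_pmf (\<lambda>k. a * k) (binomial_pmf N (p (n - j)))) j 1"

lemma runs_estimates:
  assumes s: "ready s" "s 12 = 1" "s 13 = 1" "s 14 = 1" "s 15 = n" "\<forall>x\<ge>30 + R. s x = 0"
  shows "runs (While (Reg 15) (estimate_step R c)) s (n * (U + (N * (U + S) + 7 * U)) + U) (estimate n)
    (\<lambda>s' a. s' 12 = N ^ n \<and> s' 13 = a \<and> a \<le> N ^ n)"
proof -
  have b: "n < 2 ^ K" "N < 2 ^ K" "N ^ n < 2 ^ K" "2 ^ Suc n < (2::nat) ^ K"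
    using small by (simp_all add: small_values_def)
  have Ni: "x < 2 ^ K" if "x \<le> N ^ i" "i \<le> n" for x i
  proof (cases "N = 0")
    \<comment> \<open>This is the graph without vertices, where \<open>E\<close> is zero as
      well.\<close>
    case True
    then have "x \<le> 1" using that(1) by (cases i) auto
    moreover have "(1::nat) \<le> 2 ^ Suc n" by simp
    ultimately show ?thesis using b(4) by linarith
  next
    case False
    then have "N ^ i \<le> N ^ n" using that(2) by (intro power_increasing) auto
    then show ?thesis using that(1) b(3) by linarith
  qed
  define Inv where "Inv j s' a \<longleftrightarrow> j \<le> n \<and> s' 15 = j \<and> s' 14 = 2 ^ (n - j) \<and> s' 12 = N ^ (n - j) \<and>
    s' 13 = a \<and> a \<le> N ^ (n - j) \<and> (\<forall>x<12. s' x = s x) \<and> (\<forall>x\<ge>30 + R. s' x = 0)" for j s' a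
  have "runs (While (Reg 15) (estimate_step R c)) s (n * (U + (N * (U + S) + 7 * U)) + U) (estimate n) (Inv 0)"
    unfolding estimate_def
  proof (rule runs_loop)
    fix j s' a assume I: "Inv (Suc j) s' a" and j: "j < n"
    let ?m = "n - j"
    have m: "0 < ?m" "?m \<le> n" "?m = Suc (n - Suc j)" using j by auto
    have r': "s' 15 = Suc j" "s' 14 = 2 ^ (n - Suc j)" "s' 12 = N ^ (n - Suc j)" "s' 13 = a" "a \<le> N ^ (n - Suc j)"
      "\<forall>x\<ge>30 + R. s' x = 0" using I by (simp_all add: Inv_def)
    have lo: "s' x = s x" if "x < 12" for x using I that by (simp add: Inv_def)
    define s1 where "s1 = s'(14 := 2 ^ ?m, 16 := 0, 17 := N)"
    have ready1: "ready s1" using s(1) by (simp add: ready_def s1_def lo)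
    have loop: "runs (While (Reg 17) (sample_step R c)) s1 (N * (U + S) + U) (binomial_pmf N (p ?m))
      (\<lambda>s2 k. s2 16 = k \<and> (\<forall>x<16. s2 x = s1 x) \<and> (\<forall>x\<ge>30 + R. s2 x = 0))"
      by (rule runs_samples[OF m(1,2) ready1]) (use r' in \<open>simp_all add: s1_def\<close>)
    have rest: "runs (12 ::= Reg 12 *\<^sub>e Reg 10 ;; 13 ::= Reg 13 *\<^sub>e Reg 16 ;; 15 ::= Reg 15 -\<^sub>e Const 1) s2 (3 * U)
        (return_pmf (a * k)) (Inv j)"
      if k: "k \<in> set_pmf (binomial_pmf N (p ?m))"
        and s2: "s2 16 = k \<and> (\<forall>x<16. s2 x = s1 x) \<and> (\<forall>x\<ge>30 + R. s2 x = 0)" for s2 k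
    proof -
      have "set_pmf (binomial_pmf N (p ?m)) \<subseteq> {..N}"
        using p_range[of ?m] by (subst set_pmf_binomial_eq) auto
      then have kN: "k \<le> N" using k by auto
      have c2: "s2 12 = N ^ (n - Suc j)" "s2 10 = N" "s2 13 = a" "s2 16 = k" "s2 15 = Suc j" "s2 14 = 2 ^ ?m"
        using s2 r' ready1 by (simp_all add: s1_def ready_def)
      have kb: "k < 2 ^ K" "a < 2 ^ K" "N ^ (n - Suc j) < 2 ^ K" "Suc j < 2 ^ K"
        using kN b j Ni[OF r'(5)] Ni[OF order_refl, of "n - Suc j"] by auto
      have "a * k \<le> N ^ (n - Suc j) * N" using r'(5) kN by (intro mult_le_mono)
      then have ak: "a * k \<le> N ^ ?m" unfolding m(3) by (simp add: mult.commute)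
      have "Inv j (s2(12 := s2 12 * s2 10, 13 := s2 13 * s2 16, 15 := s2 15 - 1)) (a * k)"
        using s2 lo j ak unfolding Inv_def by (simp add: c2 s1_def m(3) mult.commute)
      then show ?thesis
        apply -
        apply (rule runs_le)
         apply (rule runs_step[where K = K and U = U], (use b kb c2 in simp; fail), (simp; fail))+
         apply (rule runs_last[where K = K and U = U], (use b kb c2 in simp; fail), (simp; fail))
         apply simp
        by simp
    qed
    have tail: "runs (While (Reg 17) (sample_step R c) ;; 12 ::= Reg 12 *\<^sub>e Reg 10 ;; 13 ::= Reg 13 *\<^sub>e Reg 16 ;;
        15 ::= Reg 15 -\<^sub>e Const 1) s1 (N * (U + S) + U + 3 * U) (map_pmf (\<lambda>k. a * k) (binomial_pmf N (p ?m))) (Inv j)"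
      unfolding map_pmf_def by (rule runs_Seq[OF loop rest])
    have c: "s' 14 * 2 = 2 ^ ?m" "s' 10 = N" using r'(2) m(3) s(1) by (simp_all add: lo ready_def)
    have "(2::nat) ^ (n - Suc j) \<le> 2 ^ Suc n" by (intro power_increasing) auto
    then have "s' 14 < 2 ^ K" unfolding r'(2) using b(4) by (rule le_less_trans)
    moreover have "s' 10 < 2 ^ K" using b c by simp
    ultimately have b14: "s' 14 < 2 ^ K" "s' 10 < 2 ^ K" .
    show "runs (estimate_step R c) s' (N * (U + S) + 7 * U) (map_pmf (\<lambda>k. a * k) (binomial_pmf N (p ?m))) (Inv j)"
      unfolding estimate_step_def
      apply (rule runs_le)
       apply (rule runs_step[where K = K and U = U], (use b14 in simp; fail), (simp; fail))+
       apply (simp only: value_of.simps apply_op.simps c fun_upd_other)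
       apply (use tail in \<open>simp add: s1_def c\<close>)
      by simp
  next
    show "(s' 15 = 0 \<longleftrightarrow> j = 0) \<and> 2 + bits (s' 15) \<le> U" if "Inv j s' a" "j \<le> n" for j s' a
    proof -
      have "bits j \<le> K" using that b(1) by (simp add: bits_le_iff)
      then show ?thesis using that by (simp add: Inv_def)
    qed
  next
    show "Inv n s 1" using s by (simp add: Inv_def)
  qed
  then show ?thesis by (rule runs_mono) (auto simp: Inv_def)
qed

lemma runs_count_program:
  "runs (count_program R c) (input [n, code, e, d])
     ((9 * n + 3 * K + 30) * U + (n * (U + (N * (U + S) + 7 * U)) + U) + 2 * U) (estimate n)
     (\<lambda>s' a. s' 0 = N ^ n \<and> s' 1 = a)"
proof -
  have b: "N ^ n < 2 ^ K" using small by (simp add: small_values_def)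
  have fin: "runs (0 ::= Reg 12 ;; 1 ::= Reg 13) s (2 * U) (return_pmf a) (\<lambda>s' a. s' 0 = N ^ n \<and> s' 1 = a)"
    if "s 12 = N ^ n \<and> s 13 = a \<and> a \<le> N ^ n" for s a
  proof -
    have "a < 2 ^ K" using that b by linarith
    with that b show ?thesis
      apply -
      apply (rule runs_le)
       apply (rule runs_step[where K = K and U = U], simp, simp)
       apply (rule runs_last[where K = K and U = U], simp, simp)
       apply simp
      by simp
  qed
  have loop: "runs (While (Reg 15) (estimate_step R c) ;; 0 ::= Reg 12 ;; 1 ::= Reg 13) s
      (n * (U + (N * (U + S) + 7 * U)) + U + 2 * U) (estimate n) (\<lambda>s' a. s' 0 = N ^ n \<and> s' 1 = a)"
    if "ready s \<and> s 12 = 1 \<and> s 13 = 1 \<and> s 14 = 1 \<and> s 15 = n \<and> (\<forall>x\<ge>30. s x = input [n, code, e, d] x)" for s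
  proof -
    have "\<forall>x\<ge>30 + R. s x = 0" using that by (simp add: input_def)
    then have "runs (While (Reg 15) (estimate_step R c)) s (n * (U + (N * (U + S) + 7 * U)) + U) (estimate n)
      (\<lambda>s' a. s' 12 = N ^ n \<and> s' 13 = a \<and> a \<le> N ^ n)" using that by (intro runs_estimates) auto
    then have "runs (While (Reg 15) (estimate_step R c) ;; 0 ::= Reg 12 ;; 1 ::= Reg 13) s
      (n * (U + (N * (U + S) + 7 * U)) + U + 2 * U) (bind_pmf (estimate n) return_pmf) (\<lambda>s' a. s' 0 = N ^ n \<and> s' 1 = a)"
      by (rule runs_Seq) (rule fin)
    then show ?thesis by (simp only: bind_return_pmf')
  qed
  have pre: "runs prelude (input [n, code, e, d]) ((9 * n + 3 * K + 30) * U) (return_pmf ()) (\<lambda>s _. ready s \<and>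
     s 12 = 1 \<and> s 13 = 1 \<and> s 14 = 1 \<and> s 15 = n \<and> (\<forall>x\<ge>30. s x = input [n, code, e, d] x))"
    by (rule runs_prelude[OF _ _ _ _ small]) (simp_all add: input_def)
  show ?thesis
    unfolding count_program_def
    by (rule runs_le, rule runs_Seq_det, rule runs_mono[OF pre order_refl], rule loop) simp_all
qed

end

section \<open>Accuracy and polynomial running time\<close>

lemma poly_nat_mono: "x \<le> y \<Longrightarrow> poly p x \<le> poly (p :: nat poly) y"
  by (induction p) (auto intro!: add_mono mult_mono)

lemma set_encode_less: "X \<subseteq> {..<k} \<Longrightarrow> set_encode X < 2 ^ k"
proof -
  assume X: "X \<subseteq> {..<k}"
  then have fin: "finite X" using finite_subset by blast
  have "set_decode (set_encode X mod 2 ^ k) = set_decode (set_encode X)"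
    using X fin by (auto simp: set_decode_mod)
  then have "set_encode X mod 2 ^ k = set_encode X" by (metis set_decode_inverse)
  then show ?thesis by (metis mod_less_divisor zero_less_numeral zero_less_power)
qed

lemma graph_code_iff:
  assumes E: "E \<subseteq> {..<n} \<times> {..<n}" and uv: "u < n" "v < n"
  shows "u * n + v \<in> set_decode (set_encode ((\<lambda>(u, v). u * n + v) ` E)) \<longleftrightarrow> (u, v) \<in> E"
proof -
  have "finite ((\<lambda>(u, v). u * n + v) ` E)" using E finite_subset by (intro finite_imageI) blast
  moreover have "u * n + v \<in> (\<lambda>(u, v). u * n + v) ` E \<longleftrightarrow> (u, v) \<in> E"
  proof
    assume "u * n + v \<in> (\<lambda>(u, v). u * n + v) ` E"
    then obtain u' v' where *: "u * n + v = u' * n + v'" "(u', v') \<in> E" by auto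
    then have "v' < n" using E by auto
    then have "u = u'" "v = v'"
      using arg_cong[OF *(1), of "\<lambda>x. x div n"] arg_cong[OF *(1), of "\<lambda>x. x mod n"] uv by auto
    then show "(u, v) \<in> E" using * by simp
  qed (force intro: image_eqI[of _ _ "(u, v)"])
  ultimately show ?thesis by simp
qed

lemma graph_code_less:
  assumes "E \<subseteq> {..<n} \<times> {..<n}"
  shows "set_encode ((\<lambda>(u, v). u * n + v) ` E) < 2 ^ (n * n)"
proof (rule set_encode_less, safe)
  fix u v assume "(u, v) \<in> E"
  then have "u < n" "v < n" using assms by auto
  then have "u * n + v < Suc u * n" by simp
  also have "\<dots> \<le> n * n" using \<open>u < n\<close> by (intro mult_le_mono1) simp
  finally show "u * n + v < n * n" .
qed

definition sampler_bound :: "com \<Rightarrow> nat poly \<Rightarrow> bool" where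
  "sampler_bound c ps \<longleftrightarrow> (\<forall>n g \<pi> b orc (\<epsilon> :: real).
        log_Mnat_convex_dist {..<n} g \<pi> \<longrightarrow> value_oracle n g b orc \<longrightarrow> 0 < \<epsilon> \<longrightarrow>
        (\<exists>r. exec orc c (input [n, nat \<lceil>1 / \<epsilon>\<rceil>]) r \<and>
             (\<forall>(s, t) \<in> set_pmf r. t \<le> poly ps (n + b + nat \<lceil>log 2 (1 / \<epsilon>)\<rceil>)) \<and>
             tv_dist (map_pmf (\<lambda>(s, t). set_decode (s 0)) r) \<pi> \<le> \<epsilon>))"

text \<open>The accuracy is chosen as \<open>1 / E\<close>, so the rounded reciprocal passed to the
  sampler is \<open>E\<close> itself. The error of the sampler and the weight of the sets of nonzero
  rank add up, and \<open>b\<close> bounds the length of the oracle's answers.\<close>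

lemma sampler_marginal:
  assumes samp: "sampler_bound c ps" and graph: "(n, G) \<in> bipartite_graphs"
    and code: "code = set_encode ((\<lambda>(u, v). u * n + v) ` G)"
    and ctx: "eval_context n code m Q K" and m: "0 < m" "m \<le> n" and b: "Q ^ n < 2 ^ b" and E: "0 < E"
  shows "\<exists>r. exec (eval_context.weight_oracle n code m Q) c (input [2 * n, E]) r \<and>
    (\<forall>(s, t) \<in> set_pmf r. t \<le> poly ps (2 * n + b + E)) \<and>
    \<bar>measure_pmf.prob r {(s, t). m - 1 \<notin> set_decode (s 0)} -
       card (prefix_independent n G (m - 1)) / (2 * card (prefix_independent n G m))\<bar> \<le> 1 / E + 4 ^ n / Q"
proof -
  interpret ev: eval_context n code m Q K by fact
  from graph have G: "G \<subseteq> {..<n} \<times> {..<n}" "sym G" and "\<exists>P. \<forall>(u, v)\<in>G. u \<in> P \<longleftrightarrow> v \<notin> P"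
    by (auto simp: bipartite_graphs_def)
  then obtain P where P: "\<forall>(u, v)\<in>G. u \<in> P \<longleftrightarrow> v \<notin> P" by blast
  have edge: "ev.edge = (\<lambda>u v. u < m \<and> v < m \<and> (u, v) \<in> G)"
  proof (intro ext)
    show "ev.edge u v = (u < m \<and> v < m \<and> (u, v) \<in> G)" for u v
      using graph_code_iff[OF G(1), of u v] m(2) unfolding ev.edge_def by (auto simp: code)
  qed
  let ?g = "cut_weight n ev.edge Q"
  have Q: "1 \<le> Q" using ev.Q(1) by simp
  obtain \<pi> where \<pi>: "log_Mnat_convex_dist {..<2 * n} ?g \<pi>" using cut_weight_dist_exists[OF Q] by blast
  have orc: "value_oracle (2 * n) ?g b ev.weight_oracle"
    unfolding value_oracle_def
  proof (intro allI impI)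
    fix X :: "nat set" assume X: "X \<subseteq> {..<2 * n}"
    then have fin: "finite X" using finite_subset by blast
    have "set_encode X < 2 ^ n * 2 ^ n"
      using set_encode_less[OF X] by (simp add: power_add[symmetric] mult_2)
    then have "ev.weight_oracle (set_encode X) = (1, Q ^ cut_rank n ev.edge X)"
      using fin by (simp add: ev.weight_oracle_def)
    moreover have "Q ^ cut_rank n ev.edge X \<le> Q ^ n" using Q cut_rank_le by (intro power_increasing)
    then have "bits (Q ^ cut_rank n ev.edge X) \<le> b" using b by (simp add: bits_le_iff)
    moreover have "(1::nat) < 2 ^ b"
    proof -
      have "1 \<le> Q ^ n" using Q by simp
      then show ?thesis using b by linarith
    qed
    then have "bits 1 \<le> b" by (simp add: bits_le_iff)
    ultimately show "\<exists>num den. ev.weight_oracle (set_encode X) = (num, den) \<and> den \<noteq> 0 \<and>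
        ?g X = real num / real den \<and> bits num \<le> b \<and> bits den \<le> b"
      using Q by (intro exI[of _ 1] exI[of _ "Q ^ cut_rank n ev.edge X"]) (auto simp: cut_weight_def)
  qed
  have \<epsilon>: "0 < 1 / real E" "nat \<lceil>1 / (1 / real E)\<rceil> = E" using E by simp_all
  obtain r where r: "exec ev.weight_oracle c (input [2 * n, E]) r"
      "\<forall>(s, t)\<in>set_pmf r. t \<le> poly ps (2 * n + b + nat \<lceil>log 2 (1 / (1 / real E))\<rceil>)"
      "tv_dist (map_pmf (\<lambda>(s, t). set_decode (s 0)) r) \<pi> \<le> 1 / real E"
    using samp \<pi> orc \<epsilon> unfolding sampler_bound_def by metis
  \<comment> \<open>A crude bound suffices, because \<open>E\<close> will itself be polynomial in
    the number of vertices and \<open>1 / \<epsilon>\<close>.\<close>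
  have "log 2 (real E) \<le> real E"
  proof -
    have "real E \<le> real (2 ^ E)" by (simp only: of_nat_le_iff) (simp add: less_imp_le)
    then have "real E \<le> 2 powr real E" by (simp add: powr_realpow)
    then show ?thesis using E by (simp add: log_le_iff)
  qed
  then have "nat \<lceil>log 2 (1 / (1 / real E))\<rceil> \<le> E" by (simp add: ceiling_le_iff nat_le_iff)
  then have time: "poly ps (2 * n + b + nat \<lceil>log 2 (1 / (1 / real E))\<rceil>) \<le> poly ps (2 * n + b + E)"
    by (intro poly_nat_mono) simp
  let ?A = "{S. m - 1 \<notin> S}"
  let ?K = "\<lambda>j. card (prefix_independent n G j)"
  have irr: "(u, u) \<notin> G" for u using P by auto
  have pos: "0 < ?K j" for j
  proof -
    have "{} \<in> prefix_independent n G j" by (simp add: prefix_independent_def)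
    then show ?thesis using finite_prefix_independent by (auto simp: card_gt_0_iff)
  qed
  have w: "m - 1 < n" using m by simp
  have K1: "?K (m - 1) = 2 * card {J \<in> prefix_independent n G m. m - 1 \<notin> J}"
    using card_prefix_independent_Suc[of G "m - 1" n] irr m by simp
  have "measure_pmf.prob r {(s, t). m - 1 \<notin> set_decode (s 0)} =
      measure_pmf.prob (map_pmf (\<lambda>(s, t). set_decode (s 0)) r) ?A"
    by (simp add: vimage_def case_prod_unfold)
  then have 1: "\<bar>measure_pmf.prob r {(s, t). m - 1 \<notin> set_decode (s 0)} - measure_pmf.prob \<pi> ?A\<bar> \<le> 1 / E"
    using prob_le_tv_dist[of "map_pmf (\<lambda>(s, t). set_decode (s 0)) r" ?A \<pi>] r(3) by simp
  have "card {S \<in> zero_cuts n ev.edge. m - 1 \<notin> S} / card (zero_cuts n ev.edge) = ?K (m - 1) / (2 * ?K m)"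
    unfolding edge card_zero_cuts[OF G(2) P w, of m] K1 using pos[of m] by simp
  then have 2: "\<bar>measure_pmf.prob \<pi> ?A - ?K (m - 1) / (2 * ?K m)\<bar> \<le> 4 ^ n / Q"
    using prob_cut_weight[OF \<pi> Q, of "\<lambda>S. m - 1 \<notin> S"] by simp
  have 3: "\<bar>measure_pmf.prob r {(s, t). m - 1 \<notin> set_decode (s 0)} - ?K (m - 1) / (2 * ?K m)\<bar>
      \<le> 1 / E + 4 ^ n / Q"
    using 1 2 by linarith
  have "\<forall>(s, t) \<in> set_pmf r. t \<le> poly ps (2 * n + b + E)" using r(2) time by (auto intro: order_trans)
  with r(1) 3 show ?thesis by blast
qed

context bis_sampler begin

text \<open>The exact marginals multiply to \<open>P m\<close> because the counts telescope. The
  invariant \<open>Good\<close> loses one factor \<open>1 - x\<close> or \<open>1 + x\<close> per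
  stage, and a stage fails only if its frequency deviates from \<open>p m\<close> by
  \<open>1 / E\<close>.\<close>

lemma estimate_concentration:
  fixes k :: "nat \<Rightarrow> nat"
  assumes n: "0 < n" and k: "\<And>m. 0 < k m" "\<And>m. 0 < m \<Longrightarrow> m \<le> n \<Longrightarrow> k m \<le> k (m - 1)"
    and p: "\<And>m. 0 < m \<Longrightarrow> m \<le> n \<Longrightarrow> \<bar>p m - k (m - 1) / (2 * k m)\<bar> \<le> 2 / E"
  defines "x \<equiv> 6 / real E" and "P \<equiv> \<lambda>m. real (k 0) / (2 ^ m * real (k m))"
  shows "measure_pmf.prob (estimate n)
    {a. \<not> ((1 - x) ^ n * P n * real N ^ n \<le> real a \<and> real a \<le> (1 + x) ^ n * P n * real N ^ n)} \<le>
    n * (2 * exp (- 2 * (real L + real n)))"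
proof -
  have E: "16 \<le> E" using n e unfolding E_def by (cases n; cases e) auto
  have N: "0 < N" using E by (simp add: N_def L_def)
  have x: "0 \<le> x" "x \<le> 1" using E by (simp_all add: x_def)
  define Good where "Good j a \<longleftrightarrow> (1 - x) ^ (n - j) * P (n - j) * real N ^ (n - j) \<le> real a \<and>
    real a \<le> (1 + x) ^ (n - j) * P (n - j) * real N ^ (n - j)" for j a
  have P_pos: "0 < P m" for m using k(1)[of m] k(1)[of 0] by (simp add: P_def)
  have "measure_pmf.prob (estimate n) {a. \<not> Good 0 a} \<le> real n * (2 * exp (- 2 * (real L + real n)))"
    unfolding estimate_def
  proof (rule prob_iterate_le)
    show "Good n 1" using k(1)[of 0] by (simp add: Good_def P_def)
  next
    fix j a assume j: "j < n" and good: "Good (Suc j) a"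
    define m where "m = n - j"
    define i where "i = n - Suc j"
    have m: "0 < m" "m \<le> n" "m = Suc i" using j by (auto simp: m_def i_def)
    define q where "q = real (k (m - 1)) / (2 * real (k m))"
    \<comment> \<open>Removing edges cannot destroy independent sets. This lower bound is what turns
      an additive error into a relative one.\<close>
    have q: "1 / 2 \<le> q" using k(1)[of m] k(2)[OF m(1,2)] by (simp add: q_def field_simps)
    have P: "P m = P i * q" using m(3) k(1)[of i] by (simp add: P_def q_def)
    have ok: "Good j (a * t)" if "\<not> 1 / E \<le> \<bar>real t / N - p m\<bar>" for t
    proof -
      have "\<bar>p m - q\<bar> \<le> 2 / E" using p[OF m(1,2)] by (simp only: q_def)
      moreover have "2 / real E = 2 * (1 / real E)" "3 / real E = 3 * (1 / real E)" by simp_all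
      \<comment> \<open>Two units of \<open>1 / E\<close> stem from the bias of \<open>p m\<close>,
        the third from sampling.\<close>
      ultimately have "\<bar>real t / N - q\<bar> \<le> 3 / E" using that by linarith
      also have "3 / E \<le> x * q" using q E by (simp add: x_def field_simps)
      finally have "(1 - x) * q \<le> real t / N" "real t / N \<le> (1 + x) * q"
        by (simp_all add: abs_le_iff algebra_simps)
      then have t: "(1 - x) * q * N \<le> t" "t \<le> (1 + x) * q * N" using N by (simp_all add: field_simps)
      have g: "(1 - x) ^ i * P i * real N ^ i \<le> real a" "real a \<le> (1 + x) ^ i * P i * real N ^ i"
        using good unfolding Good_def i_def by simp_all
      have "((1 - x) ^ i * P i * real N ^ i) * ((1 - x) * q * N) \<le> real a * real t"
        using t(1) g(1) x q P_pos[of i] by (intro mult_mono) auto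
      moreover have "real a * real t \<le> ((1 + x) ^ i * P i * real N ^ i) * ((1 + x) * q * N)"
        using t(2) g(2) x q P_pos[of i] by (intro mult_mono) auto
      ultimately show ?thesis unfolding Good_def m_def[symmetric] P unfolding m(3)
        by (simp add: mult_ac)
    qed
    have "measure_pmf.prob (map_pmf (\<lambda>t. a * t) (binomial_pmf N (p m))) {y. \<not> Good j y} =
        measure_pmf.prob (binomial_pmf N (p m)) {t. \<not> Good j (a * t)}"
      by (simp add: vimage_def)
    also have "\<dots> \<le> measure_pmf.prob (binomial_pmf N (p m)) {t. 1 / real E \<le> \<bar>real t / N - p m\<bar>}"
      using ok by (intro measure_pmf.finite_measure_mono) auto
    also have "\<dots> \<le> 2 * exp (- 2 * real N * (1 / real E)\<^sup>2)"
      by (rule binomial_tail[OF p_range N]) simp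
    also have "- 2 * real N * (1 / real E)\<^sup>2 = - 2 * (real L + real n)"
      using E by (simp add: N_def power2_eq_square field_simps)
    finally show "measure_pmf.prob (map_pmf (\<lambda>t. a * t) (binomial_pmf N (p (n - j)))) {y. \<not> Good j y}
        \<le> 2 * exp (- 2 * (real L + real n))" unfolding m_def .
  qed simp
  then show ?thesis by (simp add: Good_def)
qed

end

text \<open>Taking the reciprocal swaps the two sides: the upper bound rests on Bernoulli's
  inequality for \<open>(1 - x) ^ n\<close>, the lower one on comparing \<open>(1 + x) ^ n\<close>
  with an exponential. The lower bound on \<open>a\<close> also keeps the denominator
  positive.\<close>

lemma count_accuracy:
  fixes \<epsilon> x k A a :: real
  assumes \<epsilon>: "0 < \<epsilon>" "\<epsilon> < 1" and x: "0 \<le> x" "x \<le> 1" "real n * x \<le> 3 / 8 * \<epsilon>" and k: "0 < k" and A: "0 < A"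
    and a: "(1 - x) ^ n * (1 / k) * A \<le> a" "a \<le> (1 + x) ^ n * (1 / k) * A"
  shows "(1 - \<epsilon>) * k \<le> A / a \<and> A / a \<le> (1 + \<epsilon>) * k"
proof -
  have lower: "1 - 3 / 8 * \<epsilon> \<le> (1 - x) ^ n"
    using Bernoulli_inequality[of "- x" n] x by simp
  then have pos: "0 < (1 - x) ^ n" using \<epsilon> by linarith
  then have "0 < (1 - x) ^ n * (1 / k) * A" using k A by simp
  then have apos: "0 < a" using a(1) by linarith
  have "1 \<le> (1 + \<epsilon>) * (1 - 3 / 8 * \<epsilon>)"
  proof -
    have "\<epsilon> * \<epsilon> \<le> \<epsilon> * 1" using \<epsilon> by (intro mult_left_mono) auto
    then show ?thesis using \<epsilon> by (simp add: algebra_simps)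
  qed
  also have "\<dots> \<le> (1 + \<epsilon>) * (1 - x) ^ n" using lower \<epsilon> by (intro mult_left_mono) auto
  finally have up: "1 \<le> (1 + \<epsilon>) * (1 - x) ^ n" .
  have "A * 1 \<le> A * ((1 + \<epsilon>) * (1 - x) ^ n)" using up A by (intro mult_left_mono) auto
  also have "\<dots> = (1 + \<epsilon>) * k * ((1 - x) ^ n * (1 / k) * A)" using k by simp
  also have "\<dots> \<le> (1 + \<epsilon>) * k * a" using a(1) k \<epsilon> by (intro mult_left_mono) auto
  finally have 1: "A / a \<le> (1 + \<epsilon>) * k" using apos by (simp add: field_simps)
  have "(1 + x) ^ n \<le> exp (real n * x)"
  proof -
    have "(1 + x) ^ n \<le> exp x ^ n" using x exp_ge_add_one_self[of x] by (intro power_mono) auto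
    then show ?thesis by (simp add: exp_of_nat_mult)
  qed
  moreover have "1 - \<epsilon> \<le> exp (- \<epsilon>)" using exp_ge_add_one_self[of "- \<epsilon>"] by simp
  ultimately have "(1 - \<epsilon>) * (1 + x) ^ n \<le> exp (- \<epsilon>) * exp (real n * x)"
    using \<epsilon> x by (intro mult_mono) auto
  also have "\<dots> = exp (real n * x - \<epsilon>)" by (simp add: exp_add[symmetric])
  also have "\<dots> \<le> 1" using x \<epsilon> by simp
  finally have lo: "(1 - \<epsilon>) * (1 + x) ^ n \<le> 1" .
  have "(1 - \<epsilon>) * k * a \<le> (1 - \<epsilon>) * k * ((1 + x) ^ n * (1 / k) * A)"
    using a(2) k \<epsilon> by (intro mult_left_mono) auto
  also have "\<dots> = ((1 - \<epsilon>) * (1 + x) ^ n) * A" using k by simp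
  also have "\<dots> \<le> 1 * A" using lo A by (intro mult_right_mono) auto
  finally have "(1 - \<epsilon>) * k \<le> A / a" using apos by (simp add: field_simps)
  with 1 show ?thesis by simp
qed

text \<open>The factor \<open>exp (- 2 * n)\<close> absorbs the number of stages, and
  \<open>exp (- 2 * L)\<close> is at most \<delta> because \<open>2 ^ L\<close> exceeds the rounded
  \<open>1 / \<delta>\<close>.\<close>

lemma confidence_bound:
  assumes \<delta>: "0 < \<delta>" "\<delta> < 1" and L: "L = Suc (bits (nat \<lceil>1 / \<delta>\<rceil>))"
  shows "real n * (2 * exp (- 2 * (real L + real n))) \<le> \<delta>"
proof -
  have "real n * (2 * exp (- 2 * real n)) \<le> 1"
  proof -
    have "2 * real n \<le> exp (2 * real n)" using exp_ge_add_one_self[of "2 * real n"] by linarith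
    then have "2 * real n * exp (- 2 * real n) \<le> exp (2 * real n) * exp (- 2 * real n)" by (intro mult_right_mono) auto
    then show ?thesis by (simp add: exp_add[symmetric] mult_ac)
  qed
  moreover have "exp (- 2 * real L) \<le> \<delta>"
  proof -
    have "nat \<lceil>1 / \<delta>\<rceil> < 2 ^ L" using L bits_le_iff[of "nat \<lceil>1 / \<delta>\<rceil>" L] by simp
    then have "real (nat \<lceil>1 / \<delta>\<rceil>) \<le> 2 ^ L" using of_nat_mono[of _ "2 ^ L", where 'a = real] by fastforce
    then have "1 / \<delta> \<le> 2 ^ L" using \<delta> by (meson of_nat_ceiling order_trans)
    also have "(2::real) ^ L \<le> exp 1 ^ L" using exp_ge_add_one_self[of 1] by (intro power_mono) auto
    also have "\<dots> = exp (real L)" by (simp add: exp_of_nat_mult[symmetric])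
    also have "\<dots> \<le> exp (2 * real L)" by simp
    finally have "1 / \<delta> * (\<delta> * exp (- 2 * real L)) \<le> exp (2 * real L) * (\<delta> * exp (- 2 * real L))"
      using \<delta> by (intro mult_right_mono) auto
    also have "\<dots> = \<delta>" by (simp add: exp_minus field_simps)
    finally show ?thesis using \<delta> by simp
  qed
  ultimately have "real n * (2 * exp (- 2 * real n)) * exp (- 2 * real L) \<le> 1 * \<delta>"
    by (intro mult_mono) auto
  moreover have "exp (- 2 * (real L + real n)) = exp (- 2 * real n) * exp (- 2 * real L)"
    by (simp add: exp_add[symmetric] algebra_simps)
  ultimately show ?thesis by (simp add: mult_ac)
qed

text \<open>Closure rules for this predicate yield the final time bound as a polynomial without
  computing its coefficients.\<close>

definition polynomial :: "(nat \<Rightarrow> nat) \<Rightarrow> bool" where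
  "polynomial f \<longleftrightarrow> (\<exists>p. f = poly p)"

lemma polynomial_const: "polynomial (\<lambda>_. k)"
  unfolding polynomial_def by (rule exI[of _ "[:k:]"]) auto

lemma polynomial_id: "polynomial (\<lambda>z. z)"
  unfolding polynomial_def by (rule exI[of _ "[:0, 1:]"]) auto

lemma polynomial_add: "polynomial f \<Longrightarrow> polynomial g \<Longrightarrow> polynomial (\<lambda>z. f z + g z)"
  unfolding polynomial_def by (auto simp: fun_eq_iff) (metis poly_add)

lemma polynomial_mult: "polynomial f \<Longrightarrow> polynomial g \<Longrightarrow> polynomial (\<lambda>z. f z * g z)"
  unfolding polynomial_def by (auto simp: fun_eq_iff) (metis poly_mult)

lemma polynomial_poly: "polynomial f \<Longrightarrow> polynomial (\<lambda>z. poly p (f z))"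
  unfolding polynomial_def by (auto simp: fun_eq_iff) (metis poly_pcompose)

lemmas polynomial_intros = polynomial_const polynomial_id polynomial_add polynomial_mult polynomial_poly

theorem theorem9:
  assumes "\<exists>c. poly_time_sampler c"
  shows "\<exists>c. BIS_fpras c"
proof -
  obtain c ps where samp: "sampler_bound c ps"
    using assms unfolding poly_time_sampler_def sampler_bound_def by blast
  obtain R0 where R0: "\<forall>x\<in>writes c. x < R0" using finite_writes finite_nat_set_iff_bounded by blast
  \<comment> \<open>The summand 2 puts both input registers of the sampler among those that are
    cleared.\<close>
  define R where "R = R0 + 2"
  have R: "writes c \<subseteq> {..<R}" "2 \<le> R" using R0 by (auto simp: R_def)
  \<comment> \<open>The functions with suffix \<open>z\<close> majorise the parameters of the
    program in terms of the single size \<open>z = n + e + l\<close>.\<close>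
  define Ez where "Ez z = 16 * z * z" for z :: nat
  define Lz where "Lz z = z + 3" for z :: nat
  define Nz where "Nz z = Ez z * Ez z * (Lz z + z)" for z
  define qz where "qz z = (z + 1) * z * z + Ez z" for z
  define bz where "bz z = qz z * (z + 1) + 1" for z
  define Tz where "Tz z = poly ps (2 * z + bz z + Ez z)" for z
  \<comment> \<open>A plain sum, so that every exponent occurring below is visibly smaller than
    \<open>K\<close>.\<close>
  define Kz where "Kz z = z + z * z + Lz z + Ez z + Nz z + Nz z * z + bz z + 2 * z + Tz z + 2" for z
  define Uz where "Uz z = 40 * (Kz z + 1)" for z
  define Sz where "Sz z = (R + 5) * Uz z + (14 * (z * z) + 15 * z + 20) * Uz z * Tz z" for z
  define Bz where "Bz z = (9 * z + 3 * Kz z + 30) * Uz z +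
     (z * (Uz z + (Nz z * (Uz z + Sz z) + 7 * Uz z)) + Uz z) + 2 * Uz z" for z
  have "polynomial Bz"
    unfolding Bz_def Sz_def Uz_def Kz_def Tz_def bz_def qz_def Nz_def Lz_def Ez_def
    by (intro polynomial_intros)
  then obtain pb where pb: "Bz = poly pb" unfolding polynomial_def by blast
  have "\<exists>r. exec (\<lambda>_. (0, 0)) (count_program R c) (input (graph_code (n, G) @ [nat \<lceil>1 / \<epsilon>\<rceil>, nat \<lceil>1 / \<delta>\<rceil>])) r \<and>
      (\<forall>(s, t)\<in>set_pmf r. t \<le> poly pb (n + nat \<lceil>1 / \<epsilon>\<rceil> + nat \<lceil>log 2 (1 / \<delta>)\<rceil>)) \<and>
      measure_pmf.prob r {(s, t). (1 - \<epsilon>) * real (card (independent_sets (n, G))) \<le> real (s 0) / real (s 1) \<and>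
         real (s 0) / real (s 1) \<le> (1 + \<epsilon>) * real (card (independent_sets (n, G)))} \<ge> 1 - \<delta>"
    if graph: "(n, G) \<in> bipartite_graphs" and \<epsilon>: "0 < \<epsilon>" "\<epsilon> < 1" and \<delta>: "0 < \<delta>" "\<delta> < 1" for n G and \<epsilon> \<delta> :: real
  proof -
    define e where "e = nat \<lceil>1 / \<epsilon>\<rceil>"
    define d where "d = nat \<lceil>1 / \<delta>\<rceil>"
    define l where "l = nat \<lceil>log 2 (1 / \<delta>)\<rceil>"
    define code where "code = set_encode ((\<lambda>(u, v). u * n + v) ` G)"
    define z where "z = n + e + l"
    define K where "K = Kz z"
    have G: "G \<subseteq> {..<n} \<times> {..<n}" using graph by (auto simp: bipartite_graphs_def)
    have e_real: "1 / \<epsilon> \<le> real e" unfolding e_def by (rule of_nat_ceiling)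
    have e: "0 < e" using e_real \<epsilon> by (cases e) auto
    have z: "n \<le> z" "e \<le> z" "l \<le> z" "1 \<le> z" using e by (auto simp: z_def)
    interpret bis_run n code e d K .
    \<comment> \<open>Links the rounded \<open>1 / \<delta>\<close>, which the program reads, to the
      rounded logarithm, on which its time may depend.\<close>
    have "d \<le> 2 ^ l"
    proof -
      have "log 2 (1 / \<delta>) \<le> real l" unfolding l_def by (rule of_nat_ceiling)
      then have "1 / \<delta> \<le> 2 powr real l" using \<delta> by (simp add: log_le_iff)
      then have "1 / \<delta> \<le> real (2 ^ l)" by (simp add: powr_realpow)
      then show ?thesis unfolding d_def by (simp only: nat_le_iff ceiling_le_iff of_int_of_nat_eq)
    qed
    then have d: "d < 2 ^ Suc l" by (rule le_less_trans) simp
    then have "bits d \<le> Suc l" by (simp add: bits_le_iff)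
    then have L: "L \<le> Lz z" using z by (simp add: L_def Lz_def)
    have E: "E \<le> Ez z" unfolding E_def Ez_def using z by (intro mult_le_mono) auto
    have N: "N \<le> Nz z" unfolding N_def Nz_def using E L z by (intro mult_le_mono add_mono) auto
    have pow: "x < 2 ^ K" if "x \<le> y" "y \<le> 2 ^ k" "k < K" for x y k :: nat
    proof -
      have "(2::nat) ^ k < 2 ^ K" using that(3) by (intro power_strict_increasing) auto
      then show ?thesis using that(1,2) by linarith
    qed
    have self: "x \<le> 2 ^ x" for x :: nat by (simp add: less_imp_le)
    have Mn: "M ^ n = 2 ^ (Suc n * n * n)" by (simp only: M_def power_mult)
    have nz: "Suc n * n * n \<le> (z + 1) * z * z" using z by (intro mult_le_mono) auto
    have Q: "Q \<le> 2 ^ qz z"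
    proof -
      have "Q \<le> 2 ^ (Suc n * n * n) * 2 ^ E" unfolding Q_def Mn using self by (intro mult_le_mono2)
      also have "\<dots> = 2 ^ (Suc n * n * n + E)" by (simp only: power_add)
      also have "\<dots> \<le> 2 ^ qz z" unfolding qz_def using nz E by (intro power_increasing add_mono) auto
      finally show ?thesis .
    qed
    have Q_pow: "Q ^ i \<le> 2 ^ (qz z * (z + 1))" if "i \<le> Suc n" for i
    proof -
      have "Q ^ i \<le> (2 ^ qz z) ^ i" using Q by (intro power_mono) auto
      also have "\<dots> = 2 ^ (qz z * i)" by (simp only: power_mult)
      also have "\<dots> \<le> 2 ^ (qz z * (z + 1))" using that z by (intro power_increasing mult_le_mono2) auto
      finally show ?thesis .
    qed
    have small: small_values
      unfolding small_values_def
    proof (intro conjI)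
      have le: "z < K" "z * z < K" "Lz z < K" "Ez z < K" "Nz z < K" "Nz z * z < K" "Suc z < K"
        "qz z < K" "qz z * (z + 1) < K" "(z + 1) * z * z < K"
        by (simp_all add: K_def Kz_def bz_def qz_def)
      show "n < 2 ^ K" using pow[OF z(1) self le(1)] .
      show "e < 2 ^ K" using pow[OF z(2) self le(1)] .
      have "code < 2 ^ (n * n)" unfolding code_def by (rule graph_code_less[OF G])
      moreover have "n * n \<le> z * z" using z by (intro mult_le_mono)
      ultimately show "code < 2 ^ K" using le(2) by (intro pow[OF order_refl, of _ "n * n"]) auto
      show "d < 2 ^ K" using d le(7) z by (intro pow[OF order_refl, of _ "Suc l"]) auto
      show "L < 2 ^ K" using pow[OF L self le(3)] .
      show "E < 2 ^ K" using pow[OF E self le(4)] .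
      show "N < 2 ^ K" using pow[OF N self le(5)] .
      have "N ^ n \<le> (2 ^ N) ^ n" using self by (intro power_mono) auto
      also have "\<dots> = 2 ^ (N * n)" by (simp only: power_mult)
      finally have "N ^ n \<le> 2 ^ (N * n)" .
      moreover have "N * n < K" using mult_le_mono[OF N z(1)] le(6) by linarith
      ultimately show "N ^ n < 2 ^ K" by (rule pow[OF order_refl])
      show "(2::nat) ^ Suc n < 2 ^ K" using z le(7) by (intro pow[OF order_refl order_refl]) auto
      show "M ^ n < 2 ^ K" unfolding Mn using nz le(10) by (intro pow[OF order_refl order_refl]) auto
      have "M = 2 ^ (Suc n * n)" by (simp only: M_def power_mult)
      moreover have "Suc n * n * 1 \<le> (z + 1) * z * z" using z by (intro mult_le_mono) auto
      ultimately show "M < 2 ^ K" using le(10) by (intro pow[OF order_refl, of _ "Suc n * n"]) auto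
      show "Q < 2 ^ K" using pow[OF order_refl Q le(8)] .
      show "Q ^ Suc n < 2 ^ K" using pow[OF order_refl Q_pow[OF order_refl] le(9)] .
    qed
    define T where "T = Tz z"
    define k where "k m = card (prefix_independent n G m)" for m
    have k_pos: "0 < k m" for m
    proof -
      have "{} \<in> prefix_independent n G m" by (simp add: prefix_independent_def)
      then show ?thesis unfolding k_def using finite_prefix_independent by (auto simp: card_gt_0_iff)
    qed
    have k_mono: "k m \<le> k (m - 1)" for m
      unfolding k_def using finite_prefix_independent
      by (intro card_mono) (auto simp: prefix_independent_def)
    have four: "real (4 ^ n) / real Q \<le> 1 / real E" if "0 < n"
    proof -
      have "n * 2 \<le> Suc n * n * n" using that by (cases n) auto
      then have "(2::nat) ^ (n * 2) \<le> M ^ n" unfolding Mn by (intro power_increasing) auto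
      moreover have "(4::nat) ^ n = 2 ^ (n * 2)" unfolding mult.commute[of n 2] power_mult by simp
      ultimately have "(4::nat) ^ n \<le> M ^ n" by simp
      then have "real (4 ^ n) \<le> real (M ^ n)" by (simp only: of_nat_le_iff)
      moreover have "0 < E" using that e by (simp add: E_def)
      ultimately show ?thesis by (simp add: Q_def M_def field_simps)
    qed
    have "\<exists>r. exec (eval_context.weight_oracle n code m Q) c (input [2 * n, E]) r \<and>
       (\<forall>(s, t) \<in> set_pmf r. t \<le> T) \<and>
       \<bar>measure_pmf.prob r {(s, t). m - 1 \<notin> set_decode (s 0)} - k (m - 1) / (2 * k m)\<bar> \<le> 2 / E"
      if m: "0 < m" "m \<le> n" for m
    proof -
      have n: "0 < n" using m by simp
      have ctx: "eval_context n code m Q K" using eval_context[OF small n e m(2)] .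
      have b: "Q ^ n < 2 ^ bz z"
      proof -
        have "Q ^ n \<le> 2 ^ (qz z * (z + 1))" by (rule Q_pow) simp
        also have "(2::nat) ^ (qz z * (z + 1)) < 2 ^ bz z" unfolding bz_def by (intro power_strict_increasing) auto
        finally show ?thesis .
      qed
      have E0: "0 < E" using n e by (simp add: E_def)
      obtain r where r: "exec (eval_context.weight_oracle n code m Q) c (input [2 * n, E]) r"
        "\<forall>(s, t) \<in> set_pmf r. t \<le> poly ps (2 * n + bz z + E)"
        "\<bar>measure_pmf.prob r {(s, t). m - 1 \<notin> set_decode (s 0)} - k (m - 1) / (2 * k m)\<bar> \<le> 1 / E + 4 ^ n / Q"
        using sampler_marginal[OF samp graph code_def ctx m b E0] unfolding k_def by blast
      have "poly ps (2 * n + bz z + E) \<le> T"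
        unfolding T_def Tz_def using z E by (intro poly_nat_mono) auto
      then have "\<forall>(s, t) \<in> set_pmf r. t \<le> T" using r(2) by (auto intro: order_trans)
      moreover have "1 / real E + 4 ^ n / real Q \<le> 2 / real E" using four[OF n] by simp
      ultimately show ?thesis using r(1,3) by (intro exI[of _ r]) auto
    qed
    then obtain r where r: "\<And>m. 0 < m \<Longrightarrow> m \<le> n \<Longrightarrow> exec (eval_context.weight_oracle n code m Q) c (input [2 * n, E]) (r m)"
      "\<And>m. 0 < m \<Longrightarrow> m \<le> n \<Longrightarrow> \<forall>(s, t) \<in> set_pmf (r m). t \<le> T"
      "\<And>m. 0 < m \<Longrightarrow> m \<le> n \<Longrightarrow>
        \<bar>measure_pmf.prob (r m) {(s, t). m - 1 \<notin> set_decode (s 0)} - k (m - 1) / (2 * k m)\<bar> \<le> 2 / E"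
      by metis
    interpret bis_sampler n code e d K c R T r
    proof
      have "bits (2 * n) + bits E + T \<le> 2 * z + Ez z + Tz z"
        using bits_le[of "2 * n"] bits_le[of E] E z by (auto simp: T_def)
      then show "bits (2 * n) + bits E + T \<le> K" by (simp add: K_def Kz_def)
    qed (use small e R r in auto)
    define P where "P a \<longleftrightarrow> (1 - \<epsilon>) * real (k n) \<le> real (N ^ n) / real a \<and>
      real (N ^ n) / real a \<le> (1 + \<epsilon>) * real (k n)" for a :: nat
    have bad: "measure_pmf.prob (estimate n) {a. \<not> P a} \<le> \<delta>"
    proof (cases "n = 0")
      \<comment> \<open>Here \<open>E\<close> and \<open>N\<close> are zero and no stage is run; the
        empty product 1 is the exact count, as only the empty set is independent.\<close>
      case True
      then have "k n = 1" by (simp add: k_def prefix_independent_def)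
      then have "P 1" using True \<epsilon> by (simp add: P_def)
      moreover have "estimate n = return_pmf 1" unfolding estimate_def by (simp only: True iterate.simps)
      ultimately show ?thesis using \<delta> by simp
    next
      case False
      then have n: "0 < n" by simp
      have E16: "0 < E" using n e by (simp add: E_def)
      have N0: "0 < N" using E16 by (simp add: N_def L_def)
      define x where "x = 6 / real E"
      have k0: "k 0 = 2 ^ n" by (simp add: k_def prefix_independent_0 card_Pow)
      have "16 \<le> E" using n e unfolding E_def by (cases n; cases e) auto
      then have x: "0 \<le> x" "x \<le> 1" by (simp_all add: x_def)
      have nx: "real n * x \<le> 3 / 8 * \<epsilon>"
      proof -
        have "real n * x = 3 / 8 * (1 / real e)" using n e by (simp add: x_def E_def)
        also have "1 / real e \<le> \<epsilon>" using e_real \<epsilon> e by (simp add: field_simps)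
        finally show ?thesis by simp
      qed
      have good: "P a" if "(1 - x) ^ n * (real (k 0) / (2 ^ n * real (k n))) * real N ^ n \<le> real a \<and>
          real a \<le> (1 + x) ^ n * (real (k 0) / (2 ^ n * real (k n))) * real N ^ n" for a
      proof -
        have "real (k 0) / (2 ^ n * real (k n)) = 1 / real (k n)" using k0 by simp
        then show ?thesis unfolding P_def of_nat_power
          using count_accuracy[OF \<epsilon> x nx, of "real (k n)" "real N ^ n" "real a"] k_pos[of n] N0 that by simp
      qed
      have "measure_pmf.prob (estimate n) {a. \<not> P a} \<le> measure_pmf.prob (estimate n)
        {a. \<not> ((1 - x) ^ n * (real (k 0) / (2 ^ n * real (k n))) * real N ^ n \<le> real a \<and>
          real a \<le> (1 + x) ^ n * (real (k 0) / (2 ^ n * real (k n))) * real N ^ n)}"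
        using good by (intro measure_pmf.finite_measure_mono) auto
      also have "\<dots> \<le> n * (2 * exp (- 2 * (real L + real n)))"
        unfolding x_def by (rule estimate_concentration[OF n]) (use k_pos k_mono r(3) in \<open>auto simp: p_def\<close>)
      also have "\<dots> \<le> \<delta>" by (rule confidence_bound[OF \<delta>]) (unfold L_def, simp only: d_def)
      finally show ?thesis .
    qed
    define B where "B = (9 * n + 3 * K + 30) * U + (n * (U + (N * (U + S) + 7 * U)) + U) + 2 * U"
    have U: "U = Uz z" by (simp add: Uz_def K_def)
    have S: "S \<le> Sz z"
      unfolding Sz_def U[symmetric] T_def[symmetric] power2_eq_square
      using z by (intro add_mono mult_le_mono) auto
    have B: "B \<le> Bz z"
      unfolding B_def Bz_def K_def[symmetric] U[symmetric]
      using z N S by (intro add_mono mult_le_mono) auto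
    obtain r where ex: "exec (\<lambda>_. (0, 0)) (count_program R c) (input [n, code, e, d]) r"
      and rel: "rel_pmf (\<lambda>(s', t) a. t \<le> B \<and> s' 0 = N ^ n \<and> s' 1 = a) r (estimate n)"
      using runs_count_program unfolding runs_def runsT_def B_def by blast
    have time: "\<forall>(s, t)\<in>set_pmf r. t \<le> poly pb z"
    proof safe
      fix s t assume "(s, t) \<in> set_pmf r"
      from rel_pmf_supp1[OF rel this] have "t \<le> B" by auto
      also have "B \<le> poly pb z" using B by (simp add: pb)
      finally show "t \<le> poly pb z" .
    qed
    define A where "A = {(s :: state, t :: nat). (1 - \<epsilon>) * real (k n) \<le> real (s 0) / real (s 1) \<and>
         real (s 0) / real (s 1) \<le> (1 + \<epsilon>) * real (k n)}"
    \<comment> \<open>The coupling carries the failure probability over from the ideal estimate to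
      the actual run.\<close>
    have "measure_pmf.prob r (- A) \<le> measure_pmf.prob (estimate n)
        {a. \<exists>x\<in>- A. case x of (s', t) \<Rightarrow> t \<le> B \<and> s' 0 = N ^ n \<and> s' 1 = a}"
      using rel_pmf_measureD[OF rel, of "- A"] by (simp add: case_prod_unfold)
    also have "\<dots> \<le> measure_pmf.prob (estimate n) {a. \<not> P a}"
    proof (rule measure_pmf.finite_measure_mono)
      show "{a. \<exists>x\<in>- A. case x of (s', t) \<Rightarrow> t \<le> B \<and> s' 0 = N ^ n \<and> s' 1 = a} \<subseteq> {a. \<not> P a}"
      proof safe
        fix s :: state and t :: nat
        assume "(s, t) \<notin> A" "s 0 = N ^ n" "P (s 1)"
        then show False by (simp add: A_def P_def)
      qed
    qed simp
    also note bad
    finally have "1 - \<delta> \<le> measure_pmf.prob r A"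
      using measure_pmf.prob_compl[of A r] by (simp add: Compl_eq_Diff_UNIV)
    moreover have "k n = card (independent_sets (n, G))" by (simp add: k_def prefix_independent_n)
    moreover have "input (graph_code (n, G) @ [nat \<lceil>1 / \<epsilon>\<rceil>, nat \<lceil>1 / \<delta>\<rceil>]) = input [n, code, e, d]"
      by (simp add: graph_code_def code_def e_def d_def)
    ultimately show ?thesis using ex time unfolding A_def z_def e_def l_def by auto
  qed
  then have "BIS_fpras (count_program R c)"
    unfolding BIS_fpras_def is_fpras_def
    by (intro conjI query_free_count_program exI[of _ pb]) auto
  then show ?thesis ..
qed

end
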